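(* Assume that $A,A_1,C,C_1$ are bounded adapted $\mathbb{R}^{n\times n}$-valued processes, $B,D$ are bounded adapted $\mathbb{R}^{n\times m}$-valued processes, $Q,Q_1$ are bounded adapted $\mathbb{S}^n_+$-valued processes, $R$ is a bounded adapted $\mathbb{S}^m_+$-valued process, $G$ is a bounded $\mathcal{F}_T$-measurable $\mathbb{S}^n_+$-valued random matrix, and there is $\delta>0$ with $R(s)\ge\delta I_m$ for a.e. $s\in[0,T]$, a.s. Let $\alpha^*(\cdot)\in\mathbb{L}^2_0$ be any solution of $$(\mathcal{K}_1^*Q\mathcal{K}_1+\mathbb{E}Q_1+\mathcal{K}_2^*R\mathcal{K}_2+\mathcal{K}_3^*G\mathcal{K}_3)\alpha^*+(\mathcal{K}_1^*Q\mathcal{P}_1+\mathcal{K}_2^*R\mathcal{P}_2+\mathcal{K}_3^*G\mathcal{P}_3)x=0,$$ and let $\lambda^*(\cdot)\in\mathbb{L}^2$ be any solution $\lambda$ of $$\alpha^*(t)=(\mathcal{P}x)(t)+(\mathcal{L}_1\lambda)(t)+(\mathcal{L}_2\alpha^* )(t).$$ Then the optimal control $u^*(\cdot)$ of Problem (MFSLQ) is given by $$R(s)u^*(s)+B(s)^\top Y(s)+D(s)^\top Z(s)=0,\quad\text{a.e. }s\in[0,T],\ \text{a.s.},$$ where $(X,Y,Z)$ is the solution of the forward-backward system, for $s\in[0,T]$, $$\begin{cases} dX(s)=\{AX-BR^{-1}[B^\top Y+D^\top Z]+A_1\alpha^*\}ds+\{CX-DR^{-1}[B^\top Y+D^\top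 Z]+C_1\alpha^*\}dW(s),\\ dY(s)=-[A^\top Y+C^\top Z+QX+\lambda^*]ds+Z(s)dW(s),\\ X(0)=x,\quad Y(T)=GX(T).\end{cases}$$
   Context: $(\Omega,\mathcal{F},\mathbb{F},\mathbb{P})$ is a complete filtered probability space carrying a one-dimensional standard Brownian motion $W$, and $\mathbb{F}=\{\mathcal{F}_t\}$ is the natural filtration of $W$ augmented by the $\mathbb{P}$-null sets. $T>0$ and $x\in\mathbb{R}^n$ are fixed. $\mathbb{S}^k_+$ denotes the $k\times k$ positive semi-definite matrices. "Adapted" means $\mathcal{F}_t$-adapted. $\mathcal{U}$ is the set of adapted $\mathbb{R}^m$-valued $u$ with $\mathbb{E}\int_0^T|u|^2dt<\infty$. $\mathbb{L}^2=L^2([0,T];\mathbb{R}^n)$ (deterministic functions). $L^{2,c}_{\mathbb{F}}(\mathbb{R}^n)$: continuous adapted processes with $\mathbb{E}[\sup_{s\le T}|X(s)|^2]<\infty$; $L^2_{\mathbb{F}}(\mathbb{R}^n)$: adapted processes with $\mathbb{E}\int_0^T|X|^2ds<\infty$; $L^2_{\mathcal{F}_T}(\mathbb{R}^n)$: square-integrable $\mathcal{F}_T$-measurable random vectors. Problem (MFSLQ): minimize over $u\in\mathcal{U}$ $$J(u(\cdot))=\mathbb{E}\Big\{\int_0^T\big(\langle QX,X\rangle+\langle Q_1\mathbb{E}X,\mathbb{E}X\rangle+\langle Ru,u\rangle\big)ds+\langle GX(T),X(T)\rangle\Big\},$$ where $X=X^u$ solves $dX=[AX+A_1\mathbb{E}X+Bu]ds+[CX+C_1\mathbb{E}X+Du]dW$,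 $X(0)=x$. An optimal control is a minimizer. $\mathbb{L}^2_0$ is the set of $\alpha\in\mathbb{L}^2$ such that $\mathbb{E}X^u(\cdot)=\alpha(\cdot)$ for some $u\in\mathcal{U}$. For $\alpha,\lambda$, let $(X_{\alpha,\lambda},Y_{\alpha,\lambda},Z_{\alpha,\lambda})\in(L^{2,c}_{\mathbb{F}}(\mathbb{R}^n))^2\times L^2_{\mathbb{F}}(\mathbb{R}^n)$ be the unique adapted solution of the forward-backward system displayed in the claim with $(\alpha^*,\lambda^* )$ replaced by $(\alpha,\lambda)$. It depends linearly on $(x,\lambda,\alpha)$, and $\mathcal{P},\mathcal{L}_1,\mathcal{L}_2$ are the $\mathbb{L}^2$-valued linear operators defined by $\mathbb{E}X_{\alpha,\lambda}(\cdot)=(\mathcal{P}x)(\cdot)+(\mathcal{L}_1\lambda)(\cdot)+(\mathcal{L}_2\alpha)(\cdot)$. For $\alpha\in\mathbb{L}^2_0$, let $$\hat J_\alpha(u(\cdot))=\mathbb{E}\Big\{\int_0^T\big(\langle QX,X\rangle+\langle Q_1\alpha,\alpha\rangle+\langle Ru,u\rangle\big)ds+\langle GX(T),X(T)\rangle\Big\},$$ and let $u^*_\alpha$ be the unique minimizer of $\hat J_\alpha(u)$ over $u\in\mathcal{U}$ with $\mathbb{E}X^u=\alpha$ (with $X=X^u$). Let $X$ be the state for $u^*_\alpha$, i.e. the solution of $dX=[AX+Bu^*_\alpha+A_1\alpha]ds+[CX+Du^*_\alpha+C_1\alpha]dW$, $X(0)=x$. Fix linear operators $\mathcal{P}_i,\mathcal{K}_i$,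 $i=1,2,3$ (with $\mathcal{P}_i$ acting on $\mathbb{R}^n$ and $\mathcal{K}_i$ acting on a linear subspace $\mathcal{D}\subset\mathbb{L}^2$ containing $\mathbb{L}^2_0$) such that for every $\alpha\in\mathbb{L}^2_0$ $$u^*_\alpha=\mathcal{P}_2x+\mathcal{K}_2\alpha\in\mathcal{U},\qquad X=\mathcal{P}_1x+\mathcal{K}_1\alpha\in L^2_{\mathbb{F}}(\mathbb{R}^n),\qquad X(T)=\mathcal{P}_3x+\mathcal{K}_3\alpha\in L^2_{\mathcal{F}_T}(\mathbb{R}^n).$$ $\mathcal{K}_i^*$ denotes the adjoint of $\mathcal{K}_i$, taking values in $\mathbb{L}^2$: $\langle\mathcal{K}_i^*\xi,\beta\rangle_{\mathbb{L}^2}=\langle\xi,\mathcal{K}_i\beta\rangle$ for $\beta\in\mathcal{D}$, where the right-hand inner product is that of $L^2_{\mathbb{F}}(\mathbb{R}^n)$, $\mathcal{U}$, $L^2_{\mathcal{F}_T}(\mathbb{R}^n)$ for $i=1,2,3$ respectively. $Q,R,G$ act by pointwise multiplication, and $\mathbb{E}Q_1$ acts by multiplication by $s\mapsto\mathbb{E}[Q_1(s)]$. *)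

theory Defs
  imports "HOL-Probability.Probability"
begin

section \<open>Brownian motion and its augmented filtration\<close>

definition brownian_motion :: "'w measure \<Rightarrow> (real \<Rightarrow> 'w \<Rightarrow> real) \<Rightarrow> bool" where
  "brownian_motion M W \<longleftrightarrow>
     (\<forall>t\<ge>0. W t \<in> borel_measurable M) \<and>
     (AE \<omega> in M. W 0 \<omega> = 0) \<and>
     (\<forall>s t. 0 \<le> s \<longrightarrow> s < t \<longrightarrow>
        distributed M lborel (\<lambda>\<omega>. W t \<omega> - W s \<omega>) (normal_density 0 (sqrt (t - s)))) \<and>
     (\<forall>(k::nat) \<tau>. 0 \<le> \<tau> 0 \<longrightarrow> (\<forall>i<k. \<tau> i \<le> \<tau> (Suc i)) \<longrightarrow>
        prob_space.indep_vars M (\<lambda>_. borel) (\<lambda>i \<omega>. W (\<tau> (Suc i)) \<omega> - W (\<tau> i) \<omega>) {..<k}) \<and>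
     (AE \<omega> in M. continuous_on {0..} (\<lambda>t. W t \<omega>))"

definition brownian_filtration :: "'w measure \<Rightarrow> (real \<Rightarrow> 'w \<Rightarrow> real) \<Rightarrow> real \<Rightarrow> 'w measure" where
  "brownian_filtration M W t =
     sigma (space M) ({W s -` S \<inter> space M |s S. s \<in> {0..t} \<and> S \<in> sets borel} \<union> null_sets M)"

section \<open>Spaces of functions, random vectors and processes\<close>

text \<open>Elements of the various \<open>L\<^sup>2\<close>-spaces are represented by functions; two functions represent
  the same element iff they agree almost everywhere.\<close>

abbreviation dt :: "real \<Rightarrow> real measure" where
  "dt T \<equiv> restrict_space lborel {0..T}"

abbreviation dtP :: "'w measure \<Rightarrow> real \<Rightarrow> (real \<times> 'w) measure" where
  "dtP M T \<equiv> dt T \<Otimes>\<^sub>M M"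

definition L2 :: "'c measure \<Rightarrow> ('c \<Rightarrow> 'v::euclidean_space) set" where
  "L2 \<nu> = {f \<in> borel_measurable \<nu>. integrable \<nu> (\<lambda>z. (norm (f z))\<^sup>2)}"

definition ip :: "'c measure \<Rightarrow> ('c \<Rightarrow> 'v::euclidean_space) \<Rightarrow> ('c \<Rightarrow> 'v) \<Rightarrow> real" where
  "ip \<nu> f g = (LINT z|\<nu>. f z \<bullet> g z)"

text \<open>Adapted processes are understood to be jointly measurable in time and scenario, so that
  their time integrals make sense.\<close>

definition adapted ::
    "'w measure \<Rightarrow> (real \<Rightarrow> 'w \<Rightarrow> real) \<Rightarrow> real \<Rightarrow> (real \<Rightarrow> 'w \<Rightarrow> 'v::euclidean_space) \<Rightarrow> bool" where
  "adapted M W T X \<longleftrightarrow>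
     case_prod X \<in> borel_measurable (dtP M T) \<and>
     (\<forall>t\<in>{0..T}. X t \<in> borel_measurable (brownian_filtration M W t))"

definition bounded_adapted ::
    "'w measure \<Rightarrow> (real \<Rightarrow> 'w \<Rightarrow> real) \<Rightarrow> real \<Rightarrow> (real \<Rightarrow> 'w \<Rightarrow> 'v::euclidean_space) \<Rightarrow> bool" where
  "bounded_adapted M W T X \<longleftrightarrow>
     adapted M W T X \<and> (\<exists>c. AE (s, \<omega>) in dtP M T. norm (X s \<omega>) \<le> c)"

definition L2F ::
    "'w measure \<Rightarrow> (real \<Rightarrow> 'w \<Rightarrow> real) \<Rightarrow> real \<Rightarrow> (real \<Rightarrow> 'w \<Rightarrow> 'v::euclidean_space) set" where
  "L2F M W T = {X. adapted M W T X \<and> case_prod X \<in> L2 (dtP M T)}"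

definition L2Fc ::
    "'w measure \<Rightarrow> (real \<Rightarrow> 'w \<Rightarrow> real) \<Rightarrow> real \<Rightarrow> (real \<Rightarrow> 'w \<Rightarrow> 'v::euclidean_space) set" where
  "L2Fc M W T =
     {X. adapted M W T X \<and> (AE \<omega> in M. continuous_on {0..T} (\<lambda>t. X t \<omega>)) \<and>
         (\<integral>\<^sup>+ \<omega>. (SUP t\<in>{0..T}. ennreal ((norm (X t \<omega>))\<^sup>2)) \<partial>M) < \<infinity>}"

definition L2FT ::
    "'w measure \<Rightarrow> (real \<Rightarrow> 'w \<Rightarrow> real) \<Rightarrow> real \<Rightarrow> ('w \<Rightarrow> 'v::euclidean_space) set" where
  "L2FT M W T = {\<xi> \<in> borel_measurable (brownian_filtration M W T). \<xi> \<in> L2 M}"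

definition mean :: "'w measure \<Rightarrow> (real \<Rightarrow> 'w \<Rightarrow> 'v::euclidean_space) \<Rightarrow> real \<Rightarrow> 'v" where
  "mean M X s = (LINT \<omega>|M. X s \<omega>)"

section \<open>The Ito integral\<close>

text \<open>A simple process is \<open>\<Sum>i<N. \<xi> i \<cdot> 1_{(\<tau> i, \<tau> (i+1)]}\<close> with bounded \<open>\<xi> i\<close>, measurable with
  respect to the \<open>\<sigma>\<close>-algebra at time \<open>\<tau> i\<close>.\<close>

definition simple_data ::
    "'w measure \<Rightarrow> (real \<Rightarrow> 'w \<Rightarrow> real) \<Rightarrow> real \<Rightarrow> nat \<Rightarrow> (nat \<Rightarrow> real) \<Rightarrow>
     (nat \<Rightarrow> 'w \<Rightarrow> 'v::euclidean_space) \<Rightarrow> bool" where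
  "simple_data M W T N \<tau> \<xi> \<longleftrightarrow>
     0 \<le> \<tau> 0 \<and> \<tau> N \<le> T \<and> (\<forall>i<N. \<tau> i \<le> \<tau> (Suc i)) \<and>
     (\<forall>i<N. \<xi> i \<in> borel_measurable (brownian_filtration M W (\<tau> i)) \<and>
            (\<exists>c. \<forall>\<omega>\<in>space M. norm (\<xi> i \<omega>) \<le> c))"

definition simple_process ::
    "nat \<Rightarrow> (nat \<Rightarrow> real) \<Rightarrow> (nat \<Rightarrow> 'w \<Rightarrow> 'v::euclidean_space) \<Rightarrow> real \<Rightarrow> 'w \<Rightarrow> 'v" where
  "simple_process N \<tau> \<xi> t \<omega> = (\<Sum>i<N. indicator {\<tau> i<..\<tau> (Suc i)} t *\<^sub>R \<xi> i \<omega>)"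

definition simple_integral ::
    "(real \<Rightarrow> 'w \<Rightarrow> real) \<Rightarrow> nat \<Rightarrow> (nat \<Rightarrow> real) \<Rightarrow> (nat \<Rightarrow> 'w \<Rightarrow> 'v::euclidean_space) \<Rightarrow>
     real \<Rightarrow> 'w \<Rightarrow> 'v" where
  "simple_integral W N \<tau> \<xi> t \<omega> =
     (\<Sum>i<N. (W (min t (\<tau> (Suc i))) \<omega> - W (min t (\<tau> i)) \<omega>) *\<^sub>R \<xi> i \<omega>)"

text \<open>\<open>I t\<close> is a version of the integral of \<open>H\<close> over \<open>[0,t]\<close> against \<open>W\<close>: the \<open>L\<^sup>2\<close>-limit of the
  integrals of simple processes that approximate \<open>H\<close>. By the isometry the limit does not depend on
  the approximating sequence. Path continuity is not part of the definition; below it is enforced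
  through the processes defined by means of \<open>I\<close>.\<close>

definition ito_integral ::
    "'w measure \<Rightarrow> (real \<Rightarrow> 'w \<Rightarrow> real) \<Rightarrow> real \<Rightarrow> (real \<Rightarrow> 'w \<Rightarrow> 'v::euclidean_space) \<Rightarrow>
     (real \<Rightarrow> 'w \<Rightarrow> 'v) \<Rightarrow> bool" where
  "ito_integral M W T H I \<longleftrightarrow>
     H \<in> L2F M W T \<and>
     (\<forall>t\<in>{0..T}. I t \<in> borel_measurable (brownian_filtration M W t)) \<and>
     (\<exists>N \<tau> \<xi>.
        (\<forall>k::nat. simple_data M W T (N k) (\<tau> k) (\<xi> k)) \<and>
        (\<lambda>k. \<integral>\<^sup>+ (s, \<omega>). ennreal ((norm (simple_process (N k) (\<tau> k) (\<xi> k) s \<omega> - H s \<omega>))\<^sup>2)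
                \<partial>(dtP M T)) \<longlonglongrightarrow> 0 \<and>
        (\<forall>t\<in>{0..T}.
          (\<lambda>k. \<integral>\<^sup>+ \<omega>. ennreal ((norm (simple_integral W (N k) (\<tau> k) (\<xi> k) t \<omega> - I t \<omega>))\<^sup>2) \<partial>M)
             \<longlonglongrightarrow> 0))"

text \<open>\<open>dX = b ds + \<sigma> dW\<close> on \<open>[0,T]\<close>\<close>

definition ito_diff ::
    "'w measure \<Rightarrow> (real \<Rightarrow> 'w \<Rightarrow> real) \<Rightarrow> real \<Rightarrow> (real \<Rightarrow> 'w \<Rightarrow> 'v::euclidean_space) \<Rightarrow>
     (real \<Rightarrow> 'w \<Rightarrow> 'v) \<Rightarrow> (real \<Rightarrow> 'w \<Rightarrow> 'v) \<Rightarrow> bool" where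
  "ito_diff M W T X b \<sigma> \<longleftrightarrow>
     (AE \<omega> in M. integrable (dt T) (\<lambda>s. b s \<omega>)) \<and>
     (\<exists>I. ito_integral M W T \<sigma> I \<and>
        (AE \<omega> in M. \<forall>t\<in>{0..T}. X t \<omega> = X 0 \<omega> + (LINT s|dt t. b s \<omega>) + I t \<omega>))"

section \<open>The mean-field linear-quadratic problem\<close>

record ('w, 'n, 'm) lq_coeffs =
  cA  :: "real \<Rightarrow> 'w \<Rightarrow> real^'n^'n"
  cA1 :: "real \<Rightarrow> 'w \<Rightarrow> real^'n^'n"
  cB  :: "real \<Rightarrow> 'w \<Rightarrow> real^'m^'n"
  cC  :: "real \<Rightarrow> 'w \<Rightarrow> real^'n^'n"
  cC1 :: "real \<Rightarrow> 'w \<Rightarrow> real^'n^'n"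
  cD  :: "real \<Rightarrow> 'w \<Rightarrow> real^'m^'n"
  cQ  :: "real \<Rightarrow> 'w \<Rightarrow> real^'n^'n"
  cQ1 :: "real \<Rightarrow> 'w \<Rightarrow> real^'n^'n"
  cR  :: "real \<Rightarrow> 'w \<Rightarrow> real^'m^'m"
  cG  :: "'w \<Rightarrow> real^'n^'n"

definition psd :: "real^'k^'k \<Rightarrow> bool" where
  "psd S \<longleftrightarrow> transpose S = S \<and> (\<forall>v. 0 \<le> (S *v v) \<bullet> v)"

text \<open>State equation and cost with the mean \<open>\<bbbE>X\<close> replaced by a deterministic function \<open>\<alpha>\<close>.\<close>

definition frozen_state ::
    "'w measure \<Rightarrow> (real \<Rightarrow> 'w \<Rightarrow> real) \<Rightarrow> real \<Rightarrow> ('w, 'n::finite, 'm::finite) lq_coeffs \<Rightarrow> real^'n \<Rightarrow>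
     (real \<Rightarrow> real^'n) \<Rightarrow> (real \<Rightarrow> 'w \<Rightarrow> real^'m) \<Rightarrow> (real \<Rightarrow> 'w \<Rightarrow> real^'n) \<Rightarrow> bool" where
  "frozen_state M W T S x \<alpha> u X \<longleftrightarrow>
     X \<in> L2Fc M W T \<and>
     ito_diff M W T X
       (\<lambda>s \<omega>. cA S s \<omega> *v X s \<omega> + cA1 S s \<omega> *v \<alpha> s + cB S s \<omega> *v u s \<omega>)
       (\<lambda>s \<omega>. cC S s \<omega> *v X s \<omega> + cC1 S s \<omega> *v \<alpha> s + cD S s \<omega> *v u s \<omega>) \<and>
     (AE \<omega> in M. X 0 \<omega> = x)"

definition frozen_cost ::
    "'w measure \<Rightarrow> real \<Rightarrow> ('w, 'n::finite, 'm::finite) lq_coeffs \<Rightarrow>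
     (real \<Rightarrow> real^'n) \<Rightarrow> (real \<Rightarrow> 'w \<Rightarrow> real^'m) \<Rightarrow> (real \<Rightarrow> 'w \<Rightarrow> real^'n) \<Rightarrow> real" where
  "frozen_cost M T S \<alpha> u X =
     (LINT \<omega>|M.
        (LINT s|dt T. (cQ S s \<omega> *v X s \<omega>) \<bullet> X s \<omega> + (cQ1 S s \<omega> *v \<alpha> s) \<bullet> \<alpha> s
                      + (cR S s \<omega> *v u s \<omega>) \<bullet> u s \<omega>)
        + (cG S \<omega> *v X T \<omega>) \<bullet> X T \<omega>)"

definition mf_state ::
    "'w measure \<Rightarrow> (real \<Rightarrow> 'w \<Rightarrow> real) \<Rightarrow> real \<Rightarrow> ('w, 'n::finite, 'm::finite) lq_coeffs \<Rightarrow> real^'n \<Rightarrow>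
     (real \<Rightarrow> 'w \<Rightarrow> real^'m) \<Rightarrow> (real \<Rightarrow> 'w \<Rightarrow> real^'n) \<Rightarrow> bool" where
  "mf_state M W T S x u X \<longleftrightarrow> frozen_state M W T S x (mean M X) u X"

definition mf_cost ::
    "'w measure \<Rightarrow> real \<Rightarrow> ('w, 'n::finite, 'm::finite) lq_coeffs \<Rightarrow>
     (real \<Rightarrow> 'w \<Rightarrow> real^'m) \<Rightarrow> (real \<Rightarrow> 'w \<Rightarrow> real^'n) \<Rightarrow> real" where
  "mf_cost M T S u X = frozen_cost M T S (mean M X) u X"

text \<open>The set of admissible controls is \<open>L2F M W T\<close>. The solution of the state equation being unique
  up to indistinguishability, \<open>J(u)\<close> is \<open>mf_cost M T S u X\<close> for any solution \<open>X\<close>.\<close>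

definition optimal_control ::
    "'w measure \<Rightarrow> (real \<Rightarrow> 'w \<Rightarrow> real) \<Rightarrow> real \<Rightarrow> ('w, 'n::finite, 'm::finite) lq_coeffs \<Rightarrow> real^'n \<Rightarrow>
     (real \<Rightarrow> 'w \<Rightarrow> real^'m) \<Rightarrow> bool" where
  "optimal_control M W T S x u \<longleftrightarrow>
     u \<in> L2F M W T \<and>
     (\<exists>X. mf_state M W T S x u X \<and>
          (\<forall>v\<in>L2F M W T. \<forall>X'. mf_state M W T S x v X' \<longrightarrow> mf_cost M T S u X \<le> mf_cost M T S v X'))"

definition constrained_pair ::
    "'w measure \<Rightarrow> (real \<Rightarrow> 'w \<Rightarrow> real) \<Rightarrow> real \<Rightarrow> ('w, 'n::finite, 'm::finite) lq_coeffs \<Rightarrow> real^'n \<Rightarrow>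
     (real \<Rightarrow> real^'n) \<Rightarrow> (real \<Rightarrow> 'w \<Rightarrow> real^'m) \<Rightarrow> (real \<Rightarrow> 'w \<Rightarrow> real^'n) \<Rightarrow> bool" where
  "constrained_pair M W T S x \<alpha> u X \<longleftrightarrow>
     u \<in> L2F M W T \<and> mf_state M W T S x u X \<and> (AE t in dt T. mean M X t = \<alpha> t)"

definition attainable_means ::
    "'w measure \<Rightarrow> (real \<Rightarrow> 'w \<Rightarrow> real) \<Rightarrow> real \<Rightarrow> ('w, 'n::finite, 'm::finite) lq_coeffs \<Rightarrow> real^'n \<Rightarrow>
     (real \<Rightarrow> real^'n) set" where
  "attainable_means M W T S x = {\<alpha> \<in> L2 (dt T). \<exists>u X. constrained_pair M W T S x \<alpha> u X}"

text \<open>\<open>u\<close> is the unique minimizer (up to null sets) of the frozen cost under the constraint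
  \<open>\<bbbE>X = \<alpha>\<close>, and \<open>X\<close> is its state.\<close>

definition constrained_minimizer ::
    "'w measure \<Rightarrow> (real \<Rightarrow> 'w \<Rightarrow> real) \<Rightarrow> real \<Rightarrow> ('w, 'n::finite, 'm::finite) lq_coeffs \<Rightarrow> real^'n \<Rightarrow>
     (real \<Rightarrow> real^'n) \<Rightarrow> (real \<Rightarrow> 'w \<Rightarrow> real^'m) \<Rightarrow> (real \<Rightarrow> 'w \<Rightarrow> real^'n) \<Rightarrow> bool" where
  "constrained_minimizer M W T S x \<alpha> u X \<longleftrightarrow>
     constrained_pair M W T S x \<alpha> u X \<and>
     (\<forall>v X'. constrained_pair M W T S x \<alpha> v X' \<longrightarrow>
        frozen_cost M T S \<alpha> u X \<le> frozen_cost M T S \<alpha> v X' \<and>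
        (frozen_cost M T S \<alpha> v X' = frozen_cost M T S \<alpha> u X \<longrightarrow>
           (AE (s, \<omega>) in dtP M T. v s \<omega> = u s \<omega>)))"

definition fbsde_solution ::
    "'w measure \<Rightarrow> (real \<Rightarrow> 'w \<Rightarrow> real) \<Rightarrow> real \<Rightarrow> ('w, 'n::finite, 'm::finite) lq_coeffs \<Rightarrow> real^'n \<Rightarrow>
     (real \<Rightarrow> real^'n) \<Rightarrow> (real \<Rightarrow> real^'n) \<Rightarrow>
     (real \<Rightarrow> 'w \<Rightarrow> real^'n) \<Rightarrow> (real \<Rightarrow> 'w \<Rightarrow> real^'n) \<Rightarrow> (real \<Rightarrow> 'w \<Rightarrow> real^'n) \<Rightarrow> bool" where
  "fbsde_solution M W T S x \<alpha> l X Y Z \<longleftrightarrow>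
     X \<in> L2Fc M W T \<and> Y \<in> L2Fc M W T \<and> Z \<in> L2F M W T \<and>
     (let V = (\<lambda>s \<omega>. matrix_inv (cR S s \<omega>) *v
                 (transpose (cB S s \<omega>) *v Y s \<omega> + transpose (cD S s \<omega>) *v Z s \<omega>)) in
       ito_diff M W T X
         (\<lambda>s \<omega>. cA S s \<omega> *v X s \<omega> - cB S s \<omega> *v V s \<omega> + cA1 S s \<omega> *v \<alpha> s)
         (\<lambda>s \<omega>. cC S s \<omega> *v X s \<omega> - cD S s \<omega> *v V s \<omega> + cC1 S s \<omega> *v \<alpha> s)) \<and>
     ito_diff M W T Y
       (\<lambda>s \<omega>. - (transpose (cA S s \<omega>) *v Y s \<omega> + transpose (cC S s \<omega>) *v Z s \<omega>
                  + cQ S s \<omega> *v X s \<omega> + l s))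
       Z \<and>
     (AE \<omega> in M. X 0 \<omega> = x) \<and>
     (AE \<omega> in M. Y T \<omega> = cG S \<omega> *v X T \<omega>)"

section \<open>Linear operators between \<open>L\<^sup>2\<close>-spaces and their adjoints\<close>

definition linear_subspace :: "('c \<Rightarrow> 'v::euclidean_space) set \<Rightarrow> bool" where
  "linear_subspace V \<longleftrightarrow>
     (\<lambda>_. 0) \<in> V \<and> (\<forall>f\<in>V. \<forall>g\<in>V. \<forall>a b. (\<lambda>t. a *\<^sub>R f t + b *\<^sub>R g t) \<in> V)"

text \<open>Linear operators on classes of \<open>\<mu>\<close>-a.e. equal functions from \<open>V\<close>, with values in classes of
  \<open>\<nu>\<close>-a.e. equal functions.\<close>

definition linear_op ::
    "'d measure \<Rightarrow> ('d \<Rightarrow> 'u::euclidean_space) set \<Rightarrow> 'c measure \<Rightarrow> ('c \<Rightarrow> 'v::euclidean_space) set \<Rightarrow>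
     (('d \<Rightarrow> 'u) \<Rightarrow> 'c \<Rightarrow> 'v) \<Rightarrow> bool" where
  "linear_op \<mu> V \<nu> H K \<longleftrightarrow>
     (\<forall>f\<in>V. K f \<in> H) \<and>
     (\<forall>f\<in>V. \<forall>g\<in>V. \<forall>a b. AE z in \<nu>. K (\<lambda>t. a *\<^sub>R f t + b *\<^sub>R g t) z = a *\<^sub>R K f z + b *\<^sub>R K g z) \<and>
     (\<forall>f\<in>V. \<forall>g\<in>V. (AE t in \<mu>. f t = g t) \<longrightarrow> (AE z in \<nu>. K f z = K g z))"

definition linear_op_vec ::
    "'c measure \<Rightarrow> ('c \<Rightarrow> 'v::euclidean_space) set \<Rightarrow> ('u::euclidean_space \<Rightarrow> 'c \<Rightarrow> 'v) \<Rightarrow> bool" where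
  "linear_op_vec \<nu> H K \<longleftrightarrow>
     (\<forall>y. K y \<in> H) \<and>
     (\<forall>y y' a b. AE z in \<nu>. K (a *\<^sub>R y + b *\<^sub>R y') z = a *\<^sub>R K y z + b *\<^sub>R K y' z)"

text \<open>The operators \<open>K\<close> need not be bounded, so the adjoint is defined only at those \<open>\<xi> \<in> H\<close> for
  which the defining identity can be satisfied at all (everywhere, if \<open>K\<close> is bounded). If \<open>V\<close> is not
  dense the value is not unique, and \<open>is_adjoint\<close> allows any choice.\<close>

definition adjoint_value ::
    "'d measure \<Rightarrow> ('d \<Rightarrow> 'u::euclidean_space) set \<Rightarrow> 'c measure \<Rightarrow>
     (('d \<Rightarrow> 'u) \<Rightarrow> 'c \<Rightarrow> 'v::euclidean_space) \<Rightarrow> ('c \<Rightarrow> 'v) \<Rightarrow> ('d \<Rightarrow> 'u) \<Rightarrow> bool" where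
  "adjoint_value \<mu> V \<nu> K \<xi> \<gamma> \<longleftrightarrow> \<gamma> \<in> L2 \<mu> \<and> (\<forall>\<beta>\<in>V. ip \<mu> \<gamma> \<beta> = ip \<nu> \<xi> (K \<beta>))"

definition adjoint_domain ::
    "'d measure \<Rightarrow> ('d \<Rightarrow> 'u::euclidean_space) set \<Rightarrow> 'c measure \<Rightarrow> ('c \<Rightarrow> 'v::euclidean_space) set \<Rightarrow>
     (('d \<Rightarrow> 'u) \<Rightarrow> 'c \<Rightarrow> 'v) \<Rightarrow> ('c \<Rightarrow> 'v) set" where
  "adjoint_domain \<mu> V \<nu> H K = {\<xi> \<in> H. \<exists>\<gamma>. adjoint_value \<mu> V \<nu> K \<xi> \<gamma>}"

definition is_adjoint ::
    "'d measure \<Rightarrow> ('d \<Rightarrow> 'u::euclidean_space) set \<Rightarrow> 'c measure \<Rightarrow> ('c \<Rightarrow> 'v::euclidean_space) set \<Rightarrow>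
     (('d \<Rightarrow> 'u) \<Rightarrow> 'c \<Rightarrow> 'v) \<Rightarrow> (('c \<Rightarrow> 'v) \<Rightarrow> 'd \<Rightarrow> 'u) \<Rightarrow> bool" where
  "is_adjoint \<mu> V \<nu> H K K' \<longleftrightarrow> (\<forall>\<xi>\<in>adjoint_domain \<mu> V \<nu> H K. adjoint_value \<mu> V \<nu> K \<xi> (K' \<xi>))"

text \<open>\<open>L2F\<close> with processes regarded as functions on \<open>[0,T] \<times> \<Omega>\<close>, as the operators above need it.\<close>

definition L2Fp ::
    "'w measure \<Rightarrow> (real \<Rightarrow> 'w \<Rightarrow> real) \<Rightarrow> real \<Rightarrow> (real \<times> 'w \<Rightarrow> 'v::euclidean_space) set" where
  "L2Fp M W T = {f. curry f \<in> L2F M W T}"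

end

theory Submission
  imports Defs
begin

text \<open>The prescribed mean \<open>\<alpha>\<close> turns the problem into a constrained linear-quadratic problem without mean-field
  terms, followed by a minimization over \<open>\<alpha>\<close>. For the second step, the minimal cost under the constraint
  \<open>\<bbbE>X = \<alpha>\<close> is a convex quadratic function of \<open>\<alpha>\<close>, whose derivative vanishes at \<open>\<alpha>\<^sup>*\<close> by the
  equation for \<open>\<alpha>\<^sup>*\<close>; coercivity of \<open>R\<close> makes it grow at least like \<open>\<delta>\<close> times the squared distance of the
  constrained minimizers, which also yields uniqueness. For the first step, the
  equation for \<open>\<lambda>\<^sup>*\<close> says that the forward component \<open>X\<close> satisfies \<open>\<bbbE>X = \<alpha>\<^sup>*\<close>. Any competitor \<open>X'\<close> under the same
  constraint is compared with \<open>X\<close> by taking the expectation of the Ito product formula for \<open>\<langle>X' - X, Y\<rangle>\<close>, in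
  which \<open>\<lambda>\<^sup>*\<close> is tested only against \<open>\<bbbE>(X' - X) = 0\<close>.

  Only this product formula is needed of stochastic calculus. It follows from the isometry and the martingale
  property of the integral, both obtained from simple processes, and from Fubini's theorem for the drift
  terms.\<close>

section \<open>Square-integrable functions\<close>

text \<open>Uniqueness needs two gaps. An optimal control first coincides with the constrained
  minimizer for its own mean, because that minimizer is unique; then the growth in \<alpha>
  identifies this minimizer with the one for \<open>as\<close>. Both gaps are squeezed between equal
  costs. The adjoint calculus works because constrained minimizers depend affinely on the mean:
  their differences are values of \<open>K\<^sub>1\<close>, \<open>K\<^sub>2\<close>,
  \<open>K\<^sub>3\<close> at \<beta> - \<alpha>. Such a difference need not be an attainable mean,
  so the operators live on a linear space \<open>V\<close>; they may be unbounded there, so adjoints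
  are applied only inside their domains. The stochastic integral is given merely as a family of
  random variables, one for each time, without joint measurability or path regularity. Products
  involving it therefore cannot be integrated over time and scenario directly; they are tested at a
  fixed time and moved to the terminal time. The weights are symmetric, so both minimizations rest
  on one exact second-order expansion of the cost.\<close>

lemma L2_measurable: "f \<in> L2 \<nu> \<Longrightarrow> f \<in> borel_measurable \<nu>"
  by (simp add: L2_def)

lemma L2_integrable_norm2: "f \<in> L2 \<nu> \<Longrightarrow> integrable \<nu> (\<lambda>z. (norm (f z))\<^sup>2)"
  by (simp add: L2_def)

lemma L2_bound:
  fixes f :: "'c \<Rightarrow> 'v::euclidean_space" and g :: "'c \<Rightarrow> 'u::euclidean_space"
  assumes f: "f \<in> L2 \<nu>" and g: "g \<in> borel_measurable \<nu>" and le: "AE z in \<nu>. norm (g z) \<le> c * norm (f z)"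
  shows "g \<in> L2 \<nu>"
proof -
  have "integrable \<nu> (\<lambda>z. (norm (g z))\<^sup>2)"
  proof (rule Bochner_Integration.integrable_bound)
    show "integrable \<nu> (\<lambda>z. c\<^sup>2 * (norm (f z))\<^sup>2)"
      using f by (simp add: L2_def)
    show "(\<lambda>z. (norm (g z))\<^sup>2) \<in> borel_measurable \<nu>" using g by simp
    show "AE z in \<nu>. norm ((norm (g z))\<^sup>2) \<le> norm (c\<^sup>2 * (norm (f z))\<^sup>2)"
      using le
    proof eventually_elim
      case (elim z)
      then show ?case using power_mono[of "norm (g z)" "c * norm (f z)" 2]
        by (simp add: power_mult_distrib)
    qed
  qed
  with g show ?thesis by (simp add: L2_def)
qed

lemma L2_add:
  assumes "f \<in> L2 \<nu>" "g \<in> L2 \<nu>"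
  shows "(\<lambda>z. f z + g z) \<in> L2 \<nu>"
proof -
  have "integrable \<nu> (\<lambda>z. (norm (f z + g z))\<^sup>2)"
  proof (rule Bochner_Integration.integrable_bound)
    show "integrable \<nu> (\<lambda>z. 2 * (norm (f z))\<^sup>2 + 2 * (norm (g z))\<^sup>2)"
      using assms by (simp add: L2_def)
    show "(\<lambda>z. (norm (f z + g z))\<^sup>2) \<in> borel_measurable \<nu>" using assms by (auto simp: L2_def)
    have "(norm (f z + g z))\<^sup>2 \<le> 2 * (norm (f z))\<^sup>2 + 2 * (norm (g z))\<^sup>2" for z
      \<comment> \<open>Parallelogram law: the two sides differ by the squared norm of
        \<open>f z - g z\<close>.\<close>
      using zero_le_power2[of "norm (f z - g z)"]
      by (simp only: power2_norm_eq_inner) (simp add: inner_simps inner_commute)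
    then show "AE z in \<nu>. norm ((norm (f z + g z))\<^sup>2) \<le> norm (2 * (norm (f z))\<^sup>2 + 2 * (norm (g z))\<^sup>2)"
      by (auto intro!: AE_I2)
  qed
  with assms show ?thesis by (auto simp: L2_def)
qed

lemma L2_scaleR: "f \<in> L2 \<nu> \<Longrightarrow> (\<lambda>z. c *\<^sub>R f z) \<in> L2 \<nu>"
  by (rule L2_bound[of f _ _ "\<bar>c\<bar>"]) (auto dest: L2_measurable)

lemma L2_uminus: "f \<in> L2 \<nu> \<Longrightarrow> (\<lambda>z. - f z) \<in> L2 \<nu>"
  using L2_scaleR[of f \<nu> "-1"] by simp

lemma L2_diff: "f \<in> L2 \<nu> \<Longrightarrow> g \<in> L2 \<nu> \<Longrightarrow> (\<lambda>z. f z - g z) \<in> L2 \<nu>"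
  using L2_add[of f \<nu> "\<lambda>z. - g z"] L2_uminus[of g \<nu>] by simp

lemma (in finite_measure) L2_bounded:
  assumes "f \<in> borel_measurable M" "AE z in M. norm (f z) \<le> c"
  shows "f \<in> L2 M"
proof -
  have "integrable M (\<lambda>z. (norm (f z))\<^sup>2)"
  proof (rule integrable_const_bound)
    show "AE z in M. norm ((norm (f z))\<^sup>2) \<le> c\<^sup>2"
      using assms(2) by eventually_elim (simp add: power_mono)
  qed (use assms(1) in measurable)
  with assms show ?thesis by (simp add: L2_def)
qed

lemma L2_integrable_inner:
  assumes f: "f \<in> L2 \<nu>" and g: "g \<in> L2 \<nu>"
  shows "integrable \<nu> (\<lambda>z. f z \<bullet> g z)"
proof (rule Bochner_Integration.integrable_bound)
  show "integrable \<nu> (\<lambda>z. (norm (f z))\<^sup>2 + (norm (g z))\<^sup>2)"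
    using assms by (simp add: L2_def)
  show "(\<lambda>z. f z \<bullet> g z) \<in> borel_measurable \<nu>"
    using assms by (auto simp: L2_def)
  have "\<bar>f z \<bullet> g z\<bar> \<le> (norm (f z))\<^sup>2 + (norm (g z))\<^sup>2" for z
    using Cauchy_Schwarz_ineq2[of "f z" "g z"] sum_squares_bound[of "norm (f z)" "norm (g z)"]
      mult_nonneg_nonneg[of "norm (f z)" "norm (g z)"]
    by (simp add: power2_eq_square)
  then show "AE z in \<nu>. norm (f z \<bullet> g z) \<le> norm ((norm (f z))\<^sup>2 + (norm (g z))\<^sup>2)"
    by (auto intro!: AE_I2)
qed

lemma (in finite_measure) L2_integrable:
  assumes f: "f \<in> L2 M"
  shows "integrable M f"
proof (rule Bochner_Integration.integrable_bound)
  show "integrable M (\<lambda>z. 1 + (norm (f z))\<^sup>2)"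
    using f by (simp add: L2_def)
  have "norm (f z) \<le> 1 + (norm (f z))\<^sup>2" for z
    using sum_squares_bound[of "norm (f z)" 1] norm_ge_zero[of "f z"] by (simp del: norm_ge_zero)
  then show "AE z in M. norm (f z) \<le> norm (1 + (norm (f z))\<^sup>2)"
    by (auto intro!: AE_I2)
qed (use f in \<open>auto simp: L2_def\<close>)

section \<open>The form \<open>ip\<close> and limits in it\<close>

lemma ip_commute: "ip \<nu> f g = ip \<nu> g f"
  by (simp add: ip_def inner_commute)

lemma ip_add_left:
  "f \<in> L2 \<nu> \<Longrightarrow> g \<in> L2 \<nu> \<Longrightarrow> h \<in> L2 \<nu> \<Longrightarrow> ip \<nu> (\<lambda>z. f z + g z) h = ip \<nu> f h + ip \<nu> g h"
  by (simp add: ip_def inner_add_left L2_integrable_inner)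

lemma ip_diff_left:
  "f \<in> L2 \<nu> \<Longrightarrow> g \<in> L2 \<nu> \<Longrightarrow> h \<in> L2 \<nu> \<Longrightarrow> ip \<nu> (\<lambda>z. f z - g z) h = ip \<nu> f h - ip \<nu> g h"
  by (simp add: ip_def inner_diff_left L2_integrable_inner)

lemma ip_add_right:
  "f \<in> L2 \<nu> \<Longrightarrow> g \<in> L2 \<nu> \<Longrightarrow> h \<in> L2 \<nu> \<Longrightarrow> ip \<nu> h (\<lambda>z. f z + g z) = ip \<nu> h f + ip \<nu> h g"
  using ip_add_left[of f \<nu> g h] by (simp add: ip_commute)

lemma ip_diff_right:
  "f \<in> L2 \<nu> \<Longrightarrow> g \<in> L2 \<nu> \<Longrightarrow> h \<in> L2 \<nu> \<Longrightarrow> ip \<nu> h (\<lambda>z. f z - g z) = ip \<nu> h f - ip \<nu> h g"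
  using ip_diff_left[of f \<nu> g h] by (simp add: ip_commute)

lemma ip_cong_AE:
  assumes "f \<in> borel_measurable \<nu>" "f' \<in> borel_measurable \<nu>" "g \<in> borel_measurable \<nu>" "g' \<in> borel_measurable \<nu>"
    and "AE z in \<nu>. f z = f' z" "AE z in \<nu>. g z = g' z"
  shows "ip \<nu> f g = ip \<nu> f' g'"
  unfolding ip_def using assms by (intro integral_cong_AE) auto

lemma ip_self_nonneg: "0 \<le> ip \<nu> f f"
  by (simp add: ip_def)

lemma ip_self: "ip \<nu> f f = (LINT z|\<nu>. (norm (f z))\<^sup>2)"
  by (simp add: ip_def power2_norm_eq_inner)

text \<open>Functions are not identified with their classes, so \<open>ip\<close> is only
  semidefinite and the discriminant argument has to treat \<open>ip \<nu> g g = 0\<close>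
  separately.\<close>

lemma ip_Cauchy_Schwarz:
  assumes f: "f \<in> L2 \<nu>" and g: "g \<in> L2 \<nu>"
  shows "\<bar>ip \<nu> f g\<bar> \<le> sqrt (ip \<nu> f f) * sqrt (ip \<nu> g g)"
proof -
  let ?a = "ip \<nu> f f" and ?b = "ip \<nu> f g" and ?c = "ip \<nu> g g"
  have quad: "0 \<le> ?a + 2 * t * ?b + t\<^sup>2 * ?c" for t
  proof -
    have "0 \<le> ip \<nu> (\<lambda>z. f z + t *\<^sub>R g z) (\<lambda>z. f z + t *\<^sub>R g z)"
      by (rule ip_self_nonneg)
    also have "\<dots> = ip \<nu> f f + ip \<nu> f (\<lambda>z. t *\<^sub>R g z) + (ip \<nu> (\<lambda>z. t *\<^sub>R g z) f
        + ip \<nu> (\<lambda>z. t *\<^sub>R g z) (\<lambda>z. t *\<^sub>R g z))"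
      using f g by (simp add: ip_add_left ip_add_right L2_add L2_scaleR)
    also have "\<dots> = ?a + 2 * t * ?b + t\<^sup>2 * ?c"
      by (simp add: ip_def inner_commute power2_eq_square)
    finally show ?thesis .
  qed
  have "?b\<^sup>2 \<le> ?a * ?c"
  proof (cases "?c = 0")
    case True
    have "?b = 0"
    proof (rule ccontr)
      assume "?b \<noteq> 0"
      \<comment> \<open>With \<open>?c = 0\<close> the quadratic is affine in t; this t gives it the
        value -1.\<close>
      then show False using quad[of "- (?a + 1) / (2 * ?b)"] True by (simp add: field_simps)
    qed
    then show ?thesis using True by simp
  next
    case False
    with ip_self_nonneg[of \<nu> g] have c: "0 < ?c" by simp
    \<comment> \<open>The vertex of the parabola, with the denominator cleared.\<close>
    have "0 \<le> (?a + 2 * (- ?b / ?c) * ?b + (- ?b / ?c)\<^sup>2 * ?c) * ?c"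
      using quad[of "- ?b / ?c"] c by (intro mult_nonneg_nonneg) auto
    also have "\<dots> = ?a * ?c - ?b\<^sup>2"
      using c by (simp add: field_simps power2_eq_square)
    finally show ?thesis by simp
  qed
  then have "sqrt (?b\<^sup>2) \<le> sqrt (?a * ?c)" by (rule real_sqrt_le_mono)
  then show ?thesis by (simp add: real_sqrt_mult)
qed

text \<open>Cauchy-Schwarz; the convergence of the second squared norm supplies its
  boundedness.\<close>

lemma tendsto_ip_zero:
  assumes f: "\<And>k. f k \<in> L2 \<nu>" and g: "\<And>k. g k \<in> L2 \<nu>"
    and f0: "(\<lambda>k. ip \<nu> (f k) (f k)) \<longlonglongrightarrow> 0" and gc: "(\<lambda>k. ip \<nu> (g k) (g k)) \<longlonglongrightarrow> c"
  shows "(\<lambda>k. ip \<nu> (f k) (g k)) \<longlonglongrightarrow> 0"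
proof (rule tendsto_rabs_zero_cancel, rule tendsto_sandwich[OF always_eventually always_eventually tendsto_const])
  have "(\<lambda>k. sqrt (ip \<nu> (f k) (f k)) * sqrt (ip \<nu> (g k) (g k))) \<longlonglongrightarrow> sqrt 0 * sqrt c"
    by (intro tendsto_intros f0 gc)
  then show "(\<lambda>k. sqrt (ip \<nu> (f k) (f k)) * sqrt (ip \<nu> (g k) (g k))) \<longlonglongrightarrow> 0" by simp
  show "\<forall>k. \<bar>ip \<nu> (f k) (g k)\<bar> \<le> sqrt (ip \<nu> (f k) (f k)) * sqrt (ip \<nu> (g k) (g k))"
    by (intro allI ip_Cauchy_Schwarz f g)
qed simp

text \<open>The product is expanded around the limits: in each of the three error terms one factor
  tends to 0 and the other has a convergent norm.\<close>

lemma tendsto_ip: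
  assumes fk: "\<And>k. f k \<in> L2 \<nu>" and f: "f' \<in> L2 \<nu>" and gk: "\<And>k. g k \<in> L2 \<nu>" and g: "g' \<in> L2 \<nu>"
    and f0: "(\<lambda>k. ip \<nu> (\<lambda>z. f k z - f' z) (\<lambda>z. f k z - f' z)) \<longlonglongrightarrow> 0"
    and g0: "(\<lambda>k. ip \<nu> (\<lambda>z. g k z - g' z) (\<lambda>z. g k z - g' z)) \<longlonglongrightarrow> 0"
  shows "(\<lambda>k. ip \<nu> (f k) (g k)) \<longlonglongrightarrow> ip \<nu> f' g'"
proof -
  have "(\<lambda>k. ip \<nu> (\<lambda>z. f k z - f' z) (\<lambda>z. g k z - g' z) + ip \<nu> (\<lambda>z. f k z - f' z) g'
      + ip \<nu> (\<lambda>z. g k z - g' z) f' + ip \<nu> f' g') \<longlonglongrightarrow> 0 + 0 + 0 + ip \<nu> f' g'"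
    by (intro tendsto_add tendsto_const tendsto_ip_zero[OF _ _ f0 g0] tendsto_ip_zero[OF _ _ f0 tendsto_const]
        tendsto_ip_zero[OF _ _ g0 tendsto_const] L2_diff fk gk f g)
  moreover have "ip \<nu> (\<lambda>z. f k z - f' z) (\<lambda>z. g k z - g' z) + ip \<nu> (\<lambda>z. f k z - f' z) g'
      + ip \<nu> (\<lambda>z. g k z - g' z) f' + ip \<nu> f' g' = ip \<nu> (f k) (g k)" for k
    using fk[of k] gk[of k] f g
    by (simp add: ip_diff_left ip_diff_right L2_diff ip_commute[of \<nu> "g k" f'] ip_commute[of \<nu> g' f'])
  ultimately show ?thesis by simp
qed

lemma L2_of_nn_integral:
  assumes "f \<in> borel_measurable \<nu>" "(\<integral>\<^sup>+ z. ennreal ((norm (f z))\<^sup>2) \<partial>\<nu>) < \<infinity>"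
  shows "f \<in> L2 \<nu>"
  using assms by (simp add: L2_def integrable_iff_bounded)

text \<open>Nonnegative integrals express convergence before the limit is known to be square
  integrable. One finite distance to a member of \<open>L2\<close> settles membership, and then all
  distances become values of \<open>ip\<close>.\<close>

lemma L2_limit:
  assumes fk: "\<And>k. f k \<in> L2 \<nu>" and h: "h \<in> borel_measurable \<nu>"
    and lim: "(\<lambda>k. \<integral>\<^sup>+ z. ennreal ((norm (f k z - h z))\<^sup>2) \<partial>\<nu>) \<longlonglongrightarrow> 0"
  shows "h \<in> L2 \<nu>" "(\<lambda>k. ip \<nu> (\<lambda>z. f k z - h z) (\<lambda>z. f k z - h z)) \<longlonglongrightarrow> 0"
proof -
  have "eventually (\<lambda>k. (\<integral>\<^sup>+ z. ennreal ((norm (f k z - h z))\<^sup>2) \<partial>\<nu>) < \<infinity>) sequentially"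
    using lim by (rule order_tendstoD) simp
  then obtain k where k: "(\<integral>\<^sup>+ z. ennreal ((norm (f k z - h z))\<^sup>2) \<partial>\<nu>) < \<infinity>"
    by (auto simp: eventually_sequentially)
  have "(\<lambda>z. f k z - h z) \<in> L2 \<nu>"
    using fk[of k] h k by (intro L2_of_nn_integral) (auto simp: L2_def)
  from L2_diff[OF fk[of k] this] show hL: "h \<in> L2 \<nu>" by simp
  have eq: "(\<integral>\<^sup>+ z. ennreal ((norm (f k z - h z))\<^sup>2) \<partial>\<nu>)
      = ennreal (ip \<nu> (\<lambda>z. f k z - h z) (\<lambda>z. f k z - h z))" for k
    unfolding ip_self using L2_integrable_norm2[OF L2_diff[OF fk hL]]
    by (intro nn_integral_eq_integral) auto
  from lim show "(\<lambda>k. ip \<nu> (\<lambda>z. f k z - h z) (\<lambda>z. f k z - h z)) \<longlonglongrightarrow> 0"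
    unfolding eq ennreal_0[symmetric]
    by (subst (asm) tendsto_ennreal_iff) (auto simp: ip_self_nonneg)
qed

lemma L2_sum: "(\<And>i. i \<in> I \<Longrightarrow> f i \<in> L2 \<nu>) \<Longrightarrow> (\<lambda>z. \<Sum>i\<in>I. f i z) \<in> L2 \<nu>"
proof (induction I rule: infinite_finite_induct)
  case (insert i I)
  then show ?case using L2_add[of "f i" \<nu> "\<lambda>z. \<Sum>i\<in>I. f i z"] by simp
qed (auto simp: L2_def)

lemma integral_double_sum:
  fixes f :: "'i \<Rightarrow> 'j \<Rightarrow> 'c \<Rightarrow> real"
  assumes "\<And>i j. i \<in> I \<Longrightarrow> j \<in> J \<Longrightarrow> integrable \<nu> (f i j)"
  shows "integral\<^sup>L \<nu> (\<lambda>z. \<Sum>i\<in>I. \<Sum>j\<in>J. f i j z) = (\<Sum>i\<in>I. \<Sum>j\<in>J. integral\<^sup>L \<nu> (f i j))"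
proof (subst Bochner_Integration.integral_sum)
  show "(\<Sum>i\<in>I. integral\<^sup>L \<nu> (\<lambda>z. \<Sum>j\<in>J. f i j z)) = (\<Sum>i\<in>I. \<Sum>j\<in>J. integral\<^sup>L \<nu> (f i j))"
    by (intro sum.cong refl Bochner_Integration.integral_sum assms)
qed (intro Bochner_Integration.integrable_sum assms)

lemma (in finite_measure) integrable_mult_bounded:
  fixes f q :: "'a \<Rightarrow> real"
  assumes "integrable M f" "q \<in> borel_measurable M" "\<And>\<omega>. \<omega> \<in> space M \<Longrightarrow> \<bar>q \<omega>\<bar> \<le> c"
  shows "integrable M (\<lambda>\<omega>. f \<omega> * q \<omega>)"
proof (rule Bochner_Integration.integrable_bound)
  show "integrable M (\<lambda>\<omega>. c * f \<omega>)" using assms(1) by simp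
  show "AE \<omega> in M. norm (f \<omega> * q \<omega>) \<le> norm (c * f \<omega>)"
  proof (rule AE_I2)
    fix \<omega> assume "\<omega> \<in> space M"
    from assms(3)[OF this] have "\<bar>f \<omega>\<bar> * \<bar>q \<omega>\<bar> \<le> \<bar>f \<omega>\<bar> * \<bar>c\<bar>"
      by (intro mult_left_mono) auto
    then show "norm (f \<omega> * q \<omega>) \<le> norm (c * f \<omega>)" by (simp add: abs_mult ac_simps)
  qed
qed (use assms in measurable)

lemma bounded_inner:
  assumes "norm x \<le> a" "norm y \<le> b"
  shows "\<bar>x \<bullet> y\<bar> \<le> a * b"
proof -
  have "\<bar>x \<bullet> y\<bar> \<le> norm x * norm y" by (rule Cauchy_Schwarz_ineq2)
  also have "\<dots> \<le> a * b" using assms order_trans[OF norm_ge_zero assms(1)] by (intro mult_mono) auto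
  finally show ?thesis .
qed

section \<open>Product measures and integration by parts\<close>

lemma L2_fst:
  fixes f :: "'b \<Rightarrow> 'v::euclidean_space"
  assumes "sigma_finite_measure M\<^sub>1" "finite_measure M\<^sub>2" and f: "f \<in> L2 M\<^sub>1"
  shows "(\<lambda>z. f (fst z)) \<in> L2 (M\<^sub>1 \<Otimes>\<^sub>M M\<^sub>2)"
proof -
  interpret M1: sigma_finite_measure M\<^sub>1 by fact
  interpret M2: finite_measure M\<^sub>2 by fact
  interpret pair_sigma_finite M\<^sub>1 M\<^sub>2 ..
  note [measurable] = L2_measurable[OF f]
  have "integrable (M\<^sub>1 \<Otimes>\<^sub>M M\<^sub>2) (\<lambda>z. (norm (f (fst z)))\<^sup>2)"
  proof (rule Fubini_integrable)
    show "integrable M\<^sub>1 (\<lambda>x. LINT y|M\<^sub>2. norm ((norm (f (fst (x, y))))\<^sup>2))"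
      using L2_integrable_norm2[OF f] by simp
  qed simp_all
  then show ?thesis by (simp add: L2_def)
qed

lemma L2_snd:
  fixes f :: "'b \<Rightarrow> 'v::euclidean_space"
  assumes "finite_measure M\<^sub>1" "sigma_finite_measure M\<^sub>2" and f: "f \<in> L2 M\<^sub>2"
  shows "(\<lambda>z. f (snd z)) \<in> L2 (M\<^sub>1 \<Otimes>\<^sub>M M\<^sub>2)"
proof -
  interpret M1: finite_measure M\<^sub>1 by fact
  interpret M2: sigma_finite_measure M\<^sub>2 by fact
  interpret pair_sigma_finite M\<^sub>1 M\<^sub>2 ..
  note [measurable] = L2_measurable[OF f]
  have "integrable (M\<^sub>1 \<Otimes>\<^sub>M M\<^sub>2) (\<lambda>z. (norm (f (snd z)))\<^sup>2)"
  proof (rule Fubini_integrable)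
    show "integrable M\<^sub>1 (\<lambda>x. LINT y|M\<^sub>2. norm ((norm (f (snd (x, y))))\<^sup>2))" by simp
    show "AE x in M\<^sub>1. integrable M\<^sub>2 (\<lambda>y. (norm (f (snd (x, y))))\<^sup>2)"
      using L2_integrable_norm2[OF f] by simp
  qed simp
  then show ?thesis by (simp add: L2_def)
qed

text \<open>Cauchy-Schwarz against the constant function 1.\<close>

lemma (in finite_measure) norm_integral_squared_le:
  fixes f :: "'a \<Rightarrow> 'v::euclidean_space"
  assumes f: "f \<in> L2 M"
  shows "(norm (LINT z|M. f z))\<^sup>2 \<le> measure M (space M) * (LINT z|M. (norm (f z))\<^sup>2)"
proof -
  have nf: "(\<lambda>z. norm (f z)) \<in> L2 M"
    using f by (auto simp: L2_def)
  have one: "(\<lambda>z. 1::real) \<in> L2 M" by (rule L2_bounded[of _ 1]) auto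
  have "norm (LINT z|M. f z) \<le> (LINT z|M. norm (f z))" by (rule integral_norm_bound)
  also have "\<dots> \<le> sqrt (LINT z|M. (norm (f z))\<^sup>2) * sqrt (measure M (space M))"
    using ip_Cauchy_Schwarz[OF nf one] by (simp add: ip_def power2_eq_square)
  finally have "(norm (LINT z|M. f z))\<^sup>2 \<le> (sqrt (LINT z|M. (norm (f z))\<^sup>2) * sqrt (measure M (space M)))\<^sup>2"
    by (rule power_mono) simp
  then show ?thesis by (simp add: power_mult_distrib mult.commute)
qed

lemma borel_measurable_indicator_le:
  fixes f g :: "'b \<Rightarrow> real"
  assumes "f \<in> borel_measurable N" "g \<in> borel_measurable N"
  shows "(\<lambda>z. indicator {..g z} (f z) :: real) \<in> borel_measurable N"
proof -
  have "{z \<in> space N. f z \<le> g z} \<in> sets N" using assms by (rule borel_measurable_le)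
  then have "(indicator {z \<in> space N. f z \<le> g z} :: 'b \<Rightarrow> real) \<in> borel_measurable N" by simp
  then show ?thesis
    by (rule measurable_cong[THEN iffD1, rotated]) (simp add: indicator_def)
qed

text \<open>Integration by parts for two primitives, without differentiation: by Fubini each term on
  the left is the integral of \<open>f r \<bullet> g s\<close> over one of the two triangles that
  make up the square.\<close>

lemma integral_inner_by_parts:
  fixes f g :: "real \<Rightarrow> 'v::euclidean_space"
  assumes f: "f \<in> L2 (dt T)" and g: "g \<in> L2 (dt T)"
  shows "(LINT s|dt T. (LINT r|dt T. indicator {..s} r *\<^sub>R f r) \<bullet> g s)
       + (LINT r|dt T. (LINT s|dt T. indicator {..r} s *\<^sub>R g s) \<bullet> f r)
       = (LINT r|dt T. f r) \<bullet> (LINT s|dt T. g s)"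
proof -
  interpret dt: finite_measure "dt T"
    by (rule finite_measureI) (simp add: emeasure_restrict_space space_restrict_space emeasure_lborel_Icc_eq)
  interpret P: pair_sigma_finite "dt T" "dt T" ..
  have fi: "integrable (dt T) f" and gi: "integrable (dt T) g"
    using f g by (auto intro: dt.L2_integrable)
  note [measurable] = L2_measurable[OF f] L2_measurable[OF g]
  have id [measurable]: "(\<lambda>x. x) \<in> borel_measurable (dt T)" by (rule measurable_restrict_space1) simp
  let ?k = "\<lambda>r s. indicator {..s} r * (f r \<bullet> g s)" and ?k' = "\<lambda>r s. indicator {..r} s * (f r \<bullet> g s)"
  have prod: "integrable (dt T \<Otimes>\<^sub>M dt T) (\<lambda>z. f (fst z) \<bullet> g (snd z))"
    by (intro L2_integrable_inner L2_fst L2_snd f g) unfold_locales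
  have meas: "(\<lambda>z. indicator {..snd z} (fst z) :: real) \<in> borel_measurable (dt T \<Otimes>\<^sub>M dt T)"
    "(\<lambda>z. indicator {..fst z} (snd z) :: real) \<in> borel_measurable (dt T \<Otimes>\<^sub>M dt T)"
    by (intro borel_measurable_indicator_le measurable_compose[OF measurable_fst id]
      measurable_compose[OF measurable_snd id])+
  have k: "integrable (dt T \<Otimes>\<^sub>M dt T) (\<lambda>(r, s). ?k r s)"
    by (rule Bochner_Integration.integrable_bound[OF prod])
       (use meas borel_measurable_integrable[OF prod] in \<open>auto simp: split_beta' indicator_def intro!: borel_measurable_times\<close>)
  have k': "integrable (dt T \<Otimes>\<^sub>M dt T) (\<lambda>(r, s). ?k' r s)"
    by (rule Bochner_Integration.integrable_bound[OF prod])
       (use meas borel_measurable_integrable[OF prod] in \<open>auto simp: split_beta' indicator_def intro!: borel_measurable_times\<close>)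
  have ind: "integrable (dt T) (\<lambda>r. indicator {..s} r *\<^sub>R h r)" if "integrable (dt T) h" for h :: "real \<Rightarrow> 'v" and s
    by (rule Bochner_Integration.integrable_bound[OF that])
       (use borel_measurable_integrable[OF that] in \<open>auto simp: indicator_def intro!: borel_measurable_scaleR measurable_restrict_space1\<close>)
  have "(LINT r|dt T. indicator {..s} r *\<^sub>R f r) \<bullet> g s = (LINT r|dt T. ?k r s)" for s
    using integral_inner_left[OF ind[OF fi], of s "g s"] by simp
  then have "(LINT s|dt T. (LINT r|dt T. indicator {..s} r *\<^sub>R f r) \<bullet> g s) = (LINT s|dt T. LINT r|dt T. ?k r s)"
    by simp
  moreover have "(LINT s|dt T. indicator {..r} s *\<^sub>R g s) \<bullet> f r = (LINT s|dt T. ?k' r s)" for r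
    using integral_inner_left[OF ind[OF gi], of r "f r"] by (simp add: inner_commute[of "f r"])
  then have "(LINT r|dt T. (LINT s|dt T. indicator {..r} s *\<^sub>R g s) \<bullet> f r) = (LINT s|dt T. LINT r|dt T. ?k' r s)"
    unfolding P.Fubini_integral[OF k'] by simp
  moreover have "(LINT s|dt T. LINT r|dt T. ?k r s) + (LINT s|dt T. LINT r|dt T. ?k' r s)
      = (LINT s|dt T. (LINT r|dt T. ?k r s) + (LINT r|dt T. ?k' r s))"
    using P.integrable_snd[OF k] P.integrable_snd[OF k'] by simp
  moreover have "(LINT r|dt T. ?k r s) + (LINT r|dt T. ?k' r s) = (LINT r|dt T. f r) \<bullet> g s" for s
  proof -
    have fg: "integrable (dt T) (\<lambda>r. f r \<bullet> g s)" using fi by simp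
    have m: "(\<lambda>r. indicator {..s} r :: real) \<in> borel_measurable (dt T)" "(\<lambda>r. indicator {..r} s :: real) \<in> borel_measurable (dt T)"
      by (intro borel_measurable_indicator_le id borel_measurable_const)+
    have i: "integrable (dt T) (\<lambda>r. ?k r s)" "integrable (dt T) (\<lambda>r. ?k' r s)"
      by (rule Bochner_Integration.integrable_bound[OF fg];
          use m borel_measurable_integrable[OF fg] in \<open>auto simp: indicator_def intro!: borel_measurable_times\<close>)+
    then have "(LINT r|dt T. ?k r s) + (LINT r|dt T. ?k' r s) = (LINT r|dt T. ?k r s + ?k' r s)" by simp
    also have "\<dots> = (LINT r|dt T. f r \<bullet> g s)"
    proof (rule integral_cong_AE)
      \<comment> \<open>The diagonal lies in both triangles, but each of its sections is a single
        point.\<close>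
      have "AE r in lborel. r \<in> {0..T} \<longrightarrow> r \<noteq> s"
        using AE_lborel_singleton[of s] by eventually_elim simp
      then have "AE r in dt T. r \<noteq> s" by (simp add: AE_restrict_space_iff)
      then show "AE r in dt T. ?k r s + ?k' r s = f r \<bullet> g s"
        by eventually_elim (auto simp: indicator_def)
    qed (use i fg in auto)
    also have "\<dots> = (LINT r|dt T. f r) \<bullet> g s" using fi by simp
    finally show ?thesis .
  qed
  ultimately show ?thesis using gi by simp
qed

section \<open>Matrix-valued coefficients\<close>

lemma bounded_bilinear_matrix_vector_mult:
  "bounded_bilinear ((*v) :: real^'n^'m \<Rightarrow> real^'n \<Rightarrow> real^'m)"
proof (rule bilinear_conv_bounded_bilinear[THEN iffD1])
  show "bilinear ((*v) :: real^'n^'m \<Rightarrow> real^'n \<Rightarrow> real^'m)"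
    unfolding bilinear_def
    by (intro conjI allI linearI)
      (auto simp: matrix_vector_mult_def vec_eq_iff sum_distrib_left sum.distrib algebra_simps)
qed

lemma borel_measurable_matrix_vector_mult [measurable (raw)]:
  fixes A :: "'c \<Rightarrow> real^'n^'m"
  assumes "A \<in> borel_measurable \<nu>" "f \<in> borel_measurable \<nu>"
  shows "(\<lambda>z. A z *v f z) \<in> borel_measurable \<nu>"
  using assms
  by (rule borel_measurable_continuous_Pair)
     (intro bounded_bilinear.continuous_on[OF bounded_bilinear_matrix_vector_mult] continuous_intros)

lemma continuous_on_transpose: "continuous_on UNIV (transpose :: real^'n^'m \<Rightarrow> real^'m^'n)"
  unfolding transpose_def by (intro continuous_intros)

lemma borel_measurable_transpose [measurable (raw)]:
  fixes A :: "'c \<Rightarrow> real^'n^'m"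
  assumes "A \<in> borel_measurable \<nu>"
  shows "(\<lambda>z. transpose (A z)) \<in> borel_measurable \<nu>"
  by (rule borel_measurable_continuous_on[OF continuous_on_transpose assms])

lemma norm_transpose: 
  fixes A :: "real^'n^'m"
  shows "norm (transpose A) = norm A"
proof -
  have "transpose A \<bullet> transpose A = A \<bullet> A"
    by (simp add: inner_vec_def transpose_def) (rule sum.swap)
  then show ?thesis by (simp add: norm_eq_sqrt_inner)
qed

lemma L2_matrix_vector_mult:
  fixes A :: "'c \<Rightarrow> real^'n^'m"
  assumes A: "A \<in> borel_measurable \<nu>" "\<exists>c. AE z in \<nu>. norm (A z) \<le> c" and f: "f \<in> L2 \<nu>"
  shows "(\<lambda>z. A z *v f z) \<in> L2 \<nu>"
proof -
  obtain K where K: "\<And>(a::real^'n^'m) b. norm (a *v b) \<le> norm a * norm b * K" "K \<ge> 0"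
    using bounded_bilinear.nonneg_bounded[OF bounded_bilinear_matrix_vector_mult] by blast
  from A obtain c where c: "AE z in \<nu>. norm (A z) \<le> c" by blast
  have "AE z in \<nu>. norm (A z *v f z) \<le> (c * K) * norm (f z)"
    using c
  proof eventually_elim
    case (elim z)
    have "norm (A z *v f z) \<le> norm (A z) * norm (f z) * K" by (rule K)
    also have "\<dots> \<le> c * norm (f z) * K"
      using elim K by (intro mult_right_mono) auto
    finally show ?case by (simp add: ac_simps)
  qed
  with f A show ?thesis
    by (intro L2_bound[OF f]) (auto intro!: borel_measurable_matrix_vector_mult simp: L2_def)
qed

text \<open>Cramer's rule writes the product as a quotient of polynomials where the determinant is
  nonzero; where it vanishes, \<open>matrix_inv\<close> is a single unspecified constant.\<close>

lemma borel_measurable_matrix_inv_mult [measurable (raw)]: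
  fixes A :: "'c \<Rightarrow> real^'n^'n"
  assumes [measurable]: "A \<in> borel_measurable \<nu>" "f \<in> borel_measurable \<nu>"
  shows "(\<lambda>z. matrix_inv (A z) *v f z) \<in> borel_measurable \<nu>"
proof -
  \<comment> \<open>The value of the choice operator for an unsatisfiable description, which is the
    same for all singular matrices.\<close>
  define c where "c = (SOME A'::real^'n^'n. False)"
  have sing: "matrix_inv B = c" if "det B = 0" for B :: "real^'n^'n"
  proof -
    from that have "\<not> invertible B" by (simp add: invertible_det_nz)
    then have "(\<lambda>A'. B ** A' = mat 1 \<and> A' ** B = mat 1) = (\<lambda>_. False)"
      by (auto simp: invertible_def)
    then show ?thesis unfolding matrix_inv_def c_def by (rule arg_cong)
  qed
  have reg: "matrix_inv B *v b = (\<chi> k. det (\<chi> i j. if j = k then b $ i else B $ i $ j) / det B)"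
    if "det B \<noteq> 0" for B :: "real^'n^'n" and b
  proof (subst cramer[OF that, symmetric])
    have "invertible B" using that by (simp add: invertible_det_nz)
    then have "B ** matrix_inv B = mat 1 \<and> matrix_inv B ** B = mat 1"
      unfolding invertible_def matrix_inv_def by (rule someI_ex)
    then show "B *v (matrix_inv B *v b) = b"
      by (simp add: matrix_vector_mul_assoc)
  qed
  have "(\<lambda>z. matrix_inv (A z) *v f z) = (\<lambda>z. if det (A z) = 0 then c *v f z else
      (\<chi> k. det (\<chi> i j. if j = k then f z $ i else A z $ i $ j) / det (A z)))"
    using sing reg by auto
  moreover have comp: "(\<lambda>z. A z $ i $ j) \<in> borel_measurable \<nu>" "(\<lambda>z. f z $ i) \<in> borel_measurable \<nu>" for i j
    by (auto intro!: borel_measurable_continuous_on[OF _ assms(1), of "\<lambda>a. a $ i $ j"]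
      borel_measurable_continuous_on[OF _ assms(2), of "\<lambda>a. a $ i"] continuous_intros)
  have [measurable]: "(\<lambda>z. det (A z)) \<in> borel_measurable \<nu>"
    unfolding det_def by (intro borel_measurable_sum borel_measurable_times borel_measurable_prod comp) auto
  have "(\<lambda>z. det (\<chi> i j. if j = k then f z $ i else A z $ i $ j)) \<in> borel_measurable \<nu>" for k
    unfolding det_def
  proof (intro borel_measurable_sum borel_measurable_times borel_measurable_prod)
    fix p and i :: 'n
    show "(\<lambda>z. (\<chi> i j. if j = k then f z $ i else A z $ i $ j) $ i $ p i) \<in> borel_measurable \<nu>"
      using comp by (cases "p i = k") auto
  qed auto
  then have [measurable]: "(\<lambda>z. \<chi> k. det (\<chi> i j. if j = k then f z $ i else A z $ i $ j) / det (A z)) \<in> borel_measurable \<nu>"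
    by (subst borel_measurable_euclidean_space) (auto simp: Basis_vec_def inner_axis)
  ultimately show ?thesis by simp
qed

section \<open>Coercive matrices and quadratic forms\<close>

lemma inner_matrix_vector_mult:
  fixes A :: "real^'n^'m"
  shows "(A *v x) \<bullet> y = x \<bullet> (transpose A *v y)"
  by (metis dot_lmul_matrix vector_transpose_matrix)

lemma matrix_vector_mult_minus:
  fixes A :: "real^'n^'m"
  shows "A *v (- x) = - (A *v x)"
  using linear_neg[OF matrix_vector_mul_linear, of A x] .

lemma psd_diff_coercive:
  fixes A :: "real^'n^'n"
  assumes "psd (A - \<delta> *\<^sub>R mat 1)"
  shows "\<delta> * (v \<bullet> v) \<le> (A *v v) \<bullet> v"
proof -
  have "0 \<le> ((A - \<delta> *\<^sub>R mat 1) *v v) \<bullet> v" using assms by (simp add: psd_def)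
  then show ?thesis
    by (simp add: matrix_vector_mult_diff_rdistrib inner_diff_left scaleR_matrix_vector_assoc[symmetric])
qed

text \<open>Coercivity bounds \<open>A\<close> from below, so it is injective, hence invertible in
  finite dimension. The uniform constant \<open>1 / \<delta>\<close> later keeps the feedback
  control square integrable.\<close>

lemma coercive_invertible:
  fixes A :: "real^'n^'n"
  assumes "0 < \<delta>" and A: "\<And>v. \<delta> * (v \<bullet> v) \<le> (A *v v) \<bullet> v"
  shows "matrix_inv A *v (A *v v) = v" "A *v (matrix_inv A *v v) = v" "norm v \<le> 1 / \<delta> * norm (A *v v)"
proof -
  have bound: "norm v \<le> 1 / \<delta> * norm (A *v v)" for v
  proof (cases "v = 0")
    case False
    have "\<delta> * (norm v * norm v) \<le> norm (A *v v) * norm v"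
      using A[of v] norm_cauchy_schwarz[of "A *v v" v]
      by (simp add: power2_norm_eq_inner[symmetric] power2_eq_square)
    then have "\<delta> * norm v \<le> norm (A *v v)"
      using False by (simp add: mult.assoc[symmetric])
    then show ?thesis using assms(1) by (simp add: field_simps)
  qed simp
  then show "norm v \<le> 1 / \<delta> * norm (A *v v)" .
  have "inj ((*v) A)"
  proof (rule injI)
    fix v w assume "A *v v = A *v w"
    then have "A *v (v - w) = 0" by (simp add: matrix_vector_mult_diff_distrib)
    with bound[of "v - w"] show "v = w" by simp
  qed
  then have "invertible A" by (simp add: invertible_left_inverse matrix_left_invertible_injective)
  then have "A ** matrix_inv A = mat 1 \<and> matrix_inv A ** A = mat 1"
    unfolding invertible_def matrix_inv_def by (rule someI_ex)
  then show "matrix_inv A *v (A *v v) = v" "A *v (matrix_inv A *v v) = v"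
    by (simp_all add: matrix_vector_mul_assoc)
qed

text \<open>Taylor expansion at \<open>f\<close> in the direction \<open>g - f\<close>, exact
  because the form is quadratic; symmetry merges the two mixed terms.\<close>

lemma ip_quadratic_expansion:
  fixes A :: "'c \<Rightarrow> real^'n^'n"
  assumes A: "A \<in> borel_measurable \<nu>" "\<exists>c. AE z in \<nu>. norm (A z) \<le> c" and sym: "AE z in \<nu>. transpose (A z) = A z"
    and f: "f \<in> L2 \<nu>" and g: "g \<in> L2 \<nu>"
  shows "ip \<nu> (\<lambda>z. A z *v g z) g = ip \<nu> (\<lambda>z. A z *v f z) f
    + 2 * ip \<nu> (\<lambda>z. A z *v f z) (\<lambda>z. g z - f z) + ip \<nu> (\<lambda>z. A z *v (g z - f z)) (\<lambda>z. g z - f z)"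
proof -
  note gf = L2_diff[OF g f]
  note Af = L2_matrix_vector_mult[OF A f] and Ag = L2_matrix_vector_mult[OF A g] and Agf = L2_matrix_vector_mult[OF A gf]
  note i = L2_integrable_inner
  have "ip \<nu> (\<lambda>z. A z *v g z) g = (LINT z|\<nu>. (A z *v f z) \<bullet> f z + 2 * ((A z *v f z) \<bullet> (g z - f z))
      + (A z *v (g z - f z)) \<bullet> (g z - f z))"
    unfolding ip_def
  proof (rule integral_cong_AE)
    show "AE z in \<nu>. (A z *v g z) \<bullet> g z = (A z *v f z) \<bullet> f z + 2 * ((A z *v f z) \<bullet> (g z - f z))
      + (A z *v (g z - f z)) \<bullet> (g z - f z)"
      using sym
    proof eventually_elim
      case (elim z)
      have "(A z *v g z) \<bullet> f z = (A z *v f z) \<bullet> g z"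
        using inner_matrix_vector_mult[of "A z" "g z" "f z"] elim by (simp add: inner_commute)
      then show ?case
        by (simp add: matrix_vector_mult_diff_distrib inner_diff_left inner_diff_right)
    qed
  qed (use i[OF Ag g] i[OF Af f] i[OF Af gf] i[OF Agf gf] in auto)
  also have "\<dots> = ip \<nu> (\<lambda>z. A z *v f z) f
    + 2 * ip \<nu> (\<lambda>z. A z *v f z) (\<lambda>z. g z - f z) + ip \<nu> (\<lambda>z. A z *v (g z - f z)) (\<lambda>z. g z - f z)"
    unfolding ip_def using i[OF Af f] i[OF Af gf] i[OF Agf gf] by simp
  finally show ?thesis .
qed

lemma ip_psd_nonneg:
  assumes "AE z in \<nu>. psd (A z)"
  shows "0 \<le> ip \<nu> (\<lambda>z. A z *v h z) h"
proof -
  have "AE z in \<nu>. 0 \<le> (A z *v h z) \<bullet> h z"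
    using assms by eventually_elim (simp add: psd_def)
  then show ?thesis unfolding ip_def by (rule integral_nonneg_AE)
qed

lemma ip_zero_AE:
  assumes f: "f \<in> L2 \<nu>" and z: "ip \<nu> f f \<le> 0"
  shows "AE z in \<nu>. f z = 0"
proof -
  have "(LINT z|\<nu>. f z \<bullet> f z) = 0"
    using z ip_self_nonneg[of \<nu> f] unfolding ip_def by (rule antisym)
  moreover have "integrable \<nu> (\<lambda>z. f z \<bullet> f z)" by (rule L2_integrable_inner[OF f f])
  ultimately have "AE z in \<nu>. f z \<bullet> f z = 0"
    by (subst (asm) integral_nonneg_eq_0_iff_AE) auto
  then show ?thesis by eventually_elim simp
qed

text \<open>The common part \<open>p\<close> cancels in \<open>g - f\<close>, which is thus the
  value of \<open>K\<close> at \<beta> - \<alpha>, and the adjoint moves \<open>K\<close> to the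
  other side. This turns one term of the derivative of the cost into a pairing with the direction
  \<beta> - \<alpha> over time.\<close>

lemma adjoint_pairing:
  fixes K :: "('d \<Rightarrow> real^'n) \<Rightarrow> 'c \<Rightarrow> real^'k" and A :: "'c \<Rightarrow> real^'k^'k"
  assumes K: "linear_op \<mu> V \<nu> H K" and H: "H \<subseteq> L2 \<nu>"
    and V: "linear_subspace V" "\<alpha> \<in> V" "\<beta> \<in> V"
    and A: "A \<in> borel_measurable \<nu>" "\<exists>c. AE z in \<nu>. norm (A z) \<le> c"
    and f: "f \<in> L2 \<nu>" "AE z in \<nu>. f z = p z + K \<alpha> z"
    and g: "g \<in> L2 \<nu>" "AE z in \<nu>. g z = p z + K \<beta> z"
    and adj: "is_adjoint \<mu> V \<nu> H K K'"
    and dom: "(\<lambda>z. A z *v K \<alpha> z) \<in> adjoint_domain \<mu> V \<nu> H K" "(\<lambda>z. A z *v p z) \<in> adjoint_domain \<mu> V \<nu> H K"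
  shows "K' (\<lambda>z. A z *v K \<alpha> z) \<in> L2 \<mu>" "K' (\<lambda>z. A z *v p z) \<in> L2 \<mu>"
    "ip \<nu> (\<lambda>z. A z *v f z) (\<lambda>z. g z - f z) = ip \<mu> (K' (\<lambda>z. A z *v K \<alpha> z)) (\<lambda>t. \<beta> t - \<alpha> t)
      + ip \<mu> (K' (\<lambda>z. A z *v p z)) (\<lambda>t. \<beta> t - \<alpha> t)"
proof -
  have val: "adjoint_value \<mu> V \<nu> K (\<lambda>z. A z *v K \<alpha> z) (K' (\<lambda>z. A z *v K \<alpha> z))"
    "adjoint_value \<mu> V \<nu> K (\<lambda>z. A z *v p z) (K' (\<lambda>z. A z *v p z))"
    using adj dom unfolding is_adjoint_def by blast+
  then show "K' (\<lambda>z. A z *v K \<alpha> z) \<in> L2 \<mu>" "K' (\<lambda>z. A z *v p z) \<in> L2 \<mu>"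
    by (auto simp: adjoint_value_def)
  \<comment> \<open>The difference in the shape of a linear combination that
    \<open>linear_subspace\<close> and \<open>linear_op\<close> speak of.\<close>
  let ?d = "\<lambda>t. 1 *\<^sub>R \<beta> t + (-1) *\<^sub>R \<alpha> t"
  have d: "?d \<in> V" using V unfolding linear_subspace_def by blast
  have Kd: "K ?d \<in> L2 \<nu>" using K H d unfolding linear_op_def by blast
  have "AE z in \<nu>. K ?d z = 1 *\<^sub>R K \<beta> z + (-1) *\<^sub>R K \<alpha> z"
    using K V(2,3) unfolding linear_op_def by blast
  then have gf: "AE z in \<nu>. g z - f z = K ?d z"
    using f(2) g(2) by eventually_elim simp
  have L: "(\<lambda>z. A z *v K \<alpha> z) \<in> L2 \<nu>" "(\<lambda>z. A z *v p z) \<in> L2 \<nu>"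
    using dom H by (auto simp: adjoint_domain_def)
  have "ip \<nu> (\<lambda>z. A z *v f z) (\<lambda>z. g z - f z) = ip \<nu> (\<lambda>z. A z *v K \<alpha> z + A z *v p z) (K ?d)"
  proof (rule ip_cong_AE)
    show "AE z in \<nu>. A z *v f z = A z *v K \<alpha> z + A z *v p z"
      using f(2) by eventually_elim (simp add: matrix_vector_right_distrib)
  qed (use gf L2_measurable[OF L2_matrix_vector_mult[OF A f(1)]] L2_measurable[OF L2_add[OF L]]
      L2_measurable[OF L2_diff[OF g(1) f(1)]] L2_measurable[OF Kd] in auto)
  also have "\<dots> = ip \<nu> (\<lambda>z. A z *v K \<alpha> z) (K ?d) + ip \<nu> (\<lambda>z. A z *v p z) (K ?d)"
    by (rule ip_add_left[OF L Kd])
  also have "\<dots> = ip \<mu> (K' (\<lambda>z. A z *v K \<alpha> z)) ?d + ip \<mu> (K' (\<lambda>z. A z *v p z)) ?d"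
    using val d by (simp only: adjoint_value_def)
  finally show "ip \<nu> (\<lambda>z. A z *v f z) (\<lambda>z. g z - f z) = ip \<mu> (K' (\<lambda>z. A z *v K \<alpha> z)) (\<lambda>t. \<beta> t - \<alpha> t)
      + ip \<mu> (K' (\<lambda>z. A z *v p z)) (\<lambda>t. \<beta> t - \<alpha> t)" by simp
qed

section \<open>Increments of Brownian motion\<close>

locale brownian = prob_space M for M :: "'w measure" +
  fixes W :: "real \<Rightarrow> 'w \<Rightarrow> real"
  assumes BM: "brownian_motion M W"
begin

abbreviation F :: "real \<Rightarrow> 'w measure" where
  "F \<equiv> brownian_filtration M W"

lemma W_measurable [measurable]: "0 \<le> t \<Longrightarrow> W t \<in> borel_measurable M"
  using BM by (simp add: brownian_motion_def)

lemma F_generators: "{W s -` S \<inter> space M |s S. s \<in> {0..t} \<and> S \<in> sets borel} \<union> null_sets M \<subseteq> sets M"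
  using measurable_sets[OF W_measurable] by auto

lemma space_F [simp]: "space (F t) = space M"
  using F_generators[of t] sets.space_closed unfolding brownian_filtration_def
  by (intro space_measure_of) blast

lemma sets_F: "sets (F t) = sigma_sets (space M)
    ({W s -` S \<inter> space M |s S. s \<in> {0..t} \<and> S \<in> sets borel} \<union> null_sets M)"
  using F_generators[of t] sets.space_closed unfolding brownian_filtration_def
  by (intro sets_measure_of) blast

lemma subalgebra_F: "subalgebra M (F t)"
  using sets.sigma_sets_subset[OF F_generators[of t]] by (simp add: subalgebra_def sets_F)

lemma sets_F_mono: "s \<le> t \<Longrightarrow> sets (F s) \<subseteq> sets (F t)"
  unfolding sets_F by (rule sigma_sets_mono') fastforce

lemma measurable_F_mono: "f \<in> borel_measurable (F s) \<Longrightarrow> s \<le> t \<Longrightarrow> f \<in> borel_measurable (F t)"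
  using sets_F_mono[of s t] unfolding measurable_def by auto

lemma measurable_F: "f \<in> borel_measurable (F s) \<Longrightarrow> f \<in> borel_measurable M"
  by (rule measurable_from_subalg[OF subalgebra_F])

lemma W_adapted: "0 \<le> s \<Longrightarrow> s \<le> t \<Longrightarrow> W s \<in> borel_measurable (F t)"
  by (rule measurableI) (auto simp: sets_F intro!: sigma_sets.Basic)

section \<open>Moments of increments and their independence of the past\<close>

lemma W_increment:
  assumes "0 \<le> s" "s \<le> t"
  shows "integrable M (\<lambda>\<omega>. W t \<omega> - W s \<omega>)" "expectation (\<lambda>\<omega>. W t \<omega> - W s \<omega>) = 0"
    "integrable M (\<lambda>\<omega>. (W t \<omega> - W s \<omega>)\<^sup>2)" "expectation (\<lambda>\<omega>. (W t \<omega> - W s \<omega>)\<^sup>2) = t - s"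
proof -
  let ?X = "\<lambda>\<omega>. W t \<omega> - W s \<omega>"
  have *: "integrable M ?X \<and> expectation ?X = 0 \<and> integrable M (\<lambda>\<omega>. (?X \<omega>)\<^sup>2) \<and>
      expectation (\<lambda>\<omega>. (?X \<omega>)\<^sup>2) = t - s"
  \<comment> \<open>The normal law is prescribed only for s < t; the degenerate increment is
    0.\<close>
  proof (cases "s = t")
    case False
    then have st: "0 < sqrt (t - s)" using assms by simp
    have D: "distributed M lborel ?X (normal_density 0 (sqrt (t - s)))"
      using BM assms False by (auto simp: brownian_motion_def)
    have E: "expectation ?X = 0" by (rule normal_distributed_expectation[OF st D])
    have V: "expectation (\<lambda>\<omega>. (?X \<omega>)\<^sup>2) = t - s"
      using normal_distributed_variance[OF st D] E assms by simp
    have "integrable M ?X"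
      using integrable_normal_moment[OF st, of 0 1] distributed_integrable[OF D, of "\<lambda>x. x"] by simp
    moreover have "integrable M (\<lambda>\<omega>. (?X \<omega>)\<^sup>2)"
      using integrable_normal_moment[OF st, of 0 2] distributed_integrable[OF D, of "\<lambda>x. x\<^sup>2"] by simp
    ultimately show ?thesis using E V by simp
  qed simp
  then show "integrable M ?X" "expectation ?X = 0" "integrable M (\<lambda>\<omega>. (?X \<omega>)\<^sup>2)"
    "expectation (\<lambda>\<omega>. (?X \<omega>)\<^sup>2) = t - s" by auto
qed

text \<open>Independence is given for consecutive increments. The values at the points of
  \<open>J\<close> are partial sums of the increments along the sorted sequence 0, \<open>J\<close>,
  s, t, and the increment from s to t is the last one, hence independent of the block before
  it.\<close>

lemma increment_indep_cylinder:
  assumes J: "finite J" "J \<subseteq> {0..s}" and B: "\<And>r. r \<in> J \<Longrightarrow> B r \<in> sets borel"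
    and st: "0 \<le> s" "s \<le> t" and U: "U \<in> sets borel"
  shows "prob ({\<omega>\<in>space M. \<forall>r\<in>J. W r \<omega> \<in> B r} \<inter> {\<omega>\<in>space M. W t \<omega> - W s \<omega> \<in> U})
       = prob {\<omega>\<in>space M. \<forall>r\<in>J. W r \<omega> \<in> B r} * prob {\<omega>\<in>space M. W t \<omega> - W s \<omega> \<in> U}"
proof -
  define xs where "xs = sorted_list_of_set J"
  define p where "p = length xs"
  have xs: "sorted xs" "set xs = J" using J by (auto simp: xs_def)
  \<comment> \<open>Index 0 is time 0, indices 1 to p enumerate \<open>J\<close>, index p + 1 is s
    and all later ones are t. So the increments below p + 1 end at s, and increment p + 1 runs from
    s to t.\<close>
  define \<tau> where "\<tau> i = (if i = 0 then 0 else if i \<le> p then xs ! (i - 1) else if i = p + 1 then s else t)" for i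
  define Z where "Z i \<omega> = W (\<tau> (Suc i)) \<omega> - W (\<tau> i) \<omega>" for i \<omega>
  have range: "xs ! i \<in> {0..s}" if "i < p" for i
    using that J xs nth_mem[of i xs] by (auto simp: p_def)
  have \<tau>_mono: "\<tau> i \<le> \<tau> (Suc i)" if "i < p + 2" for i
    using that range[of i] range[of "i - 1"] st sorted_nth_mono[OF xs(1), of "i - 1" i]
    by (auto simp: \<tau>_def p_def)
  have \<tau>_nonneg: "0 \<le> \<tau> i" for i
    using range[of "i - 1"] st by (auto simp: \<tau>_def)
  have [measurable]: "W (\<tau> i) \<in> borel_measurable M" for i by (rule W_measurable[OF \<tau>_nonneg])
  have [measurable]: "Z i \<in> borel_measurable M" for i unfolding Z_def by measurable
  have "\<forall>(k::nat) \<tau>. 0 \<le> \<tau> 0 \<longrightarrow> (\<forall>i<k. \<tau> i \<le> \<tau> (Suc i)) \<longrightarrow>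
        indep_vars (\<lambda>_. borel) (\<lambda>i \<omega>. W (\<tau> (Suc i)) \<omega> - W (\<tau> i) \<omega>) {..<k}"
    using BM by (simp add: brownian_motion_def)
  then have "indep_vars (\<lambda>_. borel) Z {..<p + 2}"
    using \<tau>_mono \<tau>_nonneg[of 0] unfolding Z_def[abs_def] by blast
  then have ind: "indep_var (PiM {..<p + 1} (\<lambda>_. borel)) (\<lambda>\<omega>. \<lambda>i\<in>{..<p + 1}. Z i \<omega>)
      (PiM {p + 1} (\<lambda>_. borel)) (\<lambda>\<omega>. \<lambda>i\<in>{p + 1}. Z i \<omega>)"
    by (rule indep_var_restrict) auto
  let ?A = "{f \<in> space (PiM {..<p + 1} (\<lambda>_. borel)). \<forall>j\<in>{1..p}. (\<Sum>i<j. f i) \<in> B (\<tau> j)}"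
  let ?B = "{f \<in> space (PiM {p + 1} (\<lambda>_. borel)). f (p + 1) \<in> U}"
  let ?a = "{\<omega>\<in>space M. \<forall>j\<in>{1..p}. (\<Sum>i<j. Z i \<omega>) \<in> B (\<tau> j)}"
  let ?b = "{\<omega>\<in>space M. W t \<omega> - W s \<omega> \<in> U}"
  have J_eq: "J = \<tau> ` {1..p}"
  proof -
    have "J = (\<lambda>i. xs ! i) ` {..<p}" using xs by (auto simp: set_conv_nth p_def)
    also have "\<dots> = \<tau> ` {1..p}"
    proof (safe)
      fix i assume "i < p"
      then have "xs ! i = \<tau> (Suc i)" by (simp add: \<tau>_def)
      then show "xs ! i \<in> \<tau> ` {1..p}" using \<open>i < p\<close> by auto
    next
      fix i assume "i \<in> {1..p}"
      then have "\<tau> i = xs ! (i - 1)" "i - 1 < p" by (auto simp: \<tau>_def)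
      then show "\<tau> i \<in> (!) xs ` {..<p}" by auto
    qed
    finally show ?thesis .
  qed
  have B\<tau>: "B (\<tau> j) \<in> sets borel" if "j \<in> {1..p}" for j using that B J_eq by auto
  have "?A \<in> sets (PiM {..<p + 1} (\<lambda>_. borel))"
  proof (rule sets.sets_Collect_finite_All)
    fix j assume j: "j \<in> {1..p}"
    have "(\<lambda>f. \<Sum>i<j. f i :: real) \<in> borel_measurable (PiM {..<p + 1} (\<lambda>_. borel))"
      using j by (intro borel_measurable_sum[of "{..<j}" "\<lambda>i f. f i"] measurable_component_singleton) auto
    from measurable_sets[OF this B\<tau>[OF j]]
    show "{f \<in> space (PiM {..<p + 1} (\<lambda>_. borel)). (\<Sum>i<j. f i) \<in> B (\<tau> j)} \<in> sets (PiM {..<p + 1} (\<lambda>_. borel))"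
      by (simp add: vimage_def Int_def conj_commute)
  qed simp
  moreover have "?B \<in> sets (PiM {p + 1} (\<lambda>_. borel))"
    using measurable_sets[OF measurable_component_singleton[of "p + 1" "{p + 1}" "\<lambda>_. borel"] U]
    by (simp add: vimage_def Int_def conj_commute)
  ultimately have "prob ((\<lambda>\<omega>. (\<lambda>i\<in>{..<p + 1}. Z i \<omega>, \<lambda>i\<in>{p + 1}. Z i \<omega>)) -` (?A \<times> ?B) \<inter> space M)
      = prob ((\<lambda>\<omega>. \<lambda>i\<in>{..<p + 1}. Z i \<omega>) -` ?A \<inter> space M) * prob ((\<lambda>\<omega>. \<lambda>i\<in>{p + 1}. Z i \<omega>) -` ?B \<inter> space M)"
    by (rule indep_varD[OF ind])
  also have "(\<lambda>\<omega>. \<lambda>i\<in>{..<p + 1}. Z i \<omega>) -` ?A \<inter> space M = ?a"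
    by (auto simp: space_PiM PiE_def)
  also have "(\<lambda>\<omega>. \<lambda>i\<in>{p + 1}. Z i \<omega>) -` ?B \<inter> space M = ?b"
    by (auto simp: space_PiM PiE_def Z_def \<tau>_def)
  also have "(\<lambda>\<omega>. (\<lambda>i\<in>{..<p + 1}. Z i \<omega>, \<lambda>i\<in>{p + 1}. Z i \<omega>)) -` (?A \<times> ?B) \<inter> space M = ?a \<inter> ?b"
    by (auto simp: space_PiM PiE_def Z_def \<tau>_def)
  finally have main: "prob (?a \<inter> ?b) = prob ?a * prob ?b" .
  let ?c = "{\<omega>\<in>space M. \<forall>r\<in>J. W r \<omega> \<in> B r}"
  \<comment> \<open>The partial sums telescope to \<open>W (\<tau> j) - W 0\<close>, and
    \<open>W 0 = 0\<close> holds only almost surely, so the two events agree up to a null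
    set.\<close>
  have ac: "AE \<omega> in M. \<omega> \<in> ?a \<longleftrightarrow> \<omega> \<in> ?c"
  proof -
    have "AE \<omega> in M. W 0 \<omega> = 0" using BM by (simp add: brownian_motion_def)
    then show ?thesis
    proof eventually_elim
      case (elim \<omega>)
      have "(\<Sum>i<j. Z i \<omega>) = W (\<tau> j) \<omega>" for j
        using sum_lessThan_telescope[of "\<lambda>i. W (\<tau> i) \<omega>" j] elim by (simp add: Z_def \<tau>_def)
      then show ?case by (auto simp: J_eq)
    qed
  qed
  have a: "?a \<in> sets M"
  proof (rule sets.sets_Collect_finite_All)
    fix j assume "j \<in> {1..p}"
    from measurable_sets[OF _ B\<tau>[OF this], of "\<lambda>\<omega>. \<Sum>i<j. Z i \<omega>" M]
    show "{\<omega> \<in> space M. (\<Sum>i<j. Z i \<omega>) \<in> B (\<tau> j)} \<in> sets M"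
      by (simp add: vimage_def Int_def conj_commute)
  qed simp
  have c: "?c \<in> sets M"
  proof (rule sets.sets_Collect_finite_All)
    fix r assume "r \<in> J"
    then have "0 \<le> r" using J by auto
    from measurable_sets[OF W_measurable[OF this] B[OF \<open>r \<in> J\<close>]]
    show "{\<omega> \<in> space M. W r \<omega> \<in> B r} \<in> sets M"
      by (simp add: vimage_def Int_def conj_commute)
  qed (rule J)
  have b: "?b \<in> sets M"
    using st by (intro measurable_sets[OF _ U, of "\<lambda>\<omega>. W t \<omega> - W s \<omega>" M, unfolded vimage_def Int_def mem_Collect_eq conj_commute[of _ "_ \<in> space M"]]) measurable
  have "prob ?a = prob ?c"
    using ac a c by (intro finite_measure_eq_AE) auto
  moreover have "prob (?a \<inter> ?b) = prob (?c \<inter> ?b)"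
    using ac a b c by (intro finite_measure_eq_AE) auto
  ultimately show ?thesis using main by simp
qed

text \<open>Cylinder events form an intersection-stable system. Adding the null sets preserves this,
  since a null set meets any event in a null set, and preserves independence, since both sides of
  the product formula vanish. The enlarged system generates every event of the augmented
  \<open>F s\<close>.\<close>

lemma indep_increment:
  assumes st: "0 \<le> s" "s \<le> t"
  shows "indep_set (sets (F s)) (sigma_sets (space M) {(\<lambda>\<omega>. W t \<omega> - W s \<omega>) -` U \<inter> space M |U. U \<in> sets borel})"
proof -
  let ?D = "{(\<lambda>\<omega>. W t \<omega> - W s \<omega>) -` U \<inter> space M |U. U \<in> sets (borel :: real measure)}"
  define C where "C = {{\<omega>\<in>space M. \<forall>r\<in>J. W r \<omega> \<in> B r} |J B. finite J \<and> J \<subseteq> {0..s} \<and> (\<forall>r\<in>J. B r \<in> sets borel)}"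
  have Csets: "C \<subseteq> sets M"
  proof
    fix a assume "a \<in> C"
    then obtain J B where a: "a = {\<omega>\<in>space M. \<forall>r\<in>J. W r \<omega> \<in> B r}"
      and J: "finite J" "J \<subseteq> {0..s}" and B: "\<forall>r\<in>J. B r \<in> sets borel"
      by (auto simp: C_def)
    show "a \<in> sets M" unfolding a
    proof (rule sets.sets_Collect_finite_All)
      fix r assume "r \<in> J"
      then have "0 \<le> r" "B r \<in> sets borel" using J B by auto
      from measurable_sets[OF W_measurable[OF this(1)] this(2)]
      show "{\<omega> \<in> space M. W r \<omega> \<in> B r} \<in> sets M"
        by (simp add: vimage_def Int_def conj_commute)
    qed (rule J)
  qed
  have Dsets: "?D \<subseteq> sets M"
    using st measurable_sets[of "\<lambda>\<omega>. W t \<omega> - W s \<omega>" M] by auto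
  have "indep_set (C \<union> null_sets M) ?D"
    unfolding indep_sets2_eq
  proof (intro conjI ballI)
    fix a b assume "a \<in> C \<union> null_sets M" and bD: "b \<in> ?D"
    then consider "a \<in> C" | "a \<in> null_sets M" by blast
    then show "prob (a \<inter> b) = prob a * prob b"
    proof cases
      case 1
      then obtain J B where a: "a = {\<omega>\<in>space M. \<forall>r\<in>J. W r \<omega> \<in> B r}"
        and J: "finite J" "J \<subseteq> {0..s}" and B: "\<forall>r\<in>J. B r \<in> sets borel"
        by (auto simp: C_def)
      obtain U where U: "U \<in> sets borel" and b: "b = {\<omega>\<in>space M. W t \<omega> - W s \<omega> \<in> U}"
        using bD by auto
      show ?thesis unfolding a b using J B st U by (intro increment_indep_cylinder) auto
    next
      case 2
      with bD Dsets have "a \<inter> b \<in> null_sets M" by (intro null_set_Int2) auto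
      with 2 show ?thesis by (simp add: null_sets_def measure_def)
    qed
  qed (use Csets Dsets in auto)
  moreover have "Int_stable (C \<union> null_sets M)"
  proof (rule Int_stableI)
    fix a b assume a: "a \<in> C \<union> null_sets M" and b: "b \<in> C \<union> null_sets M"
    have sets: "a \<in> sets M" "b \<in> sets M" using a b Csets by auto
    show "a \<inter> b \<in> C \<union> null_sets M"
    proof (cases "a \<in> C \<and> b \<in> C")
      case True
      then obtain J B J' B' where a: "a = {\<omega>\<in>space M. \<forall>r\<in>J. W r \<omega> \<in> B r}"
        and J: "finite J" "J \<subseteq> {0..s}" and B: "\<forall>r\<in>J. B r \<in> sets borel"
        and b: "b = {\<omega>\<in>space M. \<forall>r\<in>J'. W r \<omega> \<in> B' r}"
        and J': "finite J'" "J' \<subseteq> {0..s}" and B': "\<forall>r\<in>J'. B' r \<in> sets borel"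
        unfolding C_def by blast
      let ?B = "\<lambda>r. (if r \<in> J then B r else UNIV) \<inter> (if r \<in> J' then B' r else UNIV)"
      have "a \<inter> b = {\<omega>\<in>space M. \<forall>r\<in>J \<union> J'. W r \<omega> \<in> ?B r}"
        unfolding a b by auto
      moreover have "\<forall>r\<in>J \<union> J'. ?B r \<in> sets borel" using B B' by auto
      ultimately have "a \<inter> b \<in> C" unfolding C_def using J J' 
        by (intro CollectI exI[of _ "J \<union> J'"] exI[of _ ?B]) auto
      then show ?thesis by simp
    next
      case False
      then have "a \<in> null_sets M \<or> b \<in> null_sets M" using a b by blast
      then have "a \<inter> b \<in> null_sets M" using sets by (auto intro: null_set_Int1 null_set_Int2)
      then show ?thesis by simp
    qed
  qed
  moreover have "Int_stable ?D"
  proof (rule Int_stableI)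
    fix a b assume "a \<in> ?D" "b \<in> ?D"
    then obtain U V where "U \<in> sets borel" "V \<in> sets borel"
      "a = (\<lambda>\<omega>. W t \<omega> - W s \<omega>) -` U \<inter> space M" "b = (\<lambda>\<omega>. W t \<omega> - W s \<omega>) -` V \<inter> space M" by auto
    then show "a \<inter> b \<in> ?D" by (intro CollectI exI[of _ "U \<inter> V"]) auto
  qed
  ultimately have ind: "indep_set (sigma_sets (space M) (C \<union> null_sets M)) (sigma_sets (space M) ?D)"
    by (rule indep_set_sigma_sets)
  have "sets (F s) \<subseteq> sigma_sets (space M) (C \<union> null_sets M)"
    unfolding sets_F
  proof (rule sigma_sets_mono', safe)
    fix r :: real and S :: "real set" assume "r \<in> {0..s}" "S \<in> sets borel" and *: "W r -` S \<inter> space M \<notin> null_sets M"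
    then have "W r -` S \<inter> space M \<in> C"
      unfolding C_def by (intro CollectI exI[of _ "{r}"] exI[of _ "\<lambda>_. S"]) auto
    then show "W r -` S \<inter> space M \<in> C" .
  qed
  with ind show ?thesis unfolding indep_sets2_eq by blast
qed

text \<open>A general \<open>g\<close> covers both uses: the identity for the martingale property
  and the square for the isometry.\<close>

lemma
  fixes \<zeta> :: "'w \<Rightarrow> real" and g :: "real \<Rightarrow> real"
  assumes st: "0 \<le> s" "s \<le> t" and \<zeta>: "\<zeta> \<in> borel_measurable (F s)" "integrable M \<zeta>"
    and g: "g \<in> borel_measurable borel" "integrable M (\<lambda>\<omega>. g (W t \<omega> - W s \<omega>))"
  shows integrable_mult_increment: "integrable M (\<lambda>\<omega>. \<zeta> \<omega> * g (W t \<omega> - W s \<omega>))"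
    and expectation_mult_increment:
      "expectation (\<lambda>\<omega>. \<zeta> \<omega> * g (W t \<omega> - W s \<omega>)) = expectation \<zeta> * expectation (\<lambda>\<omega>. g (W t \<omega> - W s \<omega>))"
proof -
  let ?D = "{(\<lambda>\<omega>. W t \<omega> - W s \<omega>) -` U \<inter> space M |U. U \<in> sets (borel :: real measure)}"
  have "sigma_sets (space M) {\<zeta> -` A \<inter> space M |A. A \<in> sets borel} \<subseteq> sets (F s)"
    using measurable_sets[OF \<zeta>(1)] sets.sigma_sets_subset[of "{\<zeta> -` A \<inter> space M |A. A \<in> sets borel}" "F s"]
    by auto
  moreover have "indep_set (sets (F s)) (sigma_sets (space M) ?D)"
    by (rule indep_increment[OF st])
  ultimately have "indep_set (sigma_sets (space M) {\<zeta> -` A \<inter> space M |A. A \<in> sets borel}) (sigma_sets (space M) ?D)"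
    unfolding indep_sets2_eq by blast
  then have "indep_var borel \<zeta> borel (\<lambda>\<omega>. W t \<omega> - W s \<omega>)"
    unfolding indep_var_eq using measurable_F[OF \<zeta>(1)] st by auto
  from indep_var_compose[OF this, of id borel g borel] g(1)
  have ind: "indep_var borel \<zeta> borel (\<lambda>\<omega>. g (W t \<omega> - W s \<omega>))"
    by (simp add: comp_def)
  show "integrable M (\<lambda>\<omega>. \<zeta> \<omega> * g (W t \<omega> - W s \<omega>))"
    by (rule indep_var_integrable[OF ind \<zeta>(2) g(2)])
  show "expectation (\<lambda>\<omega>. \<zeta> \<omega> * g (W t \<omega> - W s \<omega>)) = expectation \<zeta> * expectation (\<lambda>\<omega>. g (W t \<omega> - W s \<omega>))"
    by (rule indep_var_lebesgue_integral[OF ind \<zeta>(2) g(2)])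
qed

section \<open>Increments weighted by factors known in advance\<close>

lemma expectation_increment:
  assumes "0 \<le> s" "s \<le> t" "\<zeta> \<in> borel_measurable (F s)" "integrable M \<zeta>"
  shows "integrable M (\<lambda>\<omega>. \<zeta> \<omega> * (W t \<omega> - W s \<omega>))" "expectation (\<lambda>\<omega>. \<zeta> \<omega> * (W t \<omega> - W s \<omega>)) = 0"
  using integrable_mult_increment[OF assms, of "\<lambda>x. x"] expectation_mult_increment[OF assms, of "\<lambda>x. x"]
    W_increment[OF assms(1,2)] by simp_all

lemma expectation_increment_squared:
  assumes "0 \<le> s" "s \<le> t" "\<zeta> \<in> borel_measurable (F s)" "integrable M \<zeta>"
  shows "integrable M (\<lambda>\<omega>. \<zeta> \<omega> * (W t \<omega> - W s \<omega>)\<^sup>2)"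
    "expectation (\<lambda>\<omega>. \<zeta> \<omega> * (W t \<omega> - W s \<omega>)\<^sup>2) = (t - s) * expectation \<zeta>"
  using integrable_mult_increment[OF assms, of "\<lambda>x. x\<^sup>2"] expectation_mult_increment[OF assms, of "\<lambda>x. x\<^sup>2"]
    W_increment[OF assms(1,2)] by simp_all

text \<open>Splitting both increments at the end points of the overlap leaves only products of an increment with
  a factor known at its left end point. This makes the isometry available for two simple processes without
  passing to a common partition.\<close>

lemma increment_covariance_ordered:
  assumes ab: "0 \<le> a" "a \<le> b" and cd: "c \<le> d" and ac: "a \<le> c"
    and q: "q \<in> borel_measurable (F c)" and qB: "\<And>\<omega>. \<omega> \<in> space M \<Longrightarrow> \<bar>q \<omega>\<bar> \<le> K"
  shows "integrable M (\<lambda>\<omega>. (W b \<omega> - W a \<omega>) * (W d \<omega> - W c \<omega>) * q \<omega>) \<and>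
    expectation (\<lambda>\<omega>. (W b \<omega> - W a \<omega>) * (W d \<omega> - W c \<omega>) * q \<omega>)
      = max 0 (min b d - max a c) * expectation q"
proof -
  have c0: "0 \<le> c" using ab ac by simp
  note qM = measurable_F[OF q]
  have qI: "integrable M q" by (rule integrable_const_bound[of _ K]) (use qB qM in auto)
  have F_diff: "(\<lambda>\<omega>. W v \<omega> - W u \<omega>) \<in> borel_measurable (F w)" if "0 \<le> u" "u \<le> v" "v \<le> w" for u v w
    using that by (intro borel_measurable_diff W_adapted) auto
  have \<zeta>: "(\<lambda>\<omega>. (W v \<omega> - W u \<omega>) * q \<omega>) \<in> borel_measurable (F w)" "integrable M (\<lambda>\<omega>. (W v \<omega> - W u \<omega>) * q \<omega>)"
    if "0 \<le> u" "u \<le> v" "v \<le> w" "c \<le> w" for u v w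
    using that F_diff[of u v w] measurable_F_mono[OF q, of w]
    by (auto intro!: integrable_mult_bounded[OF _ qM qB] W_increment)
  show ?thesis
  proof (cases "b \<le> c")
    \<comment> \<open>The first increment is over by time c, so it joins \<open>q\<close> as a known
      factor.\<close>
    case True
    have "(\<lambda>\<omega>. (W b \<omega> - W a \<omega>) * (W d \<omega> - W c \<omega>) * q \<omega>)
        = (\<lambda>\<omega>. ((W b \<omega> - W a \<omega>) * q \<omega>) * (W d \<omega> - W c \<omega>))" by (simp add: ac_simps)
    moreover have "max 0 (min b d - max a c) = 0" using True ac by auto
    ultimately show ?thesis
      using expectation_increment[OF c0 cd \<zeta>[OF ab True]] by simp
  next
    case False
    \<comment> \<open>The overlap of the two intervals is from c to e. As e equals b or d, one of
      \<open>?f3\<close> and \<open>?f4\<close> vanishes identically; only \<open>?f2\<close>, the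
      square over the overlap, has a nonzero expectation in general.\<close>
    define e where "e = min b d"
    have e: "c \<le> e" "e \<le> b" "e \<le> d" "e = b \<or> e = d" using False cd by (auto simp: e_def)
    then have e0: "0 \<le> e" using c0 by simp
    let ?f1 = "\<lambda>\<omega>. ((W c \<omega> - W a \<omega>) * q \<omega>) * (W d \<omega> - W c \<omega>)"
    let ?f2 = "\<lambda>\<omega>. q \<omega> * (W e \<omega> - W c \<omega>)\<^sup>2"
    let ?f3 = "\<lambda>\<omega>. ((W e \<omega> - W c \<omega>) * q \<omega>) * (W d \<omega> - W e \<omega>)"
    let ?f4 = "\<lambda>\<omega>. ((W e \<omega> - W c \<omega>) * q \<omega>) * (W b \<omega> - W e \<omega>)"
    have split: "(\<lambda>\<omega>. (W b \<omega> - W a \<omega>) * (W d \<omega> - W c \<omega>) * q \<omega>)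
        = (\<lambda>\<omega>. ?f1 \<omega> + ?f2 \<omega> + ?f3 \<omega> + ?f4 \<omega>)"
      using e(4) by (auto simp: fun_eq_iff algebra_simps power2_eq_square)
    note 1 = expectation_increment[OF c0 cd \<zeta>[OF ab(1) ac order_refl order_refl]]
    note 2 = expectation_increment_squared[OF c0 e(1) q qI]
    note 3 = expectation_increment[OF e0 e(3) \<zeta>[OF c0 e(1) order_refl e(1)]]
    note 4 = expectation_increment[OF e0 e(2) \<zeta>[OF c0 e(1) order_refl e(1)]]
    have "max 0 (min b d - max a c) = e - c" using False ac cd by (auto simp: e_def)
    with 1 2 3 4 show ?thesis unfolding split by simp
  qed
qed

text \<open>The weight is known at the later of the two left end points, so exchanging the two
  increments reduces to the ordered case.\<close>

lemma increment_covariance: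
  fixes \<xi> \<eta> :: "'w \<Rightarrow> 'v::euclidean_space"
  assumes ab: "0 \<le> a" "a \<le> b" and cd: "0 \<le> c" "c \<le> d"
    and \<xi>: "\<xi> \<in> borel_measurable (F a)" "\<And>\<omega>. \<omega> \<in> space M \<Longrightarrow> norm (\<xi> \<omega>) \<le> K"
    and \<eta>: "\<eta> \<in> borel_measurable (F c)" "\<And>\<omega>. \<omega> \<in> space M \<Longrightarrow> norm (\<eta> \<omega>) \<le> L"
  shows "integrable M (\<lambda>\<omega>. (W b \<omega> - W a \<omega>) * (W d \<omega> - W c \<omega>) * (\<xi> \<omega> \<bullet> \<eta> \<omega>)) \<and>
    expectation (\<lambda>\<omega>. (W b \<omega> - W a \<omega>) * (W d \<omega> - W c \<omega>) * (\<xi> \<omega> \<bullet> \<eta> \<omega>))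
      = max 0 (min b d - max a c) * expectation (\<lambda>\<omega>. \<xi> \<omega> \<bullet> \<eta> \<omega>)"
proof (cases "a \<le> c")
  case True
  have "(\<lambda>\<omega>. \<xi> \<omega> \<bullet> \<eta> \<omega>) \<in> borel_measurable (F c)"
    using measurable_F_mono[OF \<xi>(1) True] \<eta>(1) by simp
  then show ?thesis using ab cd True bounded_inner[OF \<xi>(2) \<eta>(2)]
    by (intro increment_covariance_ordered) auto
next
  case False
  then have ca: "c \<le> a" by simp
  have "(\<lambda>\<omega>. \<xi> \<omega> \<bullet> \<eta> \<omega>) \<in> borel_measurable (F a)"
    using measurable_F_mono[OF \<eta>(1) ca] \<xi>(1) by simp
  then have "integrable M (\<lambda>\<omega>. (W d \<omega> - W c \<omega>) * (W b \<omega> - W a \<omega>) * (\<xi> \<omega> \<bullet> \<eta> \<omega>)) \<and>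
    expectation (\<lambda>\<omega>. (W d \<omega> - W c \<omega>) * (W b \<omega> - W a \<omega>) * (\<xi> \<omega> \<bullet> \<eta> \<omega>))
      = max 0 (min d b - max c a) * expectation (\<lambda>\<omega>. \<xi> \<omega> \<bullet> \<eta> \<omega>)"
    using ab cd ca bounded_inner[OF \<xi>(2) \<eta>(2)]
    by (intro increment_covariance_ordered) auto
  moreover have "(\<lambda>\<omega>. (W d \<omega> - W c \<omega>) * (W b \<omega> - W a \<omega>) * (\<xi> \<omega> \<bullet> \<eta> \<omega>))
      = (\<lambda>\<omega>. (W b \<omega> - W a \<omega>) * (W d \<omega> - W c \<omega>) * (\<xi> \<omega> \<bullet> \<eta> \<omega>))" by (simp add: ac_simps)
  ultimately show ?thesis by (simp add: min.commute max.commute)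
qed

end

section \<open>The Ito integral: isometry and martingale property\<close>

locale brownian_on = brownian +
  fixes T :: real
  assumes T_pos: "0 < T"
begin

sublocale dt: finite_measure "dt T"
  by (rule finite_measureI) (simp add: emeasure_restrict_space space_restrict_space emeasure_lborel_Icc_eq)

sublocale dtP: pair_sigma_finite "dt T" M ..

sublocale dtP: finite_measure "dtP M T"
  by (rule finite_measure_pair_measure) unfold_locales

section \<open>Simple processes\<close>

lemma simple_data_mono:
  assumes "simple_data M W T N \<tau> \<xi>" "i \<le> j" "j \<le> N"
  shows "\<tau> i \<le> \<tau> j"
  using assms(2,3)
proof (induction rule: dec_induct)
  case (step n)
  have "\<tau> n \<le> \<tau> (Suc n)" using assms(1) step.prems by (simp add: simple_data_def)
  with step show ?case by simp
qed simp

lemma simple_dataD: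
  assumes S: "simple_data M W T N \<tau> \<xi>" and i: "i < N"
  shows "0 \<le> \<tau> i" "\<tau> i \<le> \<tau> (Suc i)" "\<tau> (Suc i) \<le> T" "\<xi> i \<in> borel_measurable (F (\<tau> i))"
    "\<exists>c. \<forall>\<omega>\<in>space M. norm (\<xi> i \<omega>) \<le> c"
proof -
  have "0 \<le> \<tau> 0" "\<tau> N \<le> T" using S by (auto simp: simple_data_def)
  with simple_data_mono[OF S, of 0 i] simple_data_mono[OF S, of "Suc i" N] i
  show "0 \<le> \<tau> i" "\<tau> (Suc i) \<le> T" by auto
qed (use S i in \<open>auto simp: simple_data_def\<close>)

lemma increment_term_L2:
  fixes \<xi> :: "'a \<Rightarrow> 'v::euclidean_space"
  assumes "0 \<le> s" "s \<le> t" and \<xi>: "\<xi> \<in> borel_measurable M" "\<forall>\<omega>\<in>space M. norm (\<xi> \<omega>) \<le> c"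
  shows "(\<lambda>\<omega>. (W t \<omega> - W s \<omega>) *\<^sub>R \<xi> \<omega>) \<in> L2 M"
proof (rule L2_bound)
  show "(\<lambda>\<omega>. W t \<omega> - W s \<omega>) \<in> L2 M"
    using W_increment[OF assms(1,2)] assms(1,2) by (simp add: L2_def)
  show "AE \<omega> in M. norm ((W t \<omega> - W s \<omega>) *\<^sub>R \<xi> \<omega>) \<le> c * norm (W t \<omega> - W s \<omega>)"
    using \<xi>(2) by (intro AE_I2) (simp add: mult_right_mono mult.commute)
  have "W t \<in> borel_measurable M" "W s \<in> borel_measurable M" using assms(1,2) by auto
  with \<xi>(1) show "(\<lambda>\<omega>. (W t \<omega> - W s \<omega>) *\<^sub>R \<xi> \<omega>) \<in> borel_measurable M" by measurable
qed

lemma simple_integral_L2: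
  assumes S: "simple_data M W T N \<tau> \<xi>" and t: "0 \<le> t"
  shows "simple_integral W N \<tau> \<xi> t \<in> L2 M"
  unfolding simple_integral_def[abs_def]
proof (rule L2_sum)
  fix i assume i: "i \<in> {..<N}"
  then obtain c where "\<forall>\<omega>\<in>space M. norm (\<xi> i \<omega>) \<le> c" using simple_dataD(5)[OF S] by auto
  then show "(\<lambda>\<omega>. (W (min t (\<tau> (Suc i))) \<omega> - W (min t (\<tau> i)) \<omega>) *\<^sub>R \<xi> i \<omega>) \<in> L2 M"
    using simple_dataD[OF S, of i] i t by (intro increment_term_L2 measurable_F[of _ "\<tau> i"]) auto
qed

lemma simple_process_L2:
  assumes S: "simple_data M W T N \<tau> \<xi>"
  shows "(\<lambda>(s, \<omega>). simple_process N \<tau> \<xi> s \<omega>) \<in> L2 (dtP M T)"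
  unfolding simple_process_def split_beta'
proof (rule L2_sum)
  fix i assume i: "i \<in> {..<N}"
  then obtain c where c: "\<forall>\<omega>\<in>space M. norm (\<xi> i \<omega>) \<le> c" using simple_dataD(5)[OF S] by auto
  have \<xi>: "\<xi> i \<in> borel_measurable M"
    using simple_dataD(4)[OF S, of i] i measurable_F by auto
  show "(\<lambda>z. indicator {\<tau> i<..\<tau> (Suc i)} (fst z) *\<^sub>R \<xi> i (snd z)) \<in> L2 (dtP M T)"
  proof (rule dtP.L2_bounded)
    show "AE z in dtP M T. norm (indicator {\<tau> i<..\<tau> (Suc i)} (fst z) *\<^sub>R \<xi> i (snd z)) \<le> \<bar>c\<bar>"
      using c by (intro AE_I2) (force simp: space_pair_measure indicator_def)
    show "(\<lambda>z. indicator {\<tau> i<..\<tau> (Suc i)} (fst z) *\<^sub>R \<xi> i (snd z)) \<in> borel_measurable (dtP M T)"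
      by (intro borel_measurable_scaleR measurable_compose[OF measurable_fst] measurable_compose[OF measurable_snd]
          measurable_restrict_space1) (auto simp: \<xi>)
  qed
qed

text \<open>The martingale property in a form tested against \<open>\<eta>\<close>, which avoids
  conditional expectations. After time s each summand is an increment times a factor known at its
  left end point.\<close>

lemma simple_integral_orthogonal:
  fixes \<xi> :: "nat \<Rightarrow> 'a \<Rightarrow> 'v::euclidean_space"
  assumes S: "simple_data M W T N \<tau> \<xi>" and s: "0 \<le> s" "s \<le> T"
    and \<eta>: "\<eta> \<in> borel_measurable (F s)" "\<eta> \<in> L2 M"
  shows "ip M (\<lambda>\<omega>. simple_integral W N \<tau> \<xi> T \<omega> - simple_integral W N \<tau> \<xi> s \<omega>) \<eta> = 0"
proof -
  let ?a = "\<lambda>i. max s (\<tau> i)" and ?b = "\<lambda>i. max s (\<tau> (Suc i))"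
  \<comment> \<open>Truncation at T has no effect on u and v; subtracting the part truncated at s
    leaves the increment over the part of the interval beyond s.\<close>
  have minmax: "W (min T v) \<omega> - W (min T u) \<omega> - (W (min s v) \<omega> - W (min s u) \<omega>) = W (max s v) \<omega> - W (max s u) \<omega>"
    if "u \<le> v" "v \<le> T" for u v \<omega>
    using that by (cases "s \<le> u"; cases "s \<le> v") (auto simp: min_def max_def)
  have eq: "simple_integral W N \<tau> \<xi> T \<omega> - simple_integral W N \<tau> \<xi> s \<omega>
      = (\<Sum>i<N. (W (?b i) \<omega> - W (?a i) \<omega>) *\<^sub>R \<xi> i \<omega>)" for \<omega>
    unfolding simple_integral_def sum_subtractf[symmetric] scaleR_diff_left[symmetric]
    using simple_dataD(2,3)[OF S] by (intro sum.cong refl arg_cong2[where f=scaleR] minmax) auto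
  have *: "integrable M (\<lambda>\<omega>. (\<xi> i \<omega> \<bullet> \<eta> \<omega>) * (W (?b i) \<omega> - W (?a i) \<omega>)) \<and>
      expectation (\<lambda>\<omega>. (\<xi> i \<omega> \<bullet> \<eta> \<omega>) * (W (?b i) \<omega> - W (?a i) \<omega>)) = 0" if i: "i < N" for i
  proof -
    note D = simple_dataD[OF S i]
    then obtain c where c: "\<forall>\<omega>\<in>space M. norm (\<xi> i \<omega>) \<le> c" by auto
    have "\<xi> i \<in> borel_measurable (F (?a i))" "\<eta> \<in> borel_measurable (F (?a i))"
      using D(4) \<eta>(1) by (auto intro: measurable_F_mono)
    then have "(\<lambda>\<omega>. \<xi> i \<omega> \<bullet> \<eta> \<omega>) \<in> borel_measurable (F (?a i))" by simp
    moreover have "\<xi> i \<in> L2 M"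
      using c D(4) by (intro L2_bounded[of _ c]) (auto intro: measurable_F)
    ultimately show ?thesis
      using expectation_increment[of "?a i" "?b i" "\<lambda>\<omega>. \<xi> i \<omega> \<bullet> \<eta> \<omega>"] s D \<eta>(2)
      by (auto simp: L2_integrable_inner)
  qed
  have "ip M (\<lambda>\<omega>. simple_integral W N \<tau> \<xi> T \<omega> - simple_integral W N \<tau> \<xi> s \<omega>) \<eta>
      = expectation (\<lambda>\<omega>. \<Sum>i<N. (\<xi> i \<omega> \<bullet> \<eta> \<omega>) * (W (?b i) \<omega> - W (?a i) \<omega>))"
    unfolding ip_def eq by (simp add: inner_sum_left mult.commute)
  also have "\<dots> = 0" using * by (subst Bochner_Integration.integral_sum) auto
  finally show ?thesis .
qed

text \<open>For intersections of step intervals, \<open>max 0 (b - a)\<close> is the length also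
  when they are disjoint; it has the form found in \<open>increment_covariance\<close>.\<close>

lemma integral_dtP_product:
  fixes q :: "'a \<Rightarrow> real"
  assumes q: "integrable M q" and ab: "0 \<le> a" "b \<le> T"
  shows "integrable (dtP M T) (\<lambda>(s, \<omega>). indicator {a<..b} s * q \<omega>)"
    "(LINT (s, \<omega>)|dtP M T. indicator {a<..b} s * q \<omega>) = max 0 (b - a) * expectation q"
proof -
  show int: "integrable (dtP M T) (\<lambda>(s, \<omega>). indicator {a<..b} s * q \<omega>)"
  proof (rule dtP.Fubini_integrable)
    show "(\<lambda>(s, \<omega>). indicator {a<..b} s * q \<omega>) \<in> borel_measurable (dtP M T)"
      unfolding split_beta'
      by (intro borel_measurable_times measurable_compose[OF measurable_fst] measurable_compose[OF measurable_snd]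
          measurable_restrict_space1 borel_measurable_integrable[OF q]) auto
    have "(\<lambda>s. (LINT \<omega>|M. norm (case (s, \<omega>) of (s, \<omega>) \<Rightarrow> indicator {a<..b} s * q \<omega>)))
        = (\<lambda>s. indicator {a<..b} s * (LINT \<omega>|M. \<bar>q \<omega>\<bar>))" by (simp add: abs_mult)
    then show "integrable (dt T) (\<lambda>s. (LINT \<omega>|M. norm (case (s, \<omega>) of (s, \<omega>) \<Rightarrow> indicator {a<..b} s * q \<omega>)))"
      by (auto intro!: dt.integrable_const_bound[of _ 1] integrable_mult_left measurable_restrict_space1 simp: indicator_def)
    show "AE s in dt T. integrable M (\<lambda>\<omega>. case (s, \<omega>) of (s, \<omega>) \<Rightarrow> indicator {a<..b} s * q \<omega>)"
      using q by simp
  qed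
  have "(LINT (s, \<omega>)|dtP M T. indicator {a<..b} s * q \<omega>) = (LINT s|dt T. LINT \<omega>|M. indicator {a<..b} s * q \<omega>)"
    by (rule dtP.integral_fst[OF int, symmetric])
  also have "\<dots> = (LINT s|dt T. indicator {a<..b} s) * expectation q" by simp
  also have "(LINT s|dt T. indicator {a<..b} s :: real) = (LINT s|lborel. indicator {0..T} s *\<^sub>R indicator {a<..b} s)"
    by (rule integral_restrict_space) auto
  also have "\<dots> = (LINT s|lborel. indicator {a<..b} s)"
    using ab by (intro Bochner_Integration.integral_cong refl) (auto simp: indicator_def of_bool_def)
  also have "\<dots> = max 0 (b - a)" by (auto simp: max_def)
  finally show "(LINT (s, \<omega>)|dtP M T. indicator {a<..b} s * q \<omega>) = max 0 (b - a) * expectation q" .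
qed

text \<open>Stated for two unrelated partitions, because two integrands come with separate
  approximating sequences. For every pair of steps both sides give the length of the overlap times
  the expected inner product of the step values.\<close>

lemma simple_isometry:
  fixes \<xi> \<eta> :: "nat \<Rightarrow> 'a \<Rightarrow> 'v::euclidean_space"
  assumes S: "simple_data M W T N \<tau> \<xi>" and S': "simple_data M W T N' \<tau>' \<eta>"
  shows "ip M (simple_integral W N \<tau> \<xi> T) (simple_integral W N' \<tau>' \<eta> T)
    = ip (dtP M T) (\<lambda>(s, \<omega>). simple_process N \<tau> \<xi> s \<omega>) (\<lambda>(s, \<omega>). simple_process N' \<tau>' \<eta> s \<omega>)"
proof -
  let ?r = "\<lambda>i j \<omega>. (W (\<tau> (Suc i)) \<omega> - W (\<tau> i) \<omega>) * (W (\<tau>' (Suc j)) \<omega> - W (\<tau>' j) \<omega>) * (\<xi> i \<omega> \<bullet> \<eta> j \<omega>)"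
  let ?l = "\<lambda>i j. \<lambda>(s, \<omega>). indicator {max (\<tau> i) (\<tau>' j)<..min (\<tau> (Suc i)) (\<tau>' (Suc j))} s * (\<xi> i \<omega> \<bullet> \<eta> j \<omega>)"
  have r: "integrable M (?r i j) \<and> expectation (?r i j)
      = max 0 (min (\<tau> (Suc i)) (\<tau>' (Suc j)) - max (\<tau> i) (\<tau>' j)) * expectation (\<lambda>\<omega>. \<xi> i \<omega> \<bullet> \<eta> j \<omega>)"
    and l: "integrable (dtP M T) (?l i j) \<and> integral\<^sup>L (dtP M T) (?l i j)
      = max 0 (min (\<tau> (Suc i)) (\<tau>' (Suc j)) - max (\<tau> i) (\<tau>' j)) * expectation (\<lambda>\<omega>. \<xi> i \<omega> \<bullet> \<eta> j \<omega>)"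
    if i: "i < N" and j: "j < N'" for i j
  proof -
    note D = simple_dataD[OF S i] and D' = simple_dataD[OF S' j]
    then obtain c c' where c: "\<And>\<omega>. \<omega> \<in> space M \<Longrightarrow> norm (\<xi> i \<omega>) \<le> c" "\<And>\<omega>. \<omega> \<in> space M \<Longrightarrow> norm (\<eta> j \<omega>) \<le> c'" by auto
    show "integrable M (?r i j) \<and> expectation (?r i j)
      = max 0 (min (\<tau> (Suc i)) (\<tau>' (Suc j)) - max (\<tau> i) (\<tau>' j)) * expectation (\<lambda>\<omega>. \<xi> i \<omega> \<bullet> \<eta> j \<omega>)"
      by (rule increment_covariance[OF D(1,2) D'(1,2) D(4) c(1) D'(4) c(2)])
    have "\<xi> i \<in> L2 M" "\<eta> j \<in> L2 M"
      using c D(4) D'(4) by (auto intro!: L2_bounded AE_I2 measurable_F)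
    then have "integrable M (\<lambda>\<omega>. \<xi> i \<omega> \<bullet> \<eta> j \<omega>)" by (rule L2_integrable_inner)
    then show "integrable (dtP M T) (?l i j) \<and> integral\<^sup>L (dtP M T) (?l i j)
      = max 0 (min (\<tau> (Suc i)) (\<tau>' (Suc j)) - max (\<tau> i) (\<tau>' j)) * expectation (\<lambda>\<omega>. \<xi> i \<omega> \<bullet> \<eta> j \<omega>)"
      using D D' by (intro conjI integral_dtP_product) auto
  qed
  have "ip M (simple_integral W N \<tau> \<xi> T) (simple_integral W N' \<tau>' \<eta> T)
      = expectation (\<lambda>\<omega>. \<Sum>i<N. \<Sum>j<N'. ?r i j \<omega>)"
  proof -
    \<comment> \<open>The partition ends no later than T, so truncation at T disappears.\<close>
    have T: "simple_integral W N \<tau> \<xi> T \<omega> = (\<Sum>i<N. (W (\<tau> (Suc i)) \<omega> - W (\<tau> i) \<omega>) *\<^sub>R \<xi> i \<omega>)"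
      if "simple_data M W T N \<tau> \<xi>" for N \<tau> \<xi> \<omega>
      unfolding simple_integral_def using simple_dataD[OF that]
      by (intro sum.cong refl) (force simp: min_def)
    show ?thesis
      unfolding ip_def T[OF S] T[OF S'] inner_sum_left
      unfolding inner_sum_right by (simp add: ac_simps)
  qed
  also have "\<dots> = (\<Sum>i<N. \<Sum>j<N'. expectation (?r i j))"
    using r by (intro integral_double_sum) auto
  also have "\<dots> = (\<Sum>i<N. \<Sum>j<N'. integral\<^sup>L (dtP M T) (?l i j))"
    using r l by (intro sum.cong refl) auto
  also have "\<dots> = integral\<^sup>L (dtP M T) (\<lambda>z. \<Sum>i<N. \<Sum>j<N'. ?l i j z)"
    using l by (intro integral_double_sum[symmetric]) auto
  also have "\<dots> = ip (dtP M T) (\<lambda>(s, \<omega>). simple_process N \<tau> \<xi> s \<omega>) (\<lambda>(s, \<omega>). simple_process N' \<tau>' \<eta> s \<omega>)"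
  proof -
    have "(\<Sum>i<N. \<Sum>j<N'. ?l i j z) = (case z of (s, \<omega>) \<Rightarrow> simple_process N \<tau> \<xi> s \<omega>) \<bullet>
        (case z of (s, \<omega>) \<Rightarrow> simple_process N' \<tau>' \<eta> s \<omega>)" for z
      unfolding split_beta' simple_process_def inner_sum_left
      unfolding inner_sum_right by (intro sum.cong refl) (auto simp: indicator_def)
    then show ?thesis by (simp add: ip_def)
  qed
  finally show ?thesis .
qed

section \<open>Passage to square-integrable integrands\<close>

lemma ito_integralE:
  assumes "ito_integral M W T H I"
  obtains N \<tau> \<xi> where "\<And>k::nat. simple_data M W T (N k) (\<tau> k) (\<xi> k)"
    "(\<lambda>k. ip (dtP M T) (\<lambda>z. (case z of (s, \<omega>) \<Rightarrow> simple_process (N k) (\<tau> k) (\<xi> k) s \<omega>) - case_prod H z)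
         (\<lambda>z. (case z of (s, \<omega>) \<Rightarrow> simple_process (N k) (\<tau> k) (\<xi> k) s \<omega>) - case_prod H z)) \<longlonglongrightarrow> 0"
    "\<And>t. 0 \<le> t \<Longrightarrow> t \<le> T \<Longrightarrow> I t \<in> L2 M"
    "\<And>t. 0 \<le> t \<Longrightarrow> t \<le> T \<Longrightarrow>
       (\<lambda>k. ip M (\<lambda>\<omega>. simple_integral W (N k) (\<tau> k) (\<xi> k) t \<omega> - I t \<omega>)
          (\<lambda>\<omega>. simple_integral W (N k) (\<tau> k) (\<xi> k) t \<omega> - I t \<omega>)) \<longlonglongrightarrow> 0"
proof -
  from assms obtain N \<tau> \<xi> where S: "\<And>k::nat. simple_data M W T (N k) (\<tau> k) (\<xi> k)"
    and H: "H \<in> L2F M W T" and I: "\<And>t. t \<in> {0..T} \<Longrightarrow> I t \<in> borel_measurable (F t)"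
    and lim: "(\<lambda>k. \<integral>\<^sup>+ (s, \<omega>). ennreal ((norm (simple_process (N k) (\<tau> k) (\<xi> k) s \<omega> - H s \<omega>))\<^sup>2)
                \<partial>(dtP M T)) \<longlonglongrightarrow> 0"
    and limI: "\<And>t. t \<in> {0..T} \<Longrightarrow>
          (\<lambda>k. \<integral>\<^sup>+ \<omega>. ennreal ((norm (simple_integral W (N k) (\<tau> k) (\<xi> k) t \<omega> - I t \<omega>))\<^sup>2) \<partial>M)
             \<longlonglongrightarrow> 0"
    unfolding ito_integral_def by blast
  have "case_prod H \<in> borel_measurable (dtP M T)" using H by (simp add: L2F_def adapted_def)
  from L2_limit(2)[OF simple_process_L2[OF S] this] lim
  have 1: "(\<lambda>k. ip (dtP M T) (\<lambda>z. (case z of (s, \<omega>) \<Rightarrow> simple_process (N k) (\<tau> k) (\<xi> k) s \<omega>) - case_prod H z)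
         (\<lambda>z. (case z of (s, \<omega>) \<Rightarrow> simple_process (N k) (\<tau> k) (\<xi> k) s \<omega>) - case_prod H z)) \<longlonglongrightarrow> 0"
    by (simp add: split_beta')
  have 2: "I t \<in> L2 M \<and> (\<lambda>k. ip M (\<lambda>\<omega>. simple_integral W (N k) (\<tau> k) (\<xi> k) t \<omega> - I t \<omega>)
          (\<lambda>\<omega>. simple_integral W (N k) (\<tau> k) (\<xi> k) t \<omega> - I t \<omega>)) \<longlonglongrightarrow> 0" if "0 \<le> t" "t \<le> T" for t
  proof -
    have t: "t \<in> {0..T}" using that by simp
    show ?thesis
      using L2_limit[OF simple_integral_L2[OF S that(1)] measurable_F[OF I[OF t]] limI[OF t]] by simp
  qed
  show ?thesis using S 1 2 by (intro that) auto
qed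

lemma ito_integral_L2:
  assumes "ito_integral M W T H I" "0 \<le> t" "t \<le> T"
  shows "I t \<in> L2 M"
  using assms by (elim ito_integralE) auto

text \<open>The identity holds along the simple approximations, and pairing with the fixed
  \<open>\<eta>\<close> is continuous; the limits are taken separately at the two times T and
  s.\<close>

lemma ito_integral_orthogonal:
  assumes I: "ito_integral M W T H I" and s: "0 \<le> s" "s \<le> T"
    and \<eta>: "\<eta> \<in> borel_measurable (F s)" "\<eta> \<in> L2 M"
  shows "ip M (I T) \<eta> = ip M (I s) \<eta>"
proof -
  from I obtain N \<tau> \<xi> where S: "\<And>k::nat. simple_data M W T (N k) (\<tau> k) (\<xi> k)"
    and L: "\<And>t. 0 \<le> t \<Longrightarrow> t \<le> T \<Longrightarrow> I t \<in> L2 M"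
    and lim: "\<And>t. 0 \<le> t \<Longrightarrow> t \<le> T \<Longrightarrow>
       (\<lambda>k. ip M (\<lambda>\<omega>. simple_integral W (N k) (\<tau> k) (\<xi> k) t \<omega> - I t \<omega>)
          (\<lambda>\<omega>. simple_integral W (N k) (\<tau> k) (\<xi> k) t \<omega> - I t \<omega>)) \<longlonglongrightarrow> 0"
    by (elim ito_integralE) blast
  have l: "(\<lambda>k. ip M (simple_integral W (N k) (\<tau> k) (\<xi> k) t) \<eta>) \<longlonglongrightarrow> ip M (I t) \<eta>" if "0 \<le> t" "t \<le> T" for t
    using tendsto_ip[OF simple_integral_L2[OF S that(1)] L[OF that] \<eta>(2) \<eta>(2) lim[OF that]] by (simp add: ip_def)
  have "ip M (simple_integral W (N k) (\<tau> k) (\<xi> k) T) \<eta> = ip M (simple_integral W (N k) (\<tau> k) (\<xi> k) s) \<eta>" for k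
    using simple_integral_orthogonal[OF S s \<eta>] ip_diff_left[OF simple_integral_L2[OF S] simple_integral_L2[OF S] \<eta>(2)] s
    by simp
  with l[of T] l[of s] s show ?thesis by (auto intro: LIMSEQ_unique)
qed

lemma ito_isometry:
  assumes I: "ito_integral M W T H I" and J: "ito_integral M W T K J"
  shows "ip M (I T) (J T) = ip (dtP M T) (case_prod H) (case_prod K)"
proof -
  have T: "0 \<le> T" "T \<le> T" using T_pos by auto
  have HK: "case_prod H \<in> L2 (dtP M T)" "case_prod K \<in> L2 (dtP M T)"
    using I J by (auto simp: ito_integral_def L2F_def)
  from I obtain N \<tau> \<xi> where S: "\<And>k::nat. simple_data M W T (N k) (\<tau> k) (\<xi> k)"
    and H: "(\<lambda>k. ip (dtP M T) (\<lambda>z. (case z of (s, \<omega>) \<Rightarrow> simple_process (N k) (\<tau> k) (\<xi> k) s \<omega>) - case_prod H z)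
         (\<lambda>z. (case z of (s, \<omega>) \<Rightarrow> simple_process (N k) (\<tau> k) (\<xi> k) s \<omega>) - case_prod H z)) \<longlonglongrightarrow> 0"
    and lim: "\<And>t. 0 \<le> t \<Longrightarrow> t \<le> T \<Longrightarrow>
       (\<lambda>k. ip M (\<lambda>\<omega>. simple_integral W (N k) (\<tau> k) (\<xi> k) t \<omega> - I t \<omega>)
          (\<lambda>\<omega>. simple_integral W (N k) (\<tau> k) (\<xi> k) t \<omega> - I t \<omega>)) \<longlonglongrightarrow> 0"
    by (elim ito_integralE) blast
  from J obtain N' \<tau>' \<xi>' where S': "\<And>k::nat. simple_data M W T (N' k) (\<tau>' k) (\<xi>' k)"
    and K: "(\<lambda>k. ip (dtP M T) (\<lambda>z. (case z of (s, \<omega>) \<Rightarrow> simple_process (N' k) (\<tau>' k) (\<xi>' k) s \<omega>) - case_prod K z)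
         (\<lambda>z. (case z of (s, \<omega>) \<Rightarrow> simple_process (N' k) (\<tau>' k) (\<xi>' k) s \<omega>) - case_prod K z)) \<longlonglongrightarrow> 0"
    and lim': "\<And>t. 0 \<le> t \<Longrightarrow> t \<le> T \<Longrightarrow>
       (\<lambda>k. ip M (\<lambda>\<omega>. simple_integral W (N' k) (\<tau>' k) (\<xi>' k) t \<omega> - J t \<omega>)
          (\<lambda>\<omega>. simple_integral W (N' k) (\<tau>' k) (\<xi>' k) t \<omega> - J t \<omega>)) \<longlonglongrightarrow> 0"
    by (elim ito_integralE) blast
  have "(\<lambda>k. ip M (simple_integral W (N k) (\<tau> k) (\<xi> k) T) (simple_integral W (N' k) (\<tau>' k) (\<xi>' k) T))
      \<longlonglongrightarrow> ip M (I T) (J T)"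
    by (rule tendsto_ip[OF simple_integral_L2[OF S T(1)] ito_integral_L2[OF I T] simple_integral_L2[OF S' T(1)]
      ito_integral_L2[OF J T] lim[OF T] lim'[OF T]])
  moreover have "(\<lambda>k. ip M (simple_integral W (N k) (\<tau> k) (\<xi> k) T) (simple_integral W (N' k) (\<tau>' k) (\<xi>' k) T))
      \<longlonglongrightarrow> ip (dtP M T) (case_prod H) (case_prod K)"
    unfolding simple_isometry[OF S S']
    by (rule tendsto_ip[OF simple_process_L2[OF S] HK(1) simple_process_L2[OF S'] HK(2) H K])
  ultimately show ?thesis by (rule LIMSEQ_unique)
qed

subsection \<open>The product formula in expectation\<close>

lemma dt_measurable: "(\<lambda>s. s) \<in> borel_measurable (dt T)"
  by (rule measurable_restrict_space1) simp

lemma L2F_adapted: "b \<in> L2F M W T \<Longrightarrow> t \<in> {0..T} \<Longrightarrow> b t \<in> borel_measurable (F t)"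
  by (simp add: L2F_def adapted_def)

lemma L2F_L2: "b \<in> L2F M W T \<Longrightarrow> case_prod b \<in> L2 (dtP M T)"
  by (simp add: L2F_def)

lemma L2_sections:
  assumes "f \<in> L2 (dtP M T)"
  shows "AE s in dt T. (\<lambda>\<omega>. f (s, \<omega>)) \<in> L2 M" "AE \<omega> in M. (\<lambda>s. f (s, \<omega>)) \<in> L2 (dt T)"
proof -
  note f = L2_measurable[OF assms]
  have int: "integrable (dtP M T) (\<lambda>(s, \<omega>). (norm (f (s, \<omega>)))\<^sup>2)"
    using L2_integrable_norm2[OF assms] by (simp add: split_beta')
  show "AE s in dt T. (\<lambda>\<omega>. f (s, \<omega>)) \<in> L2 M"
    using dtP.AE_integrable_fst[OF int] AE_space
    by eventually_elim (simp add: L2_def measurable_compose[OF measurable_Pair1' f])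
  show "AE \<omega> in M. (\<lambda>s. f (s, \<omega>)) \<in> L2 (dt T)"
    using dtP.AE_integrable_snd[OF int] AE_space
    by eventually_elim (simp add: L2_def measurable_compose[OF measurable_Pair2' f])
qed

text \<open>Every slice is dominated by the supremum. The supremum over uncountably many times may
  fail to be measurable, but the nonnegative integral is monotone on arbitrary functions.\<close>

lemma L2Fc_L2:
  assumes X: "X \<in> L2Fc M W T"
  shows "\<And>t. t \<in> {0..T} \<Longrightarrow> X t \<in> L2 M" "X \<in> L2F M W T"
proof -
  have ad: "adapted M W T X" and sup: "(\<integral>\<^sup>+ \<omega>. (SUP t\<in>{0..T}. ennreal ((norm (X t \<omega>))\<^sup>2)) \<partial>M) < \<infinity>"
    using X by (auto simp: L2Fc_def)
  have le: "(\<integral>\<^sup>+ \<omega>. ennreal ((norm (X t \<omega>))\<^sup>2) \<partial>M) \<le> (\<integral>\<^sup>+ \<omega>. (SUP t\<in>{0..T}. ennreal ((norm (X t \<omega>))\<^sup>2)) \<partial>M)"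
    if "t \<in> {0..T}" for t
    using that by (intro nn_integral_mono SUP_upper)
  show "X t \<in> L2 M" if t: "t \<in> {0..T}" for t
    using ad t le[OF t] sup measurable_F[of "X t" t] by (intro L2_of_nn_integral) (auto simp: adapted_def)
  have "(\<integral>\<^sup>+ z. ennreal ((norm (case_prod X z))\<^sup>2) \<partial>dtP M T)
      = (\<integral>\<^sup>+ s. \<integral>\<^sup>+ \<omega>. ennreal ((norm (X s \<omega>))\<^sup>2) \<partial>M \<partial>dt T)"
    using ad by (subst nn_integral_fst[symmetric]) (auto simp: adapted_def)
  also have "\<dots> \<le> (\<integral>\<^sup>+ s. (\<integral>\<^sup>+ \<omega>. (SUP t\<in>{0..T}. ennreal ((norm (X t \<omega>))\<^sup>2)) \<partial>M) \<partial>dt T)"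
    by (intro nn_integral_mono le) (simp add: space_restrict_space)
  also have "\<dots> < \<infinity>"
    using sup dt.emeasure_finite[of "space (dt T)"] by (simp add: ennreal_mult_less_top less_top[symmetric] ennreal_mult_eq_top_iff)
  finally have "case_prod X \<in> L2 (dtP M T)"
    using ad by (intro L2_of_nn_integral) (auto simp: adapted_def)
  with ad show "X \<in> L2F M W T" by (simp add: L2F_def)
qed

text \<open>The time integral up to t, taken over the fixed interval up to T with an indicator, so
  that all t share one measure space and Fubini's theorem applies.\<close>

definition prim :: "(real \<Rightarrow> 'a \<Rightarrow> 'v::euclidean_space) \<Rightarrow> real \<Rightarrow> 'a \<Rightarrow> 'v" where
  "prim b t \<omega> = (LINT s|dt T. indicator {..t} s *\<^sub>R b s \<omega>)"

lemma prim_eq: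
  assumes "t \<in> {0..T}"
  shows "(LINT s|dt t. b s \<omega>) = prim b t \<omega>"
proof -
  have "(LINT s|dt t. b s \<omega>) = (LINT s|lborel. indicator {0..t} s *\<^sub>R b s \<omega>)"
    by (rule integral_restrict_space) simp
  also have "\<dots> = (LINT s|lborel. indicator {0..T} s *\<^sub>R (indicator {..t} s *\<^sub>R b s \<omega>))"
    using assms by (intro Bochner_Integration.integral_cong refl) (auto simp: indicator_def)
  also have "\<dots> = prim b t \<omega>"
    unfolding prim_def by (rule integral_restrict_space[symmetric]) simp
  finally show ?thesis .
qed

lemma prim_T: "prim b T \<omega> = (LINT s|dt T. b s \<omega>)"
  using prim_eq[of T b] T_pos by simp

lemma prim_measurable:
  assumes b: "case_prod b \<in> borel_measurable (dtP M T)"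
  shows "case_prod (prim b) \<in> borel_measurable (dtP M T)"
proof -
  have "(\<lambda>z. (LINT s|dt T. indicator {..fst z} s *\<^sub>R b s (snd z))) \<in> borel_measurable (dtP M T)"
  proof (rule dt.borel_measurable_lebesgue_integral)
    have "(\<lambda>q. (snd q, snd (fst q))) \<in> (dtP M T \<Otimes>\<^sub>M dt T) \<rightarrow>\<^sub>M dtP M T"
      by (intro measurable_Pair measurable_snd measurable_compose[OF measurable_fst measurable_snd])
    from measurable_compose[OF this b]
    have "(\<lambda>q. b (snd q) (snd (fst q))) \<in> borel_measurable (dtP M T \<Otimes>\<^sub>M dt T)" by simp
    moreover have "(\<lambda>q. indicator {..fst (fst q)} (snd q) :: real) \<in> borel_measurable (dtP M T \<Otimes>\<^sub>M dt T)"
      by (intro borel_measurable_indicator_le measurable_compose[OF measurable_snd dt_measurable]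
        measurable_compose[OF measurable_fst measurable_compose[OF measurable_fst dt_measurable]])
    ultimately show "(\<lambda>(z, s). indicator {..fst z} s *\<^sub>R b s (snd z)) \<in> borel_measurable (dtP M T \<Otimes>\<^sub>M dt T)"
      by (simp add: split_beta')
  qed
  then show ?thesis by (simp add: prim_def split_beta')
qed

text \<open>The bound does not depend on t, so a single exceptional set serves all times at
  once.\<close>

lemma prim_bound:
  assumes b: "case_prod b \<in> L2 (dtP M T)"
  shows "AE \<omega> in M. \<forall>t. (norm (prim b t \<omega>))\<^sup>2 \<le> T * (LINT s|dt T. (norm (b s \<omega>))\<^sup>2)"
  using L2_sections(2)[OF b]
proof eventually_elim
  case (elim \<omega>)
  show ?case
  proof
    fix t
    have L: "(\<lambda>s. indicator {..t} s *\<^sub>R b s \<omega>) \<in> L2 (dt T)"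
    proof (rule L2_bound[of "\<lambda>s. b s \<omega>" _ _ 1])
      show "(\<lambda>s. indicator {..t} s *\<^sub>R b s \<omega>) \<in> borel_measurable (dt T)"
        using L2_measurable[OF elim] borel_measurable_indicator_le[OF dt_measurable borel_measurable_const, of t]
        by (intro borel_measurable_scaleR) auto
    qed (use elim in \<open>auto simp: indicator_def\<close>)
    have meas: "measure (dt T) (space (dt T)) = T"
      using T_pos by (simp add: measure_restrict_space space_restrict_space)
    have "(norm (prim b t \<omega>))\<^sup>2 \<le> T * (LINT s|dt T. (norm (indicator {..t} s *\<^sub>R b s \<omega>))\<^sup>2)"
      unfolding prim_def using dt.norm_integral_squared_le[OF L] by (simp only: meas)
    also have "\<dots> \<le> T * (LINT s|dt T. (norm (b s \<omega>))\<^sup>2)"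
    proof (intro mult_left_mono integral_mono)
      show "integrable (dt T) (\<lambda>s. (norm (indicator {..t} s *\<^sub>R b s \<omega>))\<^sup>2)"
        using L2_integrable_norm2[OF L] .
      show "integrable (dt T) (\<lambda>s. (norm (b s \<omega>))\<^sup>2)"
        using L2_integrable_norm2[OF elim] by simp
    qed (use T_pos in \<open>auto simp: indicator_def\<close>)
    finally show "(norm (prim b t \<omega>))\<^sup>2 \<le> T * (LINT s|dt T. (norm (b s \<omega>))\<^sup>2)" .
  qed
qed

lemma prim_L2:
  assumes b: "case_prod b \<in> L2 (dtP M T)"
  shows "case_prod (prim b) \<in> L2 (dtP M T)" "t \<in> {0..T} \<Longrightarrow> prim b t \<in> L2 M"
proof -
  \<comment> \<open>The bound of \<open>prim_bound\<close> as a random variable: it dominates each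
    slice of \<open>prim b\<close> and, lifted to the product space, the whole process.\<close>
  define h where "h \<omega> = sqrt (T * (LINT s|dt T. (norm (b s \<omega>))\<^sup>2))" for \<omega>
  have int: "integrable (dtP M T) (\<lambda>(s, \<omega>). (norm (b s \<omega>))\<^sup>2)"
    using L2_integrable_norm2[OF b] by (simp add: split_beta')
  note hi = dtP.integrable_snd[OF int]
  have hsq: "(h \<omega>)\<^sup>2 = T * (LINT s|dt T. (norm (b s \<omega>))\<^sup>2)" for \<omega>
    using T_pos by (simp add: h_def)
  have "h \<in> borel_measurable M"
    unfolding h_def using borel_measurable_integrable[OF hi] by simp
  then have h: "h \<in> L2 M"
    using hi by (simp add: L2_def hsq)
  have nb: "norm y \<le> 1 * norm (h \<omega>)" if "(norm y)\<^sup>2 \<le> T * (LINT s|dt T. (norm (b s \<omega>))\<^sup>2)" for y :: 'b and \<omega>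
    using that unfolding hsq[symmetric] by (simp add: abs_le_square_iff[symmetric])
  have ae: "AE \<omega> in M. \<forall>t. norm (prim b t \<omega>) \<le> 1 * norm (h \<omega>)"
    using prim_bound[OF b] by eventually_elim (blast intro: nb)
  have ae1: "AE \<omega> in M. norm (prim b t \<omega>) \<le> 1 * norm (h \<omega>)" for t
    using ae by eventually_elim simp
  note meas = prim_measurable[OF L2_measurable[OF b]]
  show "case_prod (prim b) \<in> L2 (dtP M T)"
  proof (rule L2_bound[OF L2_snd[OF _ _ h] meas])
    have "AE z in dtP M T. norm (prim b (fst z) (snd z)) \<le> 1 * norm (h (snd z))"
    proof (rule dtP.AE_pair_measure)
      show "AE x in dt T. AE y in M. norm (prim b (fst (x, y)) (snd (x, y))) \<le> 1 * norm (h (snd (x, y)))"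
        using ae1 by simp
      have "(\<lambda>z. norm (prim b (fst z) (snd z))) \<in> borel_measurable (dtP M T)"
        using meas by (simp add: split_beta')
      moreover have "(\<lambda>z. 1 * norm (h (snd z))) \<in> borel_measurable (dtP M T)"
        using L2_measurable[OF h] by (intro measurable_compose[OF measurable_snd, of "\<lambda>\<omega>. 1 * norm (h \<omega>)"]) auto
      ultimately show "{z \<in> space (dtP M T). norm (prim b (fst z) (snd z)) \<le> 1 * norm (h (snd z))} \<in> sets (dtP M T)"
        by (rule borel_measurable_le)
    qed
    then show "AE z in dtP M T. norm (case z of (t, \<omega>) \<Rightarrow> prim b t \<omega>) \<le> 1 * norm (h (snd z))"
      by (simp add: split_beta')
  qed unfold_locales
  assume t: "t \<in> {0..T}"
  show "prim b t \<in> L2 M"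
  proof (rule L2_bound[OF h])
    show "AE \<omega> in M. norm (prim b t \<omega>) \<le> 1 * norm (h \<omega>)" by (rule ae1)
    show "prim b t \<in> borel_measurable M"
      using measurable_compose[OF measurable_Pair1' meas, of t] t by (simp add: space_restrict_space)
  qed
qed

lemma ip_dtP:
  assumes f: "f \<in> L2 (dtP M T)" and g: "g \<in> L2 (dtP M T)"
  shows "ip (dtP M T) f g = (LINT s|dt T. ip M (\<lambda>\<omega>. f (s, \<omega>)) (\<lambda>\<omega>. g (s, \<omega>)))"
    "ip (dtP M T) f g = (LINT \<omega>|M. ip (dt T) (\<lambda>s. f (s, \<omega>)) (\<lambda>s. g (s, \<omega>)))"
    "integrable (dt T) (\<lambda>s. ip M (\<lambda>\<omega>. f (s, \<omega>)) (\<lambda>\<omega>. g (s, \<omega>)))"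
    "integrable M (\<lambda>\<omega>. ip (dt T) (\<lambda>s. f (s, \<omega>)) (\<lambda>s. g (s, \<omega>)))"
proof -
  have int: "integrable (dtP M T) (\<lambda>(s, \<omega>). f (s, \<omega>) \<bullet> g (s, \<omega>))"
    using L2_integrable_inner[OF f g] by (simp add: split_beta')
  show "ip (dtP M T) f g = (LINT s|dt T. ip M (\<lambda>\<omega>. f (s, \<omega>)) (\<lambda>\<omega>. g (s, \<omega>)))"
    using dtP.integral_fst[OF int] by (simp add: ip_def split_beta')
  show "ip (dtP M T) f g = (LINT \<omega>|M. ip (dt T) (\<lambda>s. f (s, \<omega>)) (\<lambda>s. g (s, \<omega>)))"
    using dtP.integral_snd[OF int] by (simp add: ip_def split_beta')
  show "integrable (dt T) (\<lambda>s. ip M (\<lambda>\<omega>. f (s, \<omega>)) (\<lambda>\<omega>. g (s, \<omega>)))"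
    using dtP.integrable_fst[OF int] by (simp add: ip_def)
  show "integrable M (\<lambda>\<omega>. ip (dt T) (\<lambda>s. f (s, \<omega>)) (\<lambda>s. g (s, \<omega>)))"
    using dtP.integrable_snd[OF int] by (simp add: ip_def)
qed

text \<open>Integration by parts along almost every path, followed by the expectation.\<close>

lemma ip_prim:
  assumes b: "case_prod b \<in> L2 (dtP M T)" and c: "case_prod c \<in> L2 (dtP M T)"
  shows "ip (dtP M T) (case_prod (prim b)) (case_prod c) + ip (dtP M T) (case_prod (prim c)) (case_prod b)
    = ip M (prim b T) (prim c T)"
proof -
  note pb = prim_L2(1)[OF b] and pc = prim_L2(1)[OF c]
  have "ip (dtP M T) (case_prod (prim b)) (case_prod c) + ip (dtP M T) (case_prod (prim c)) (case_prod b)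
    = (LINT \<omega>|M. ip (dt T) (\<lambda>s. prim b s \<omega>) (\<lambda>s. c s \<omega>) + ip (dt T) (\<lambda>s. prim c s \<omega>) (\<lambda>s. b s \<omega>))"
    using ip_dtP(2,4)[OF pb c] ip_dtP(2,4)[OF pc b] by simp
  also have "\<dots> = (LINT \<omega>|M. prim b T \<omega> \<bullet> prim c T \<omega>)"
  proof (rule integral_cong_AE)
    show "AE \<omega> in M. ip (dt T) (\<lambda>s. prim b s \<omega>) (\<lambda>s. c s \<omega>) + ip (dt T) (\<lambda>s. prim c s \<omega>) (\<lambda>s. b s \<omega>)
        = prim b T \<omega> \<bullet> prim c T \<omega>"
      using L2_sections(2)[OF b] L2_sections(2)[OF c]
    proof eventually_elim
      case (elim \<omega>)
      then show ?case
        using integral_inner_by_parts[of "\<lambda>s. b s \<omega>" T "\<lambda>s. c s \<omega>"]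
        by (simp add: ip_def prim_T) (simp add: prim_def)
    qed
    show "(\<lambda>\<omega>. ip (dt T) (\<lambda>s. prim b s \<omega>) (\<lambda>s. c s \<omega>) + ip (dt T) (\<lambda>s. prim c s \<omega>) (\<lambda>s. b s \<omega>))
        \<in> borel_measurable M"
      using ip_dtP(4)[OF pb c] ip_dtP(4)[OF pc b] by auto
    show "(\<lambda>\<omega>. prim b T \<omega> \<bullet> prim c T \<omega>) \<in> borel_measurable M"
      using L2_measurable[OF prim_L2(2)[OF b, of T]] L2_measurable[OF prim_L2(2)[OF c, of T]] T_pos by auto
  qed
  finally show ?thesis by (simp add: ip_def)
qed

text \<open>Needed for the part \<open>X 0 + I T\<close> of a process, which no longer varies in
  time once the integral has been moved to T.\<close>

lemma ip_dtP_const: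
  assumes f: "f \<in> L2 M" and c: "case_prod c \<in> L2 (dtP M T)"
  shows "ip (dtP M T) (\<lambda>z. f (snd z)) (case_prod c) = ip M f (prim c T)"
proof -
  have fL: "(\<lambda>z. f (snd z)) \<in> L2 (dtP M T)" by (rule L2_snd[OF _ _ f]) unfold_locales
  have "ip (dtP M T) (\<lambda>z. f (snd z)) (case_prod c) = (LINT \<omega>|M. ip (dt T) (\<lambda>s. f \<omega>) (\<lambda>s. c s \<omega>))"
    using ip_dtP(2)[OF fL c] by simp
  also have "\<dots> = (LINT \<omega>|M. f \<omega> \<bullet> prim c T \<omega>)"
  proof (rule integral_cong_AE)
    show "AE \<omega> in M. ip (dt T) (\<lambda>s. f \<omega>) (\<lambda>s. c s \<omega>) = f \<omega> \<bullet> prim c T \<omega>"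
      using L2_sections(2)[OF c]
    proof eventually_elim
      case (elim \<omega>)
      from dt.L2_integrable[OF this] show ?case by (simp add: ip_def prim_T)
    qed
    show "(\<lambda>\<omega>. ip (dt T) (\<lambda>s. f \<omega>) (\<lambda>s. c s \<omega>)) \<in> borel_measurable M"
      using ip_dtP(4)[OF fL c] by auto
    show "(\<lambda>\<omega>. f \<omega> \<bullet> prim c T \<omega>) \<in> borel_measurable M"
      using L2_measurable[OF f] L2_measurable[OF prim_L2(2)[OF c, of T]] T_pos by auto
  qed
  finally show ?thesis by (simp add: ip_def)
qed

lemma ito_diffE:
  assumes "ito_diff M W T X b \<sigma>"
  obtains I where "ito_integral M W T \<sigma> I"
    "\<And>t. t \<in> {0..T} \<Longrightarrow> AE \<omega> in M. X t \<omega> = X 0 \<omega> + prim b t \<omega> + I t \<omega>"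
proof -
  from assms obtain I where I: "ito_integral M W T \<sigma> I"
    and X: "AE \<omega> in M. \<forall>t\<in>{0..T}. X t \<omega> = X 0 \<omega> + (LINT s|dt t. b s \<omega>) + I t \<omega>"
    unfolding ito_diff_def by blast
  show ?thesis
  proof (rule that[OF I])
    fix t assume "t \<in> {0..T}"
    from X show "AE \<omega> in M. X t \<omega> = X 0 \<omega> + prim b t \<omega> + I t \<omega>"
      unfolding prim_eq[OF \<open>t \<in> {0..T}\<close>, symmetric]
      by eventually_elim (use \<open>t \<in> {0..T}\<close> in blast)
  qed
qed

text \<open>By the martingale property, \<open>I s\<close> may be replaced by \<open>I T\<close> when tested against \<open>c s\<close>; no joint
  measurability of \<open>I\<close> is needed.\<close>

lemma ip_ito_process:
  assumes X: "X \<in> L2Fc M W T" and b: "b \<in> L2F M W T" and I: "ito_integral M W T \<sigma> I"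
    and eq: "\<And>t. t \<in> {0..T} \<Longrightarrow> AE \<omega> in M. X t \<omega> = X 0 \<omega> + prim b t \<omega> + I t \<omega>"
    and c: "c \<in> L2F M W T"
  shows "ip (dtP M T) (case_prod X) (case_prod c)
    = ip M (\<lambda>\<omega>. X 0 \<omega> + I T \<omega>) (prim c T) + ip (dtP M T) (case_prod (prim b)) (case_prod c)"
proof -
  note XL = L2F_L2[OF L2Fc_L2(2)[OF X]] and bL = L2F_L2[OF b] and cL = L2F_L2[OF c]
  have T: "0 \<le> T" "T \<le> T" and zT: "0 \<in> {0..T}" using T_pos by auto
  have X0: "X 0 \<in> L2 M" using L2Fc_L2(1)[OF X zT] .
  have IT: "I T \<in> L2 M" by (rule ito_integral_L2[OF I T])
  let ?f = "\<lambda>\<omega>. X 0 \<omega> + I T \<omega>"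
  have f: "?f \<in> L2 M" by (rule L2_add[OF X0 IT])
  have fL: "(\<lambda>z. ?f (snd z)) \<in> L2 (dtP M T)" by (rule L2_snd[OF _ _ f]) unfold_locales
  have "ip (dtP M T) (case_prod X) (case_prod c) = (LINT s|dt T. ip M (X s) (c s))"
    using ip_dtP(1)[OF XL cL] by simp
  also have "\<dots> = (LINT s|dt T. ip M ?f (c s) + ip M (prim b s) (c s))"
  proof (rule integral_cong_AE)
    show "AE s in dt T. ip M (X s) (c s) = ip M ?f (c s) + ip M (prim b s) (c s)"
      using L2_sections(1)[OF cL] AE_space
    proof eventually_elim
      case (elim s)
      then have s: "s \<in> {0..T}" and cs: "c s \<in> L2 M" by (auto simp: space_restrict_space)
      have Is: "I s \<in> L2 M" and ps: "prim b s \<in> L2 M"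
        using s by (auto intro: ito_integral_L2[OF I] prim_L2(2)[OF bL])
      have "ip M (X s) (c s) = ip M (\<lambda>\<omega>. X 0 \<omega> + prim b s \<omega> + I s \<omega>) (c s)"
        using eq[OF s] L2_measurable[OF L2Fc_L2(1)[OF X s]] L2_measurable[OF cs]
          L2_measurable[OF L2_add[OF L2_add[OF X0 ps] Is]] by (intro ip_cong_AE) auto
      also have "\<dots> = ip M (X 0) (c s) + ip M (prim b s) (c s) + ip M (I s) (c s)"
        using X0 ps Is cs by (simp add: ip_add_left L2_add)
      also have "ip M (I s) (c s) = ip M (I T) (c s)"
        using s cs by (intro ito_integral_orthogonal[OF I, symmetric] L2F_adapted[OF c]) auto
      finally show ?case using X0 IT cs by (simp add: ip_add_left)
    qed
    show "(\<lambda>s. ip M (X s) (c s)) \<in> borel_measurable (dt T)" using ip_dtP(3)[OF XL cL] by auto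
    show "(\<lambda>s. ip M ?f (c s) + ip M (prim b s) (c s)) \<in> borel_measurable (dt T)"
      using ip_dtP(3)[OF fL cL] ip_dtP(3)[OF prim_L2(1)[OF bL] cL] by auto
  qed
  also have "\<dots> = ip (dtP M T) (\<lambda>z. ?f (snd z)) (case_prod c) + ip (dtP M T) (case_prod (prim b)) (case_prod c)"
    using ip_dtP(1,3)[OF fL cL] ip_dtP(1,3)[OF prim_L2(1)[OF bL] cL] by simp
  finally show ?thesis using ip_dtP_const[OF f cL] by simp
qed

text \<open>Only the product at time T is expanded, without subdividing the interval. Isometry
  evaluates the product of the two stochastic integrals, integration by parts that of the two
  drifts, and \<open>ip_ito_process\<close> absorbs the mixed terms.\<close>

lemma ito_product_rule:
  assumes X: "X \<in> L2Fc M W T" and b: "b \<in> L2F M W T" and dX: "ito_diff M W T X b \<sigma>"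
    and Y: "Y \<in> L2Fc M W T" and c: "c \<in> L2F M W T" and dY: "ito_diff M W T Y c \<rho>"
  shows "ip M (X T) (Y T) = ip M (X 0) (Y 0) + ip (dtP M T) (case_prod X) (case_prod c)
    + ip (dtP M T) (case_prod b) (case_prod Y) + ip (dtP M T) (case_prod \<sigma>) (case_prod \<rho>)"
proof -
  have T: "0 \<le> T" "T \<le> T" and zT: "0 \<in> {0..T}" and TT: "T \<in> {0..T}" using T_pos by auto
  obtain I where I: "ito_integral M W T \<sigma> I"
    and eqX: "\<And>t. t \<in> {0..T} \<Longrightarrow> AE \<omega> in M. X t \<omega> = X 0 \<omega> + prim b t \<omega> + I t \<omega>"
    using ito_diffE[OF dX] by blast
  obtain J where J: "ito_integral M W T \<rho> J"
    and eqY: "\<And>t. t \<in> {0..T} \<Longrightarrow> AE \<omega> in M. Y t \<omega> = Y 0 \<omega> + prim c t \<omega> + J t \<omega>"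
    using ito_diffE[OF dY] by blast
  note bL = L2F_L2[OF b] and cL = L2F_L2[OF c]
  have L [simp]: "X 0 \<in> L2 M" "Y 0 \<in> L2 M" "I T \<in> L2 M" "J T \<in> L2 M" "prim b T \<in> L2 M" "prim c T \<in> L2 M"
    using L2Fc_L2(1)[OF X zT] L2Fc_L2(1)[OF Y zT] ito_integral_L2[OF I T] ito_integral_L2[OF J T]
      prim_L2(2)[OF bL TT] prim_L2(2)[OF cL TT] by auto
  \<comment> \<open>A stochastic integral is orthogonal to everything known at time 0. That it
    starts at 0 is read off the equation of the process at t = 0. The statement is general because
    it serves both \<open>I\<close> and \<open>J\<close>.\<close>
  have I0: "ip M (I T) g = 0" if K: "ito_integral M W T \<kappa> I" and Z: "Z \<in> L2Fc M W T"
    and eq: "\<And>t. t \<in> {0..T} \<Longrightarrow> AE \<omega> in M. Z t \<omega> = Z 0 \<omega> + prim d t \<omega> + I t \<omega>"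
    and g: "g \<in> borel_measurable (F 0)" "g \<in> L2 M"
    for \<kappa> I g d and Z :: "real \<Rightarrow> 'a \<Rightarrow> 'b"
  proof -
    have "ip M (I T) g = ip M (I 0) g"
      by (rule ito_integral_orthogonal[OF K order_refl T(1) g])
    also have "\<dots> = ip M (\<lambda>_. 0) g"
    proof (rule ip_cong_AE)
      have "prim d 0 \<omega> = 0" for \<omega>
      proof -
        \<comment> \<open>The interval of \<open>dt 0\<close> is one point, so the drift integral
          vanishes for any \<open>d\<close>.\<close>
        have "AE s in lborel. s \<noteq> (0::real)" by (rule AE_lborel_singleton)
        then have "AE s in lborel. s \<in> {0..0} \<longrightarrow> d s \<omega> = 0" by eventually_elim simp
        then have "AE s in dt 0. d s \<omega> = 0" by (subst AE_restrict_space_iff) simp_all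
        then have "(LINT s|dt 0. d s \<omega>) = 0" by (rule integral_eq_zero_AE)
        then show ?thesis using prim_eq[OF zT, of d \<omega>] by (simp only:)
      qed
      then show "AE \<omega> in M. I 0 \<omega> = 0" using eq[OF zT] by (simp del: atLeastAtMost_iff)
    qed (use L2_measurable[OF ito_integral_L2[OF K order_refl T(1)]] L2_measurable[OF g(2)] in auto)
    finally show ?thesis by (simp add: ip_def)
  qed
  have IY: "ip M (I T) (Y 0) = 0"
    by (rule I0[OF I X eqX]) (use L2F_adapted[OF L2Fc_L2(2)[OF Y] zT] in auto)
  have JX: "ip M (J T) (X 0) = 0"
    by (rule I0[OF J Y eqY]) (use L2F_adapted[OF L2Fc_L2(2)[OF X] zT] in auto)
  have "ip M (X T) (Y T) = ip M (\<lambda>\<omega>. X 0 \<omega> + prim b T \<omega> + I T \<omega>) (\<lambda>\<omega>. Y 0 \<omega> + prim c T \<omega> + J T \<omega>)"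
    using eqX[OF TT] eqY[OF TT] L2_measurable[OF L2Fc_L2(1)[OF X TT]] L2_measurable[OF L2Fc_L2(1)[OF Y TT]]
      L2_measurable[OF L2_add[OF L2_add[OF L(1,5)] L(3)]] L2_measurable[OF L2_add[OF L2_add[OF L(2,6)] L(4)]]
    by (intro ip_cong_AE) auto
  \<comment> \<open>The nine products are grouped to match \<open>ip_ito_process\<close>; the two
    pairings of an integral with the other initial value vanish by \<open>IY\<close> and
    \<open>JX\<close>.\<close>
  also have "\<dots> = ip M (X 0) (Y 0) + (ip M (\<lambda>\<omega>. X 0 \<omega> + I T \<omega>) (prim c T))
      + ip M (\<lambda>\<omega>. Y 0 \<omega> + J T \<omega>) (prim b T) + ip M (prim b T) (prim c T)
      + ip M (I T) (Y 0) + ip M (J T) (X 0) + ip M (I T) (J T)"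
    by (simp add: ip_add_left ip_add_right L2_add)
       (simp add: ip_commute[of M "prim b T" "Y 0"] ip_commute[of M "prim b T" "J T"] ip_commute[of M "X 0" "J T"])
  also have "ip M (I T) (J T) = ip (dtP M T) (case_prod \<sigma>) (case_prod \<rho>)"
    by (rule ito_isometry[OF I J])
  also have "ip M (prim b T) (prim c T) = ip (dtP M T) (case_prod (prim b)) (case_prod c)
      + ip (dtP M T) (case_prod (prim c)) (case_prod b)"
    by (rule ip_prim[OF bL cL, symmetric])
  finally show ?thesis
    using ip_ito_process[OF X b I eqX c] ip_ito_process[OF Y c J eqY b] IY JX
    by (simp add: ip_commute[of "dtP M T" "case_prod b" "case_prod Y"])
qed

subsection \<open>Processes driven by bounded coefficients\<close>

lemma adapted_matrix_vector_mult:
  fixes A :: "real \<Rightarrow> 'a \<Rightarrow> real^'n^'m"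
  assumes "adapted M W T A" "adapted M W T f"
  shows "adapted M W T (\<lambda>s \<omega>. A s \<omega> *v f s \<omega>)"
  using assms unfolding adapted_def split_beta'
  by (intro conjI ballI borel_measurable_matrix_vector_mult) blast+

lemma bounded_adaptedD:
  assumes "bounded_adapted M W T A"
  shows "case_prod A \<in> borel_measurable (dtP M T)" "\<exists>c. AE z in dtP M T. norm (case_prod A z) \<le> c" "adapted M W T A"
  using assms by (auto simp: bounded_adapted_def adapted_def split_beta')

lemma bounded_adapted_transpose:
  fixes A :: "real \<Rightarrow> 'a \<Rightarrow> real^'n^'m"
  assumes "bounded_adapted M W T A"
  shows "bounded_adapted M W T (\<lambda>s \<omega>. transpose (A s \<omega>))"
  using assms unfolding bounded_adapted_def adapted_def split_beta' norm_transpose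
  by (auto intro: borel_measurable_transpose)

lemma L2F_mult:
  fixes A :: "real \<Rightarrow> 'a \<Rightarrow> real^'n^'m"
  assumes A: "bounded_adapted M W T A" and f: "f \<in> L2F M W T"
  shows "(\<lambda>s \<omega>. A s \<omega> *v f s \<omega>) \<in> L2F M W T"
  using L2_matrix_vector_mult[OF bounded_adaptedD(1,2)[OF A] L2F_L2[OF f]] f bounded_adaptedD(3)[OF A]
  by (simp add: L2F_def adapted_matrix_vector_mult split_beta')

lemma L2F_add: "f \<in> L2F M W T \<Longrightarrow> g \<in> L2F M W T \<Longrightarrow> (\<lambda>s \<omega>. f s \<omega> + g s \<omega>) \<in> L2F M W T"
  using L2_add[of "case_prod f" "dtP M T" "case_prod g"]
  unfolding L2F_def adapted_def split_beta'
  by (intro CollectI conjI ballI borel_measurable_add) blast+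

lemma L2F_uminus: "f \<in> L2F M W T \<Longrightarrow> (\<lambda>s \<omega>. - f s \<omega>) \<in> L2F M W T"
  using L2_uminus[of "case_prod f" "dtP M T"]
  unfolding L2F_def adapted_def split_beta'
  by (intro CollectI conjI ballI borel_measurable_uminus) blast+

lemma L2F_diff: "f \<in> L2F M W T \<Longrightarrow> g \<in> L2F M W T \<Longrightarrow> (\<lambda>s \<omega>. f s \<omega> - g s \<omega>) \<in> L2F M W T"
  using L2F_add[OF _ L2F_uminus, of f g] by simp

lemma L2F_deterministic:
  assumes "\<alpha> \<in> L2 (dt T)"
  shows "(\<lambda>s \<omega>. \<alpha> s) \<in> L2F M W T"
proof -
  have "(\<lambda>z. \<alpha> (fst z)) \<in> L2 (dtP M T)"
    by (rule L2_fst[OF _ _ assms]) unfold_locales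
  then show ?thesis by (auto simp: L2F_def adapted_def split_beta' L2_measurable)
qed

text \<open>No measurability of \<open>P\<close> enters: the exceptional set lies in a cylinder over
  a null set of times.\<close>

lemma AE_dtP_fst:
  assumes "AE s in dt T. P s"
  shows "AE (s, \<omega>) in dtP M T. P s"
proof -
  obtain N where N: "{s \<in> space (dt T). \<not> P s} \<subseteq> N" "N \<in> null_sets (dt T)"
    using assms by (auto simp: eventually_ae_filter)
  have "N \<times> space M \<in> null_sets (dtP M T)"
    using N(2) by (intro times_in_null_sets1) auto
  then show ?thesis
    by (rule AE_I') (use N(1) in \<open>auto simp: space_pair_measure\<close>)
qed

text \<open>Exchanging the two almost-everywhere quantifiers requires the coincidence set to be
  measurable.\<close>

lemma AE_dtP_sections:
  fixes f g :: "real \<Rightarrow> 'a \<Rightarrow> 'v::euclidean_space"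
  assumes "case_prod f \<in> borel_measurable (dtP M T)" "case_prod g \<in> borel_measurable (dtP M T)"
    and "AE (s, \<omega>) in dtP M T. f s \<omega> = g s \<omega>"
  shows "AE \<omega> in M. AE s in dt T. f s \<omega> = g s \<omega>"
proof -
  have "{z \<in> space (dtP M T). case_prod f z = case_prod g z} \<in> sets (dtP M T)"
    using measurable_sets[OF borel_measurable_diff[OF assms(1,2)], of "{0}"]
    by (simp add: vimage_def Int_def conj_commute split_beta')
  then have "{z \<in> space (dtP M T). f (fst z) (snd z) = g (fst z) (snd z)} \<in> sets (dtP M T)"
    by (simp add: split_beta')
  from dtP.AE_commute[OF this] show ?thesis
    using dtP.AE_pair[of "\<lambda>(s, \<omega>). f s \<omega> = g s \<omega>"] assms(3) by simp
qed

section \<open>Means of processes and almost-everywhere changes of coefficients\<close>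

lemma mean_measurable:
  fixes X :: "real \<Rightarrow> 'a \<Rightarrow> 'v::euclidean_space"
  assumes "case_prod X \<in> borel_measurable (dtP M T)"
  shows "mean M X \<in> borel_measurable (dt T)"
  unfolding mean_def[abs_def] using borel_measurable_lebesgue_integral[of X "dt T"] assms by simp

lemma mean_L2:
  assumes "X \<in> L2F M W T"
  shows "mean M X \<in> L2 (dt T)"
proof -
  note XL = L2F_L2[OF assms]
  have int: "integrable (dtP M T) (\<lambda>(s, \<omega>). (norm (X s \<omega>))\<^sup>2)"
    using L2_integrable_norm2[OF XL] by (simp add: split_beta')
  note meas = mean_measurable[OF L2_measurable[OF XL]]
  have "integrable (dt T) (\<lambda>s. (norm (mean M X s))\<^sup>2)"
  proof (rule Bochner_Integration.integrable_bound[OF dtP.integrable_fst[OF int]])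
    show "AE s in dt T. norm ((norm (mean M X s))\<^sup>2) \<le> norm (LINT \<omega>|M. (norm (X s \<omega>))\<^sup>2)"
      using L2_sections(1)[OF XL]
    proof eventually_elim
      case (elim s)
      then show ?case using norm_integral_squared_le[of "X s"] by (simp add: mean_def prob_space)
    qed
  qed (use meas in auto)
  with meas show ?thesis by (simp add: L2_def)
qed

text \<open>A deterministic test function sees a process only through its mean; this is how
  \<open>ls\<close> meets the constraint.\<close>

lemma ip_dtP_deterministic:
  assumes l: "l \<in> L2 (dt T)" and X: "X \<in> L2F M W T"
  shows "ip (dtP M T) (\<lambda>z. l (fst z)) (case_prod X) = ip (dt T) l (mean M X)"
proof -
  note XL = L2F_L2[OF X]
  have lL: "(\<lambda>z. l (fst z)) \<in> L2 (dtP M T)" using L2F_L2[OF L2F_deterministic[OF l]] by (simp add: split_beta')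
  have "ip (dtP M T) (\<lambda>z. l (fst z)) (case_prod X) = (LINT s|dt T. ip M (\<lambda>\<omega>. l s) (X s))"
    using ip_dtP(1)[OF lL XL] by simp
  also have "\<dots> = (LINT s|dt T. l s \<bullet> mean M X s)"
  proof (rule integral_cong_AE)
    show "AE s in dt T. ip M (\<lambda>\<omega>. l s) (X s) = l s \<bullet> mean M X s"
      using L2_sections(1)[OF XL]
    proof eventually_elim
      case (elim s)
      then have "integrable M (X s)" by (intro L2_integrable) simp
      then show ?case by (simp add: ip_def mean_def)
    qed
    show "(\<lambda>s. ip M (\<lambda>\<omega>. l s) (X s)) \<in> borel_measurable (dt T)" using ip_dtP(3)[OF lL XL] by auto
    show "(\<lambda>s. l s \<bullet> mean M X s) \<in> borel_measurable (dt T)"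
      using L2_measurable[OF l] L2_measurable[OF mean_L2[OF X]] by auto
  qed
  finally show ?thesis by (simp add: ip_def)
qed

text \<open>Lets \<open>mean M X\<close> replace the prescribed mean and a stationary control
  replace the feedback, although they agree only almost everywhere. For almost every path the drifts
  agree at almost every time, so all their time integrals agree at once.\<close>

lemma ito_diff_cong:
  assumes d: "ito_diff M W T X b \<sigma>" and b: "b \<in> L2F M W T" "b' \<in> L2F M W T" "AE (s, \<omega>) in dtP M T. b s \<omega> = b' s \<omega>"
    and \<sigma>: "\<sigma>' \<in> L2F M W T" "AE (s, \<omega>) in dtP M T. \<sigma> s \<omega> = \<sigma>' s \<omega>"
  shows "ito_diff M W T X b' \<sigma>'"
proof -
  note bm = L2_measurable[OF L2F_L2[OF b(1)]] L2_measurable[OF L2F_L2[OF b(2)]]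
  from d obtain I where I: "ito_integral M W T \<sigma> I"
    and X: "AE \<omega> in M. \<forall>t\<in>{0..T}. X t \<omega> = X 0 \<omega> + (LINT s|dt t. b s \<omega>) + I t \<omega>"
    unfolding ito_diff_def by blast
  have "AE \<omega> in M. integrable (dt T) (\<lambda>s. b' s \<omega>)"
    using L2_sections(2)[OF L2F_L2[OF b(2)]] by eventually_elim (auto dest: dt.L2_integrable)
  moreover have "AE \<omega> in M. \<forall>t\<in>{0..T}. X t \<omega> = X 0 \<omega> + (LINT s|dt t. b' s \<omega>) + I t \<omega>"
    using X AE_dtP_sections[OF bm b(3)] AE_space
  proof eventually_elim
    case (elim \<omega>)
    have sec: "(\<lambda>s. b s \<omega>) \<in> borel_measurable (dt T)" "(\<lambda>s. b' s \<omega>) \<in> borel_measurable (dt T)"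
      using measurable_compose[OF measurable_Pair2'[OF elim(3)] bm(1)]
        measurable_compose[OF measurable_Pair2'[OF elim(3)] bm(2)] by simp_all
    have "prim b t \<omega> = prim b' t \<omega>" for t
      unfolding prim_def
    proof (rule integral_cong_AE)
      show "AE s in dt T. indicator {..t} s *\<^sub>R b s \<omega> = indicator {..t} s *\<^sub>R b' s \<omega>"
        using elim(2) by eventually_elim simp
    qed (intro borel_measurable_scaleR borel_measurable_indicator_le[OF dt_measurable borel_measurable_const] sec)+
    then show ?case using elim(1) by (simp add: prim_eq del: atLeastAtMost_iff)
  qed
  \<comment> \<open>Apart from membership in \<open>L2F\<close>, the integrand enters only through
    its distance to simple processes, so the old approximations and the old \<open>I\<close> still
    serve.\<close>
  moreover have "ito_integral M W T \<sigma>' I"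
  proof -
    have "(\<integral>\<^sup>+ (s, \<omega>). ennreal ((norm (h s \<omega> - \<sigma> s \<omega>))\<^sup>2) \<partial>dtP M T)
        = (\<integral>\<^sup>+ (s, \<omega>). ennreal ((norm (h s \<omega> - \<sigma>' s \<omega>))\<^sup>2) \<partial>dtP M T)" for h
      by (rule nn_integral_cong_AE) (use \<sigma>(2) in \<open>eventually_elim; auto\<close>)
    with I \<sigma>(1) show ?thesis unfolding ito_integral_def by simp
  qed
  ultimately show ?thesis unfolding ito_diff_def by blast
qed

lemma L2Fp_subset: "L2Fp M W T \<subseteq> L2 (dtP M T)"
proof
  fix f :: "real \<times> 'a \<Rightarrow> 'b" assume "f \<in> L2Fp M W T"
  then have "curry f \<in> L2F M W T" by (simp add: L2Fp_def)
  from L2F_L2[OF this] show "f \<in> L2 (dtP M T)" by simp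
qed

lemma L2FT_subset: "L2FT M W T \<subseteq> L2 M"
  by (auto simp: L2FT_def)

text \<open>Both vector arguments are deterministic, so the expectation falls on the matrix alone;
  hence the averaged weight in the equation for \<open>as\<close>.\<close>

lemma mean_matrix_mult:
  fixes A :: "real \<Rightarrow> 'a \<Rightarrow> real^'n^'n"
  assumes A: "bounded_adapted M W T A" and \<alpha>: "\<alpha> \<in> L2 (dt T)" and \<beta>: "\<beta> \<in> L2 (dt T)"
  shows "(\<lambda>t. mean M A t *v \<alpha> t) \<in> L2 (dt T)"
    "ip (dtP M T) (\<lambda>z. case_prod A z *v \<alpha> (fst z)) (\<lambda>z. \<beta> (fst z)) = ip (dt T) (\<lambda>t. mean M A t *v \<alpha> t) \<beta>"
proof -
  note D = bounded_adaptedD[OF A]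
  obtain c where "AE z in dtP M T. norm (case_prod A z) \<le> c" using D(2) by blast
  then have "AE s in dt T. AE \<omega> in M. norm (A s \<omega>) \<le> c"
    using dtP.AE_pair[of "\<lambda>(s, \<omega>). norm (A s \<omega>) \<le> c"] by (simp add: split_beta')
  then have int: "AE s in dt T. integrable M (A s) \<and> norm (mean M A s) \<le> c"
    using AE_space
  proof eventually_elim
    case (elim s)
    have "A s \<in> borel_measurable M"
      using measurable_compose[OF measurable_Pair1'[OF elim(2)] D(1)] by simp
    then have i: "integrable M (A s)" using elim(1) by (rule integrable_const_bound[rotated])
    have "norm (mean M A s) \<le> (LINT \<omega>|M. norm (A s \<omega>))" unfolding mean_def by (rule integral_norm_bound)
    also have "\<dots> \<le> (LINT \<omega>|M. c)" using i elim(1) by (intro integral_mono_AE) auto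
    finally show ?case using i by (simp add: prob_space)
  qed
  then have "AE s in dt T. norm (mean M A s) \<le> c" by eventually_elim blast
  then show mA: "(\<lambda>t. mean M A t *v \<alpha> t) \<in> L2 (dt T)"
    using mean_measurable[OF D(1)] \<alpha> by (intro L2_matrix_vector_mult) blast+
  have \<alpha>L: "(\<lambda>z. \<alpha> (fst z)) \<in> L2 (dtP M T)" and \<beta>L: "(\<lambda>z. \<beta> (fst z)) \<in> L2 (dtP M T)"
    using L2F_L2[OF L2F_deterministic[OF \<alpha>]] L2F_L2[OF L2F_deterministic[OF \<beta>]] by (simp_all add: split_beta')
  note A\<alpha> = L2_matrix_vector_mult[OF D(1,2) \<alpha>L]
  have "ip (dtP M T) (\<lambda>z. case_prod A z *v \<alpha> (fst z)) (\<lambda>z. \<beta> (fst z))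
      = (LINT s|dt T. ip M (\<lambda>\<omega>. A s \<omega> *v \<alpha> s) (\<lambda>\<omega>. \<beta> s))"
    using ip_dtP(1)[OF A\<alpha> \<beta>L] by simp
  also have "\<dots> = ip (dt T) (\<lambda>t. mean M A t *v \<alpha> t) \<beta>"
    unfolding ip_def[of "dt T"]
  proof (rule integral_cong_AE)
    show "AE s in dt T. ip M (\<lambda>\<omega>. A s \<omega> *v \<alpha> s) (\<lambda>\<omega>. \<beta> s) = (mean M A s *v \<alpha> s) \<bullet> \<beta> s"
      using int
    proof eventually_elim
      case (elim s)
      \<comment> \<open>The integrand depends linearly on the matrix, so the integral can be taken
        inside.\<close>
      have "bounded_linear (\<lambda>a. (a *v \<alpha> s) \<bullet> \<beta> s)"
        by (intro bounded_linear_compose[OF bounded_linear_inner_left]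
          bounded_bilinear.bounded_linear_left[OF bounded_bilinear_matrix_vector_mult])
      from integral_bounded_linear[OF this, of M "A s"] elim show ?case
        by (simp add: ip_def mean_def)
    qed
    show "(\<lambda>s. ip M (\<lambda>\<omega>. A s \<omega> *v \<alpha> s) (\<lambda>\<omega>. \<beta> s)) \<in> borel_measurable (dt T)"
      using ip_dtP(3)[OF A\<alpha> \<beta>L] by auto
    show "(\<lambda>s. (mean M A s *v \<alpha> s) \<bullet> \<beta> s) \<in> borel_measurable (dt T)"
      using L2_measurable[OF mA] L2_measurable[OF \<beta>] by auto
  qed
  finally show "ip (dtP M T) (\<lambda>z. case_prod A z *v \<alpha> (fst z)) (\<lambda>z. \<beta> (fst z)) = ip (dt T) (\<lambda>t. mean M A t *v \<alpha> t) \<beta>" .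
qed

end

section \<open>The linear-quadratic problem\<close>

locale lq_problem = brownian_on M W T for M :: "'w measure" and W and T +
  fixes S :: "('w, 'n::finite, 'm::finite) lq_coeffs" and \<delta> :: real
  assumes A: "bounded_adapted M W T (cA S)" and A1: "bounded_adapted M W T (cA1 S)"
    and B: "bounded_adapted M W T (cB S)"
    and C: "bounded_adapted M W T (cC S)" and C1: "bounded_adapted M W T (cC1 S)"
    and D: "bounded_adapted M W T (cD S)"
    and Q: "bounded_adapted M W T (cQ S)" "AE (s, \<omega>) in dtP M T. psd (cQ S s \<omega>)"
    and Q1: "bounded_adapted M W T (cQ1 S)" "AE (s, \<omega>) in dtP M T. psd (cQ1 S s \<omega>)"
    and R: "bounded_adapted M W T (cR S)" "AE (s, \<omega>) in dtP M T. psd (cR S s \<omega>)"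
    and G: "cG S \<in> borel_measurable (brownian_filtration M W T)"
           "\<exists>c. AE \<omega> in M. norm (cG S \<omega>) \<le> c" "AE \<omega> in M. psd (cG S \<omega>)"
    and \<delta>: "0 < \<delta>" "AE (s, \<omega>) in dtP M T. psd (cR S s \<omega> - \<delta> *\<^sub>R mat 1)"
begin

lemma R_invertible:
  "AE (s, \<omega>) in dtP M T. \<forall>v. matrix_inv (cR S s \<omega>) *v (cR S s \<omega> *v v) = v \<and>
     cR S s \<omega> *v (matrix_inv (cR S s \<omega>) *v v) = v \<and> norm v \<le> 1 / \<delta> * norm (cR S s \<omega> *v v)"
  using \<delta>(2) by eventually_elim (clarify, intro conjI coercive_invertible[OF \<delta>(1)] psd_diff_coercive)

text \<open>The polar form of the cost, with state, mean, control and terminal state as independent arguments.\<close>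

definition cform where
  "cform X \<alpha> u \<zeta> X' \<alpha>' u' \<zeta>' =
     ip (dtP M T) (\<lambda>z. case_prod (cQ S) z *v X z) X' +
     ip (dtP M T) (\<lambda>z. case_prod (cQ1 S) z *v \<alpha> (fst z)) (\<lambda>z. \<alpha>' (fst z)) +
     ip (dtP M T) (\<lambda>z. case_prod (cR S) z *v u z) u' +
     ip M (\<lambda>\<omega>. cG S \<omega> *v \<zeta> \<omega>) \<zeta>'"

section \<open>The cost as a quadratic form\<close>

lemma L2_lift: "\<alpha> \<in> L2 (dt T) \<Longrightarrow> (\<lambda>z. \<alpha> (fst z)) \<in> L2 (dtP M T)"
  using L2F_L2[OF L2F_deterministic] by (simp add: split_beta')

lemma frozen_cost_eq:
  assumes \<alpha>: "\<alpha> \<in> L2 (dt T)" and u: "u \<in> L2F M W T" and X: "X \<in> L2Fc M W T"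
  shows "frozen_cost M T S \<alpha> u X = cform (case_prod X) \<alpha> (case_prod u) (X T) (case_prod X) \<alpha> (case_prod u) (X T)"
proof -
  note XL = L2F_L2[OF L2Fc_L2(2)[OF X]] and uL = L2F_L2[OF u] and aL = L2_lift[OF \<alpha>]
  have XT: "X T \<in> L2 M" using L2Fc_L2(1)[OF X] T_pos by simp
  note i1 = L2_integrable_inner[OF L2_matrix_vector_mult[OF bounded_adaptedD(1,2)[OF Q(1)] XL] XL]
  note i2 = L2_integrable_inner[OF L2_matrix_vector_mult[OF bounded_adaptedD(1,2)[OF Q1(1)] aL] aL]
  note i3 = L2_integrable_inner[OF L2_matrix_vector_mult[OF bounded_adaptedD(1,2)[OF R(1)] uL] uL]
  note i4 = L2_integrable_inner[OF L2_matrix_vector_mult[OF measurable_F[OF G(1)] G(2) XT] XT]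
  let ?h = "\<lambda>s \<omega>. (cQ S s \<omega> *v X s \<omega>) \<bullet> X s \<omega> + (cQ1 S s \<omega> *v \<alpha> s) \<bullet> \<alpha> s + (cR S s \<omega> *v u s \<omega>) \<bullet> u s \<omega>"
  have h: "integrable (dtP M T) (case_prod ?h)"
    using i1 i2 i3 by (simp add: split_beta')
  have "frozen_cost M T S \<alpha> u X = (LINT \<omega>|M. (LINT s|dt T. ?h s \<omega>)) + ip M (\<lambda>\<omega>. cG S \<omega> *v X T \<omega>) (X T)"
    unfolding frozen_cost_def ip_def using dtP.integrable_snd[OF h] i4 by simp
  also have "(LINT \<omega>|M. (LINT s|dt T. ?h s \<omega>)) = integral\<^sup>L (dtP M T) (case_prod ?h)"
    by (rule dtP.integral_snd[OF h])
  finally show ?thesis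
    using i1 i2 i3 by (simp add: cform_def ip_def split_beta')
qed

text \<open>When the derivative in the direction of the competitor vanishes, only the quadratic
  remainder is left: nonnegative in the \<open>cQ\<close>, \<open>cQ1\<close> and \<open>cG\<close>
  parts, coercive in the \<open>cR\<close> part. It serves both minimizations, once with the mean
  fixed and once with the mean varying.\<close>

lemma cform_expansion:
  assumes X: "X \<in> L2 (dtP M T)" "X' \<in> L2 (dtP M T)" and \<alpha>: "\<alpha> \<in> L2 (dt T)" "\<alpha>' \<in> L2 (dt T)"
    and u: "u \<in> L2 (dtP M T)" "u' \<in> L2 (dtP M T)" and \<zeta>: "\<zeta> \<in> L2 M" "\<zeta>' \<in> L2 M"
    and zero: "cform X \<alpha> u \<zeta> (\<lambda>z. X' z - X z) (\<lambda>t. \<alpha>' t - \<alpha> t) (\<lambda>z. u' z - u z) (\<lambda>\<omega>. \<zeta>' \<omega> - \<zeta> \<omega>) = 0"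
  shows "cform X \<alpha> u \<zeta> X \<alpha> u \<zeta> + \<delta> * ip (dtP M T) (\<lambda>z. u' z - u z) (\<lambda>z. u' z - u z)
    \<le> cform X' \<alpha>' u' \<zeta>' X' \<alpha>' u' \<zeta>'"
proof -
  have psd_sym: "AE z in \<nu>. transpose (K z) = K z" if "AE z in \<nu>. psd (K z)"
    for K :: "'d \<Rightarrow> real^'k^'k" and \<nu>
    using that by eventually_elim (simp add: psd_def)
  have pQ: "AE z in dtP M T. psd (case_prod (cQ S) z)" and pQ1: "AE z in dtP M T. psd (case_prod (cQ1 S) z)"
    and pR: "AE z in dtP M T. psd (case_prod (cR S) z)"
    using Q(2) Q1(2) R(2) by (simp_all add: split_beta')
  note ud = L2_diff[OF u(2,1)]
  have Rd: "\<delta> * ip (dtP M T) (\<lambda>z. u' z - u z) (\<lambda>z. u' z - u z)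
      \<le> ip (dtP M T) (\<lambda>z. case_prod (cR S) z *v (u' z - u z)) (\<lambda>z. u' z - u z)"
    unfolding ip_def integral_mult_right_zero[symmetric]
  proof (rule integral_mono_AE)
    show "AE z in dtP M T. \<delta> * ((u' z - u z) \<bullet> (u' z - u z))
        \<le> (case_prod (cR S) z *v (u' z - u z)) \<bullet> (u' z - u z)"
      using \<delta>(2) by eventually_elim (auto intro: psd_diff_coercive)
    show "integrable (dtP M T) (\<lambda>z. \<delta> * ((u' z - u z) \<bullet> (u' z - u z)))"
      using L2_integrable_inner[OF ud ud] by simp
    show "integrable (dtP M T) (\<lambda>z. (case_prod (cR S) z *v (u' z - u z)) \<bullet> (u' z - u z))"
      by (rule L2_integrable_inner[OF L2_matrix_vector_mult[OF bounded_adaptedD(1,2)[OF R(1)] ud] ud])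
  qed
  have "0 \<le> ip (dtP M T) (\<lambda>z. case_prod (cQ S) z *v (X' z - X z)) (\<lambda>z. X' z - X z)"
    "0 \<le> ip (dtP M T) (\<lambda>z. case_prod (cQ1 S) z *v (\<alpha>' (fst z) - \<alpha> (fst z))) (\<lambda>z. \<alpha>' (fst z) - \<alpha> (fst z))"
    "0 \<le> ip M (\<lambda>\<omega>. cG S \<omega> *v (\<zeta>' \<omega> - \<zeta> \<omega>)) (\<lambda>\<omega>. \<zeta>' \<omega> - \<zeta> \<omega>)"
    using ip_psd_nonneg[OF pQ] ip_psd_nonneg[OF pQ1] ip_psd_nonneg[OF G(3)] by auto
  with Rd zero show ?thesis
    unfolding cform_def
      ip_quadratic_expansion[OF bounded_adaptedD(1,2)[OF Q(1)] psd_sym[OF pQ] X]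
      ip_quadratic_expansion[OF bounded_adaptedD(1,2)[OF Q1(1)] psd_sym[OF pQ1] L2_lift[OF \<alpha>(1)] L2_lift[OF \<alpha>(2)]]
      ip_quadratic_expansion[OF bounded_adaptedD(1,2)[OF R(1)] psd_sym[OF pR] u]
      ip_quadratic_expansion[OF measurable_F[OF G(1)] G(2) psd_sym[OF G(3)] \<zeta>]
    by simp
qed

section \<open>The forward-backward system and its feedback control\<close>

abbreviation drift where
  "drift \<alpha> u X \<equiv> \<lambda>s \<omega>. cA S s \<omega> *v X s \<omega> + cA1 S s \<omega> *v \<alpha> s + cB S s \<omega> *v u s \<omega>"

abbreviation diffusion where
  "diffusion \<alpha> u X \<equiv> \<lambda>s \<omega>. cC S s \<omega> *v X s \<omega> + cC1 S s \<omega> *v \<alpha> s + cD S s \<omega> *v u s \<omega>"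

abbreviation feedback where
  "feedback Y Z \<equiv> \<lambda>s \<omega>. matrix_inv (cR S s \<omega>) *v
     (transpose (cB S s \<omega>) *v Y s \<omega> + transpose (cD S s \<omega>) *v Z s \<omega>)"

lemma drift_L2F:
  "\<alpha> \<in> L2 (dt T) \<Longrightarrow> u \<in> L2F M W T \<Longrightarrow> X \<in> L2F M W T \<Longrightarrow> drift \<alpha> u X \<in> L2F M W T"
  by (intro L2F_add L2F_mult A A1 B L2F_deterministic)

lemma diffusion_L2F:
  "\<alpha> \<in> L2 (dt T) \<Longrightarrow> u \<in> L2F M W T \<Longrightarrow> X \<in> L2F M W T \<Longrightarrow> diffusion \<alpha> u X \<in> L2F M W T"
  by (intro L2F_add L2F_mult C C1 D L2F_deterministic)

text \<open>The lower bound for \<open>cR S\<close> is applied to the feedback itself, whose image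
  under \<open>cR S\<close> is the square-integrable \<open>w\<close>.\<close>

lemma feedback_L2F:
  assumes Y: "Y \<in> L2F M W T" and Z: "Z \<in> L2F M W T"
  shows "feedback Y Z \<in> L2F M W T"
proof -
  define w where "w s \<omega> = transpose (cB S s \<omega>) *v Y s \<omega> + transpose (cD S s \<omega>) *v Z s \<omega>" for s \<omega>
  have w: "w \<in> L2F M W T"
    unfolding w_def[abs_def] by (intro L2F_add L2F_mult bounded_adapted_transpose B D Y Z)
  have ad: "adapted M W T (\<lambda>s \<omega>. matrix_inv (cR S s \<omega>) *v w s \<omega>)"
    using w bounded_adaptedD(3)[OF R(1)] unfolding L2F_def adapted_def split_beta'
    by (intro conjI ballI borel_measurable_matrix_inv_mult) blast+
  have "AE z in dtP M T. norm (case z of (s, \<omega>) \<Rightarrow> matrix_inv (cR S s \<omega>) *v w s \<omega>) \<le> 1 / \<delta> * norm (case_prod w z)"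
    using R_invertible
  proof eventually_elim
    case (elim z)
    obtain s \<omega> where z: "z = (s, \<omega>)" by (cases z)
    have "norm (matrix_inv (cR S s \<omega>) *v w s \<omega>) \<le> 1 / \<delta> * norm (cR S s \<omega> *v (matrix_inv (cR S s \<omega>) *v w s \<omega>))"
      using elim unfolding z prod.case by blast
    also have "cR S s \<omega> *v (matrix_inv (cR S s \<omega>) *v w s \<omega>) = w s \<omega>"
      using elim unfolding z prod.case by blast
    finally show ?case by (simp only: z prod.case)
  qed
  then have "case_prod (\<lambda>s \<omega>. matrix_inv (cR S s \<omega>) *v w s \<omega>) \<in> L2 (dtP M T)"
    using ad unfolding adapted_def by (intro L2_bound[OF L2F_L2[OF w]]) blast+
  with ad show ?thesis by (simp add: L2F_def w_def)
qed

text \<open>Phrased as an almost-everywhere equality of propositions, so that almost-everywhere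
  facts about \<open>u\<close> transfer in both directions.\<close>

lemma stationary_iff:
  "AE (s, \<omega>) in dtP M T.
     (cR S s \<omega> *v u s \<omega> + transpose (cB S s \<omega>) *v Y s \<omega> + transpose (cD S s \<omega>) *v Z s \<omega> = 0)
     = (u s \<omega> = - feedback Y Z s \<omega>)"
  using R_invertible
proof eventually_elim
  case (elim z)
  obtain s \<omega> where z: "z = (s, \<omega>)" by (cases z)
  let ?w = "transpose (cB S s \<omega>) *v Y s \<omega> + transpose (cD S s \<omega>) *v Z s \<omega>"
  have inv: "matrix_inv (cR S s \<omega>) *v (cR S s \<omega> *v v) = v" "cR S s \<omega> *v (matrix_inv (cR S s \<omega>) *v v) = v" for v
    using elim unfolding z prod.case by blast+
  have "cR S s \<omega> *v u s \<omega> + ?w = 0 \<longleftrightarrow> cR S s \<omega> *v u s \<omega> = - ?w"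
    by (rule eq_neg_iff_add_eq_0[symmetric])
  also have "\<dots> \<longleftrightarrow> u s \<omega> = - (matrix_inv (cR S s \<omega>) *v ?w)"
  proof
    assume *: "cR S s \<omega> *v u s \<omega> = - ?w"
    show "u s \<omega> = - (matrix_inv (cR S s \<omega>) *v ?w)"
      using inv(1)[of "u s \<omega>"] unfolding * matrix_vector_mult_minus by (rule sym)
  next
    assume *: "u s \<omega> = - (matrix_inv (cR S s \<omega>) *v ?w)"
    show "cR S s \<omega> *v u s \<omega> = - ?w"
      unfolding * by (simp only: matrix_vector_mult_minus inv)
  qed
  finally show ?case unfolding z prod.case by (simp only: add.assoc)
qed

text \<open>The forward equation carries \<alpha> where the mean-field equation has the mean of its
  own state. The two coincide because this mean is \<alpha>, so a stationary control drives the
  mean-field system along the same \<open>X\<close>.\<close>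

lemma fbsde_constrained_pair:
  assumes sol: "fbsde_solution M W T S x \<alpha> l X Y Z" and \<alpha>: "\<alpha> \<in> L2 (dt T)"
    and mean: "AE t in dt T. mean M X t = \<alpha> t" and u: "u \<in> L2F M W T"
    and st: "AE (s, \<omega>) in dtP M T.
      cR S s \<omega> *v u s \<omega> + transpose (cB S s \<omega>) *v Y s \<omega> + transpose (cD S s \<omega>) *v Z s \<omega> = 0"
  shows "constrained_pair M W T S x \<alpha> u X"
proof -
  from sol have X: "X \<in> L2Fc M W T" and Y: "Y \<in> L2Fc M W T" and Z: "Z \<in> L2F M W T"
    and dX: "ito_diff M W T X
         (\<lambda>s \<omega>. cA S s \<omega> *v X s \<omega> - cB S s \<omega> *v feedback Y Z s \<omega> + cA1 S s \<omega> *v \<alpha> s)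
         (\<lambda>s \<omega>. cC S s \<omega> *v X s \<omega> - cD S s \<omega> *v feedback Y Z s \<omega> + cC1 S s \<omega> *v \<alpha> s)"
    and X0: "AE \<omega> in M. X 0 \<omega> = x"
    by (simp_all add: fbsde_solution_def Let_def)
  note XF = L2Fc_L2(2)[OF X] and V = feedback_L2F[OF L2Fc_L2(2)[OF Y] Z]
  have uV: "AE (s, \<omega>) in dtP M T. u s \<omega> = - feedback Y Z s \<omega>"
    using st stationary_iff[of u Y Z] by eventually_elim auto
  have mean': "AE (s, \<omega>) in dtP M T. mean M X s = \<alpha> s" by (rule AE_dtP_fst[OF mean])
  have "ito_diff M W T X (drift (mean M X) u X) (diffusion (mean M X) u X)"
  proof (rule ito_diff_cong[OF dX])
    show "(\<lambda>s \<omega>. cA S s \<omega> *v X s \<omega> - cB S s \<omega> *v feedback Y Z s \<omega> + cA1 S s \<omega> *v \<alpha> s) \<in> L2F M W T"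
      by (intro L2F_add L2F_diff L2F_mult A A1 B XF V L2F_deterministic \<alpha>)
    show "AE (s, \<omega>) in dtP M T. cA S s \<omega> *v X s \<omega> - cB S s \<omega> *v feedback Y Z s \<omega> + cA1 S s \<omega> *v \<alpha> s
        = drift (mean M X) u X s \<omega>"
      using uV mean' by eventually_elim (clarsimp simp only: matrix_vector_mult_minus split: prod.split, simp)
    show "AE (s, \<omega>) in dtP M T. cC S s \<omega> *v X s \<omega> - cD S s \<omega> *v feedback Y Z s \<omega> + cC1 S s \<omega> *v \<alpha> s
        = diffusion (mean M X) u X s \<omega>"
      using uV mean' by eventually_elim (clarsimp simp only: matrix_vector_mult_minus split: prod.split, simp)
  qed (intro drift_L2F diffusion_L2F mean_L2 XF u)+
  with X X0 u mean show ?thesis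
    by (simp add: constrained_pair_def mf_state_def frozen_state_def)
qed

text \<open>The duality at the heart of the argument: \<open>Y\<close> solves the adjoint equation, and \<open>l\<close> acts as a
  Lagrange multiplier for the constraint, because it is only tested against \<open>\<bbbE>(X' - X) = 0\<close>.\<close>

lemma fbsde_constrained_minimal:
  assumes sol: "fbsde_solution M W T S x \<alpha> l X Y Z" and \<alpha>: "\<alpha> \<in> L2 (dt T)" and l: "l \<in> L2 (dt T)"
    and st: "AE (s, \<omega>) in dtP M T.
      cR S s \<omega> *v u s \<omega> + transpose (cB S s \<omega>) *v Y s \<omega> + transpose (cD S s \<omega>) *v Z s \<omega> = 0"
    and uX: "constrained_pair M W T S x \<alpha> u X" and vX': "constrained_pair M W T S x \<alpha> v X'"
  shows "frozen_cost M T S \<alpha> u X \<le> frozen_cost M T S \<alpha> v X'"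
proof -
  from uX have X: "X \<in> L2Fc M W T" and u: "u \<in> L2F M W T"
    and dX: "ito_diff M W T X (drift (mean M X) u X) (diffusion (mean M X) u X)"
    and X0: "AE \<omega> in M. X 0 \<omega> = x" and mX: "AE t in dt T. mean M X t = \<alpha> t"
    by (auto simp: constrained_pair_def mf_state_def frozen_state_def)
  from vX' have X': "X' \<in> L2Fc M W T" and v: "v \<in> L2F M W T"
    and dX': "ito_diff M W T X' (drift (mean M X') v X') (diffusion (mean M X') v X')"
    and X'0: "AE \<omega> in M. X' 0 \<omega> = x" and mX': "AE t in dt T. mean M X' t = \<alpha> t"
    by (auto simp: constrained_pair_def mf_state_def frozen_state_def)
  define c where "c = (\<lambda>s \<omega>. - (transpose (cA S s \<omega>) *v Y s \<omega> + transpose (cC S s \<omega>) *v Z s \<omega>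
                  + cQ S s \<omega> *v X s \<omega> + l s))"
  from sol have Y: "Y \<in> L2Fc M W T" and Z: "Z \<in> L2F M W T" and dY: "ito_diff M W T Y c Z"
    and YT: "AE \<omega> in M. Y T \<omega> = cG S \<omega> *v X T \<omega>"
    by (simp_all add: fbsde_solution_def Let_def c_def)
  note XF = L2Fc_L2(2)[OF X] and X'F = L2Fc_L2(2)[OF X'] and YF = L2Fc_L2(2)[OF Y]
  have c: "c \<in> L2F M W T"
    unfolding c_def by (intro L2F_uminus L2F_add L2F_mult bounded_adapted_transpose A C Q(1) YF Z XF L2F_deterministic l)
  let ?b = "drift (mean M X) u X" and ?b' = "drift (mean M X') v X'"
  let ?\<sigma> = "diffusion (mean M X) u X" and ?\<sigma>' = "diffusion (mean M X') v X'"
  have b: "?b \<in> L2F M W T" "?b' \<in> L2F M W T" "?\<sigma> \<in> L2F M W T" "?\<sigma>' \<in> L2F M W T"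
    by (intro drift_L2F diffusion_L2F mean_L2 XF X'F u v)+
  have t0: "0 \<in> {0..T}" and tT: "T \<in> {0..T}" using T_pos by auto
  \<comment> \<open>Both states start at x, so the initial terms cancel when the two product
    formulas are subtracted.\<close>
  have X0Y0: "ip M (X' 0) (Y 0) = ip M (X 0) (Y 0)"
  proof (rule ip_cong_AE)
    show "AE \<omega> in M. X' 0 \<omega> = X 0 \<omega>" using X0 X'0 by eventually_elim simp
  qed (use L2_measurable[OF L2Fc_L2(1)[OF X t0]] L2_measurable[OF L2Fc_L2(1)[OF X' t0]]
      L2_measurable[OF L2Fc_L2(1)[OF Y t0]] in auto)
  define X1 X1' Y1 Z1 c1 u1 v1 where defs: "X1 = case_prod X" "X1' = case_prod X'" "Y1 = case_prod Y"
    "Z1 = case_prod Z" "c1 = case_prod c" "u1 = case_prod u" "v1 = case_prod v"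
  define b1 b1' s1 s1' where defs': "b1 = case_prod ?b" "b1' = case_prod ?b'" "s1 = case_prod ?\<sigma>" "s1' = case_prod ?\<sigma>'"
  let ?\<xi> = "\<lambda>z. X1' z - X1 z" and ?w = "\<lambda>z. v1 z - u1 z"
  have L: "X1 \<in> L2 (dtP M T)" "X1' \<in> L2 (dtP M T)" "Y1 \<in> L2 (dtP M T)" "Z1 \<in> L2 (dtP M T)" "c1 \<in> L2 (dtP M T)"
    "u1 \<in> L2 (dtP M T)" "v1 \<in> L2 (dtP M T)" "b1 \<in> L2 (dtP M T)" "b1' \<in> L2 (dtP M T)"
    "s1 \<in> L2 (dtP M T)" "s1' \<in> L2 (dtP M T)" "(\<lambda>z. l (fst z)) \<in> L2 (dtP M T)"
    unfolding defs defs' by (rule L2F_L2 XF X'F YF Z c u v b L2_lift l)+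
  note \<xi>L = L2_diff[OF L(2,1)] and wL = L2_diff[OF L(7,6)]
  have QX: "(\<lambda>z. case_prod (cQ S) z *v X1 z) \<in> L2 (dtP M T)"
    by (rule L2_matrix_vector_mult[OF bounded_adaptedD(1,2)[OF Q(1)] L(1)])
  have Ru: "(\<lambda>z. case_prod (cR S) z *v u1 z) \<in> L2 (dtP M T)"
    by (rule L2_matrix_vector_mult[OF bounded_adaptedD(1,2)[OF R(1)] L(6)])
  have XT: "X T \<in> L2 M" "X' T \<in> L2 M" "Y T \<in> L2 M"
    using L2Fc_L2(1)[OF X tT] L2Fc_L2(1)[OF X' tT] L2Fc_L2(1)[OF Y tT] by auto
  let ?db = "\<lambda>z. b1' z - b1 z" and ?d\<sigma> = "\<lambda>z. s1' z - s1 z"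
  have dL: "?db \<in> L2 (dtP M T)" "?d\<sigma> \<in> L2 (dtP M T)"
    by (rule L2_diff[OF L(9,8)], rule L2_diff[OF L(11,10)])
  have "ip M (\<lambda>\<omega>. X' T \<omega> - X T \<omega>) (Y T) = ip M (X' T) (Y T) - ip M (X T) (Y T)"
    by (rule ip_diff_left[OF XT(2,1,3)])
  also have "\<dots> = ip (dtP M T) ?\<xi> c1 + ip (dtP M T) ?db Y1 + ip (dtP M T) ?d\<sigma> Z1"
    unfolding ito_product_rule[OF X b(1) dX Y c dY] ito_product_rule[OF X' b(2) dX' Y c dY] X0Y0
      defs[symmetric] defs'[symmetric]
    using ip_diff_left[OF L(2,1,5)] ip_diff_left[OF L(9,8,3)] ip_diff_left[OF L(11,10,4)] by simp
  also have "\<dots> = (LINT z|dtP M T. ?\<xi> z \<bullet> c1 z + ?db z \<bullet> Y1 z + ?d\<sigma> z \<bullet> Z1 z)"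
    unfolding ip_def using L2_integrable_inner[OF \<xi>L L(5)] L2_integrable_inner[OF dL(1) L(3)]
      L2_integrable_inner[OF dL(2) L(4)] by simp
  also have "\<dots> = (LINT z|dtP M T. - (?\<xi> z \<bullet> (case_prod (cQ S) z *v X1 z)) - ?\<xi> z \<bullet> l (fst z)
      - ?w z \<bullet> (case_prod (cR S) z *v u1 z))"
  proof (rule integral_cong_AE)
    show "AE z in dtP M T. ?\<xi> z \<bullet> c1 z + ?db z \<bullet> Y1 z + ?d\<sigma> z \<bullet> Z1 z
      = - (?\<xi> z \<bullet> (case_prod (cQ S) z *v X1 z)) - ?\<xi> z \<bullet> l (fst z)
      - ?w z \<bullet> (case_prod (cR S) z *v u1 z)"
      \<comment> \<open>The adjoint terms in \<open>c\<close> cancel the \<open>cA\<close> and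
        \<open>cC\<close> parts of the state difference, the \<open>cA1\<close> and
        \<open>cC1\<close> parts drop out because both means equal \<alpha>, and stationarity turns
        the \<open>cB\<close> and \<open>cD\<close> parts into the control term with
        \<open>cR\<close>.\<close>
      using st AE_dtP_fst[OF mX] AE_dtP_fst[OF mX']
    proof eventually_elim
      case (elim z)
      obtain s \<omega> where z: "z = (s, \<omega>)" by (cases z)
      have m: "mean M X s = \<alpha> s" "mean M X' s = \<alpha> s"
        and r: "cR S s \<omega> *v u s \<omega> = - (transpose (cB S s \<omega>) *v Y s \<omega> + transpose (cD S s \<omega>) *v Z s \<omega>)"
        using elim unfolding z prod.case eq_neg_iff_add_eq_0 add.assoc by blast+
      show ?case
        unfolding z defs defs' prod.case fst_conv c_def r m
        by (simp add: inner_add_left inner_add_right inner_diff_left inner_diff_right inner_matrix_vector_mult)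
    qed
    show "(\<lambda>z. ?\<xi> z \<bullet> c1 z + ?db z \<bullet> Y1 z + ?d\<sigma> z \<bullet> Z1 z) \<in> borel_measurable (dtP M T)"
      by (intro borel_measurable_add borel_measurable_integrable L2_integrable_inner \<xi>L dL L)
    show "(\<lambda>z. - (?\<xi> z \<bullet> (case_prod (cQ S) z *v X1 z)) - ?\<xi> z \<bullet> l (fst z)
      - ?w z \<bullet> (case_prod (cR S) z *v u1 z)) \<in> borel_measurable (dtP M T)"
      by (intro borel_measurable_diff borel_measurable_uminus borel_measurable_integrable L2_integrable_inner \<xi>L wL QX Ru L)
  qed
  also have "\<dots> = - ip (dtP M T) ?\<xi> (\<lambda>z. case_prod (cQ S) z *v X1 z)
      - ip (dtP M T) ?\<xi> (\<lambda>z. l (fst z)) - ip (dtP M T) ?w (\<lambda>z. case_prod (cR S) z *v u1 z)"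
    unfolding ip_def using L2_integrable_inner[OF \<xi>L QX] L2_integrable_inner[OF \<xi>L L(12)]
      L2_integrable_inner[OF wL Ru] by simp
  also have "ip (dtP M T) ?\<xi> (\<lambda>z. l (fst z)) = 0"
  proof -
    have "ip (dtP M T) ?\<xi> (\<lambda>z. l (fst z)) = ip (dt T) l (mean M X') - ip (dt T) l (mean M X)"
      using ip_dtP_deterministic[OF l XF, folded defs] ip_dtP_deterministic[OF l X'F, folded defs] ip_diff_right[OF L(2,1,12)]
      by (simp add: ip_commute[of "dtP M T" ?\<xi>])
    also have "ip (dt T) l (mean M X') = ip (dt T) l (mean M X)"
    proof (rule ip_cong_AE)
      show "AE t in dt T. mean M X' t = mean M X t" using mX mX' by eventually_elim simp
    qed (use L2_measurable[OF l] L2_measurable[OF mean_L2[OF XF]] L2_measurable[OF mean_L2[OF X'F]] in auto)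
    finally show ?thesis by simp
  qed
  finally have dual: "ip M (\<lambda>\<omega>. X' T \<omega> - X T \<omega>) (Y T)
      = - ip (dtP M T) ?\<xi> (\<lambda>z. case_prod (cQ S) z *v X1 z)
        - ip (dtP M T) ?w (\<lambda>z. case_prod (cR S) z *v u1 z)" by simp
  have "ip M (\<lambda>\<omega>. cG S \<omega> *v X T \<omega>) (\<lambda>\<omega>. X' T \<omega> - X T \<omega>) = ip M (Y T) (\<lambda>\<omega>. X' T \<omega> - X T \<omega>)"
  proof (rule ip_cong_AE)
    show "AE \<omega> in M. cG S \<omega> *v X T \<omega> = Y T \<omega>" using YT by eventually_elim simp
    show "(\<lambda>\<omega>. cG S \<omega> *v X T \<omega>) \<in> borel_measurable M"
      by (rule L2_measurable[OF L2_matrix_vector_mult[OF measurable_F[OF G(1)] G(2) XT(1)]])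
  qed (use XT in \<open>auto intro!: L2_measurable L2_diff\<close>)
  \<comment> \<open>The mean does not vary under the constraint, so the \<open>cQ1\<close> slot
    receives \<alpha> - \<alpha>. The terminal condition for \<open>Y\<close> has identified the
    boundary term with the \<open>cG\<close> part.\<close>
  with dual have zero: "cform X1 \<alpha> u1 (X T) ?\<xi> (\<lambda>t. \<alpha> t - \<alpha> t) ?w (\<lambda>\<omega>. X' T \<omega> - X T \<omega>) = 0"
    by (simp add: cform_def ip_commute[of _ _ ?\<xi>] ip_commute[of _ _ ?w] ip_commute[of M "Y T"])
       (simp add: ip_def)
  have "0 \<le> \<delta> * ip (dtP M T) ?w ?w" using \<delta>(1) ip_self_nonneg[of "dtP M T" ?w] by simp
  then show ?thesis
    using cform_expansion[OF L(1,2) \<alpha> \<alpha> L(6,7) XT(1,2) zero]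
    unfolding frozen_cost_eq[OF \<alpha> u X, folded defs] frozen_cost_eq[OF \<alpha> v X', folded defs] by linarith
qed

section \<open>Dependence of the cost on the prescribed mean\<close>

lemma frozen_cost_cong:
  assumes \<alpha>: "\<alpha> \<in> L2 (dt T)" "\<beta> \<in> L2 (dt T)" "AE t in dt T. \<alpha> t = \<beta> t"
    and u: "u \<in> L2F M W T" and X: "X \<in> L2Fc M W T"
  shows "frozen_cost M T S \<alpha> u X = frozen_cost M T S \<beta> u X"
proof -
  have "ip (dtP M T) (\<lambda>z. case_prod (cQ1 S) z *v \<alpha> (fst z)) (\<lambda>z. \<alpha> (fst z))
      = ip (dtP M T) (\<lambda>z. case_prod (cQ1 S) z *v \<beta> (fst z)) (\<lambda>z. \<beta> (fst z))"
  proof (rule ip_cong_AE)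
    have ae: "AE z in dtP M T. \<alpha> (fst z) = \<beta> (fst z)"
      using AE_dtP_fst[OF \<alpha>(3)] by (simp add: split_beta')
    then show "AE z in dtP M T. \<alpha> (fst z) = \<beta> (fst z)" .
    from ae show "AE z in dtP M T. case_prod (cQ1 S) z *v \<alpha> (fst z) = case_prod (cQ1 S) z *v \<beta> (fst z)"
      by eventually_elim (simp only:)
  qed (rule L2_measurable L2_matrix_vector_mult bounded_adaptedD(1,2)[OF Q1(1)] L2_lift \<alpha>)+
  then show ?thesis
    unfolding frozen_cost_eq[OF \<alpha>(1) u X] frozen_cost_eq[OF \<alpha>(2) u X] by (simp only: cform_def)
qed

text \<open>The equation for \<open>\<alpha>\<close> says that the cost, as a quadratic function of the prescribed mean, has
  vanishing derivative at \<open>\<alpha>\<close>.\<close>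

lemma constrained_value_growth:
  fixes \<alpha> \<beta> :: "real \<Rightarrow> real^'n"
  assumes V: "linear_subspace V" "V \<subseteq> L2 (dt T)" "\<alpha> \<in> V" "\<beta> \<in> V"
    and K: "linear_op (dt T) V (dtP M T) (L2Fp M W T) K\<^sub>1" "linear_op (dt T) V (dtP M T) (L2Fp M W T) K\<^sub>2"
      "linear_op (dt T) V M (L2FT M W T) K\<^sub>3"
    and adj: "is_adjoint (dt T) V (dtP M T) (L2Fp M W T) K\<^sub>1 K\<^sub>1'"
      "is_adjoint (dt T) V (dtP M T) (L2Fp M W T) K\<^sub>2 K\<^sub>2'" "is_adjoint (dt T) V M (L2FT M W T) K\<^sub>3 K\<^sub>3'"
    and uX: "u \<in> L2F M W T" "X \<in> L2Fc M W T" "v \<in> L2F M W T" "X' \<in> L2Fc M W T"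
    and rep: "AE z in dtP M T. case_prod u z = p\<^sub>2 z + K\<^sub>2 \<alpha> z" "AE z in dtP M T. case_prod X z = p\<^sub>1 z + K\<^sub>1 \<alpha> z"
      "AE \<omega> in M. X T \<omega> = p\<^sub>3 \<omega> + K\<^sub>3 \<alpha> \<omega>"
    and rep': "AE z in dtP M T. case_prod v z = p\<^sub>2 z + K\<^sub>2 \<beta> z" "AE z in dtP M T. case_prod X' z = p\<^sub>1 z + K\<^sub>1 \<beta> z"
      "AE \<omega> in M. X' T \<omega> = p\<^sub>3 \<omega> + K\<^sub>3 \<beta> \<omega>"
    and dom: "(\<lambda>z. case_prod (cQ S) z *v K\<^sub>1 \<alpha> z) \<in> adjoint_domain (dt T) V (dtP M T) (L2Fp M W T) K\<^sub>1"
      "(\<lambda>z. case_prod (cQ S) z *v p\<^sub>1 z) \<in> adjoint_domain (dt T) V (dtP M T) (L2Fp M W T) K\<^sub>1"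
      "(\<lambda>z. case_prod (cR S) z *v K\<^sub>2 \<alpha> z) \<in> adjoint_domain (dt T) V (dtP M T) (L2Fp M W T) K\<^sub>2"
      "(\<lambda>z. case_prod (cR S) z *v p\<^sub>2 z) \<in> adjoint_domain (dt T) V (dtP M T) (L2Fp M W T) K\<^sub>2"
      "(\<lambda>\<omega>. cG S \<omega> *v K\<^sub>3 \<alpha> \<omega>) \<in> adjoint_domain (dt T) V M (L2FT M W T) K\<^sub>3"
      "(\<lambda>\<omega>. cG S \<omega> *v p\<^sub>3 \<omega>) \<in> adjoint_domain (dt T) V M (L2FT M W T) K\<^sub>3"
    and eq: "AE t in dt T.
           (K\<^sub>1' (\<lambda>z. case_prod (cQ S) z *v K\<^sub>1 \<alpha> z) t
             + mean M (cQ1 S) t *v \<alpha> t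
             + K\<^sub>2' (\<lambda>z. case_prod (cR S) z *v K\<^sub>2 \<alpha> z) t
             + K\<^sub>3' (\<lambda>\<omega>. cG S \<omega> *v K\<^sub>3 \<alpha> \<omega>) t)
           + (K\<^sub>1' (\<lambda>z. case_prod (cQ S) z *v p\<^sub>1 z) t
             + K\<^sub>2' (\<lambda>z. case_prod (cR S) z *v p\<^sub>2 z) t
             + K\<^sub>3' (\<lambda>\<omega>. cG S \<omega> *v p\<^sub>3 \<omega>) t) = 0"
  shows "frozen_cost M T S \<alpha> u X
      + \<delta> * ip (dtP M T) (\<lambda>z. case_prod v z - case_prod u z) (\<lambda>z. case_prod v z - case_prod u z)
    \<le> frozen_cost M T S \<beta> v X'"
proof -
  have \<alpha>: "\<alpha> \<in> L2 (dt T)" and \<beta>: "\<beta> \<in> L2 (dt T)" using V by auto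
  define X1 X1' u1 v1 where defs: "X1 = case_prod X" "X1' = case_prod X'" "u1 = case_prod u" "v1 = case_prod v"
  have L: "X1 \<in> L2 (dtP M T)" "X1' \<in> L2 (dtP M T)" "u1 \<in> L2 (dtP M T)" "v1 \<in> L2 (dtP M T)"
    unfolding defs by (rule L2F_L2 L2Fc_L2(2) uX)+
  have XT: "X T \<in> L2 M" "X' T \<in> L2 M" using L2Fc_L2(1)[OF uX(2)] L2Fc_L2(1)[OF uX(4)] T_pos by auto
  let ?d = "\<lambda>t. \<beta> t - \<alpha> t"
  note d = L2_diff[OF \<beta> \<alpha>]
  note 1 = adjoint_pairing[OF K(1) L2Fp_subset V(1,3,4) bounded_adaptedD(1,2)[OF Q(1)]
      L(1) rep(2)[folded defs] L(2) rep'(2)[folded defs] adj(1) dom(1,2)]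
  note 2 = adjoint_pairing[OF K(2) L2Fp_subset V(1,3,4) bounded_adaptedD(1,2)[OF R(1)]
      L(3) rep(1)[folded defs] L(4) rep'(1)[folded defs] adj(2) dom(3,4)]
  note 3 = adjoint_pairing[OF K(3) L2FT_subset V(1,3,4) measurable_F[OF G(1)] G(2)
      XT(1) rep(3) XT(2) rep'(3) adj(3) dom(5,6)]
  note 4 = mean_matrix_mult[OF Q1(1) \<alpha> d]
  \<comment> \<open>Each representation contributes one adjoint for its linear part and one for its
    part \<open>p\<close>; with the averaged \<open>cQ1\<close> term they add up to the left side of
    \<open>eq\<close>, tested against \<beta> - \<alpha>.\<close>
  have "cform X1 \<alpha> u1 (X T) (\<lambda>z. X1' z - X1 z) ?d (\<lambda>z. v1 z - u1 z) (\<lambda>\<omega>. X' T \<omega> - X T \<omega>)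
      = ip (dt T) (\<lambda>t. (K\<^sub>1' (\<lambda>z. case_prod (cQ S) z *v K\<^sub>1 \<alpha> z) t
             + mean M (cQ1 S) t *v \<alpha> t
             + K\<^sub>2' (\<lambda>z. case_prod (cR S) z *v K\<^sub>2 \<alpha> z) t
             + K\<^sub>3' (\<lambda>\<omega>. cG S \<omega> *v K\<^sub>3 \<alpha> \<omega>) t)
           + (K\<^sub>1' (\<lambda>z. case_prod (cQ S) z *v p\<^sub>1 z) t
             + K\<^sub>2' (\<lambda>z. case_prod (cR S) z *v p\<^sub>2 z) t
             + K\<^sub>3' (\<lambda>\<omega>. cG S \<omega> *v p\<^sub>3 \<omega>) t)) ?d"
    unfolding cform_def 1(3) 2(3) 3(3) 4(2)
    by (simp only: ip_add_left L2_add d 1(1,2) 2(1,2) 3(1,2) 4(1))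
  also have "\<dots> = ip (dt T) (\<lambda>_. 0) ?d"
    by (rule ip_cong_AE) (intro L2_measurable L2_add d 1(1,2) 2(1,2) 3(1,2) 4(1) borel_measurable_const eq | simp)+
  finally have zero: "cform X1 \<alpha> u1 (X T) (\<lambda>z. X1' z - X1 z) ?d (\<lambda>z. v1 z - u1 z) (\<lambda>\<omega>. X' T \<omega> - X T \<omega>) = 0"
    by (simp add: ip_def)
  show ?thesis
    using cform_expansion[OF L(1,2) \<alpha> \<beta> L(3,4) XT zero]
    unfolding frozen_cost_eq[OF \<alpha> uX(1,2), folded defs] frozen_cost_eq[OF \<beta> uX(3,4), folded defs] defs .
qed

end

text \<open>Every cost is at least the constrained minimum for the mean of its own state, and this
  is at least the constrained minimum for \<open>as\<close>, which stationary controls attain. For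
  an optimal control the chain must consist of equalities, which yields the converse
  implication.\<close>

theorem theorem2p10:
  fixes M :: "'w measure" and W :: "real \<Rightarrow> 'w \<Rightarrow> real" and T :: real
    and S :: "('w, 'n::finite, 'm::finite) lq_coeffs" and x :: "real^'n"
    and \<delta> :: real
    and ustar :: "(real \<Rightarrow> real^'n) \<Rightarrow> real \<Rightarrow> 'w \<Rightarrow> real^'m"
    and Xstar :: "(real \<Rightarrow> real^'n) \<Rightarrow> real \<Rightarrow> 'w \<Rightarrow> real^'n"
    and P :: "real^'n \<Rightarrow> real \<Rightarrow> real^'n"
    and L\<^sub>1 L\<^sub>2 :: "(real \<Rightarrow> real^'n) \<Rightarrow> real \<Rightarrow> real^'n"
    and V :: "(real \<Rightarrow> real^'n) set"
    and P\<^sub>1 :: "real^'n \<Rightarrow> real \<times> 'w \<Rightarrow> real^'n"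
    and P\<^sub>2 :: "real^'n \<Rightarrow> real \<times> 'w \<Rightarrow> real^'m"
    and P\<^sub>3 :: "real^'n \<Rightarrow> 'w \<Rightarrow> real^'n"
    and K\<^sub>1 :: "(real \<Rightarrow> real^'n) \<Rightarrow> real \<times> 'w \<Rightarrow> real^'n"
    and K\<^sub>2 :: "(real \<Rightarrow> real^'n) \<Rightarrow> real \<times> 'w \<Rightarrow> real^'m"
    and K\<^sub>3 :: "(real \<Rightarrow> real^'n) \<Rightarrow> 'w \<Rightarrow> real^'n"
    and K\<^sub>1' :: "(real \<times> 'w \<Rightarrow> real^'n) \<Rightarrow> real \<Rightarrow> real^'n"
    and K\<^sub>2' :: "(real \<times> 'w \<Rightarrow> real^'m) \<Rightarrow> real \<Rightarrow> real^'n"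
    and K\<^sub>3' :: "('w \<Rightarrow> real^'n) \<Rightarrow> real \<Rightarrow> real^'n"
    and as ls :: "real \<Rightarrow> real^'n"
    and X Y Z :: "real \<Rightarrow> 'w \<Rightarrow> real^'n"
  assumes prob: "prob_space M" and compl: "complete_measure M"
    and BM: "brownian_motion M W" and T: "0 < T"
    \<comment> \<open>coefficients\<close>
    and A: "bounded_adapted M W T (cA S)" and A1: "bounded_adapted M W T (cA1 S)"
    and B: "bounded_adapted M W T (cB S)"
    and C: "bounded_adapted M W T (cC S)" and C1: "bounded_adapted M W T (cC1 S)"
    and D: "bounded_adapted M W T (cD S)"
    and Q: "bounded_adapted M W T (cQ S)" "AE (s, \<omega>) in dtP M T. psd (cQ S s \<omega>)"
    and Q1: "bounded_adapted M W T (cQ1 S)" "AE (s, \<omega>) in dtP M T. psd (cQ1 S s \<omega>)"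
    and R: "bounded_adapted M W T (cR S)" "AE (s, \<omega>) in dtP M T. psd (cR S s \<omega>)"
    and G: "cG S \<in> borel_measurable (brownian_filtration M W T)"
           "\<exists>c. AE \<omega> in M. norm (cG S \<omega>) \<le> c" "AE \<omega> in M. psd (cG S \<omega>)"
    and \<delta>: "0 < \<delta>" "AE (s, \<omega>) in dtP M T. psd (cR S s \<omega> - \<delta> *\<^sub>R mat 1)"
    \<comment> \<open>the operators describing the mean of the forward component of the FBSDE\<close>
    and P: "linear_op_vec (dt T) (L2 (dt T)) P"
    and L1: "linear_op (dt T) (L2 (dt T)) (dt T) (L2 (dt T)) L\<^sub>1"
    and L2: "linear_op (dt T) (L2 (dt T)) (dt T) (L2 (dt T)) L\<^sub>2"
    and mean_fbsde: "\<And>y \<alpha> l X' Y' Z'. \<alpha> \<in> L2 (dt T) \<Longrightarrow> l \<in> L2 (dt T) \<Longrightarrow>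
           fbsde_solution M W T S y \<alpha> l X' Y' Z' \<Longrightarrow>
           AE t in dt T. mean M X' t = P y t + L\<^sub>1 l t + L\<^sub>2 \<alpha> t"
    \<comment> \<open>the constrained problems and the operators representing their solutions\<close>
    and ustar: "\<And>\<alpha>. \<alpha> \<in> attainable_means M W T S x \<Longrightarrow>
           constrained_minimizer M W T S x \<alpha> (ustar \<alpha>) (Xstar \<alpha>)"
    and Xstar: "\<And>\<alpha>. \<alpha> \<in> attainable_means M W T S x \<Longrightarrow>
           frozen_state M W T S x \<alpha> (ustar \<alpha>) (Xstar \<alpha>)"
    and V: "linear_subspace V" "V \<subseteq> L2 (dt T)" "attainable_means M W T S x \<subseteq> V"
    and P123: "linear_op_vec (dtP M T) (L2Fp M W T) P\<^sub>1"
           "linear_op_vec (dtP M T) (L2Fp M W T) P\<^sub>2"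
           "linear_op_vec M (L2FT M W T) P\<^sub>3"
    and K123: "linear_op (dt T) V (dtP M T) (L2Fp M W T) K\<^sub>1"
           "linear_op (dt T) V (dtP M T) (L2Fp M W T) K\<^sub>2"
           "linear_op (dt T) V M (L2FT M W T) K\<^sub>3"
    and rep: "\<And>\<alpha>. \<alpha> \<in> attainable_means M W T S x \<Longrightarrow>
             (AE (s, \<omega>) in dtP M T. ustar \<alpha> s \<omega> = P\<^sub>2 x (s, \<omega>) + K\<^sub>2 \<alpha> (s, \<omega>)) \<and>
             (AE (s, \<omega>) in dtP M T. Xstar \<alpha> s \<omega> = P\<^sub>1 x (s, \<omega>) + K\<^sub>1 \<alpha> (s, \<omega>)) \<and>
             (AE \<omega> in M. Xstar \<alpha> T \<omega> = P\<^sub>3 x \<omega> + K\<^sub>3 \<alpha> \<omega>)"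
    and adj: "is_adjoint (dt T) V (dtP M T) (L2Fp M W T) K\<^sub>1 K\<^sub>1'"
           "is_adjoint (dt T) V (dtP M T) (L2Fp M W T) K\<^sub>2 K\<^sub>2'"
           "is_adjoint (dt T) V M (L2FT M W T) K\<^sub>3 K\<^sub>3'"
    \<comment> \<open>the equation for \<open>\<alpha>\<^sup>*\<close>, preceded by the domain conditions under which it makes sense\<close>
    and as: "as \<in> attainable_means M W T S x"
    and dom: "(\<lambda>(s, \<omega>). cQ S s \<omega> *v K\<^sub>1 as (s, \<omega>)) \<in> adjoint_domain (dt T) V (dtP M T) (L2Fp M W T) K\<^sub>1"
           "(\<lambda>(s, \<omega>). cQ S s \<omega> *v P\<^sub>1 x (s, \<omega>)) \<in> adjoint_domain (dt T) V (dtP M T) (L2Fp M W T) K\<^sub>1"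
           "(\<lambda>(s, \<omega>). cR S s \<omega> *v K\<^sub>2 as (s, \<omega>)) \<in> adjoint_domain (dt T) V (dtP M T) (L2Fp M W T) K\<^sub>2"
           "(\<lambda>(s, \<omega>). cR S s \<omega> *v P\<^sub>2 x (s, \<omega>)) \<in> adjoint_domain (dt T) V (dtP M T) (L2Fp M W T) K\<^sub>2"
           "(\<lambda>\<omega>. cG S \<omega> *v K\<^sub>3 as \<omega>) \<in> adjoint_domain (dt T) V M (L2FT M W T) K\<^sub>3"
           "(\<lambda>\<omega>. cG S \<omega> *v P\<^sub>3 x \<omega>) \<in> adjoint_domain (dt T) V M (L2FT M W T) K\<^sub>3"
    and eq_as: "AE t in dt T.
           (K\<^sub>1' (\<lambda>(s, \<omega>). cQ S s \<omega> *v K\<^sub>1 as (s, \<omega>)) t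
             + mean M (cQ1 S) t *v as t
             + K\<^sub>2' (\<lambda>(s, \<omega>). cR S s \<omega> *v K\<^sub>2 as (s, \<omega>)) t
             + K\<^sub>3' (\<lambda>\<omega>. cG S \<omega> *v K\<^sub>3 as \<omega>) t)
           + (K\<^sub>1' (\<lambda>(s, \<omega>). cQ S s \<omega> *v P\<^sub>1 x (s, \<omega>)) t
             + K\<^sub>2' (\<lambda>(s, \<omega>). cR S s \<omega> *v P\<^sub>2 x (s, \<omega>)) t
             + K\<^sub>3' (\<lambda>\<omega>. cG S \<omega> *v P\<^sub>3 x \<omega>) t) = 0"
    \<comment> \<open>the equation for \<open>\<lambda>\<^sup>*\<close>\<close>
    and ls: "ls \<in> L2 (dt T)"
    and eq_ls: "AE t in dt T. as t = P x t + L\<^sub>1 ls t + L\<^sub>2 as t"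
    and XYZ: "fbsde_solution M W T S x as ls X Y Z"
  shows "(\<exists>u. optimal_control M W T S x u) \<and>
         (\<forall>u\<in>L2F M W T. optimal_control M W T S x u \<longleftrightarrow>
            (AE (s, \<omega>) in dtP M T.
               cR S s \<omega> *v u s \<omega> + transpose (cB S s \<omega>) *v Y s \<omega> + transpose (cD S s \<omega>) *v Z s \<omega> = 0))"
proof -
  interpret prob_space M by (rule prob)
  interpret lq_problem M W T S \<delta>
    by unfold_locales (rule BM T A A1 B C C1 D Q Q1 R G \<delta>)+
  let ?stat = "\<lambda>u. AE (s, \<omega>) in dtP M T.
      cR S s \<omega> *v u s \<omega> + transpose (cB S s \<omega>) *v Y s \<omega> + transpose (cD S s \<omega>) *v Z s \<omega> = 0"
  let ?J = "frozen_cost M T S as (ustar as) (Xstar as)"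
  have asL: "as \<in> L2 (dt T)" using as by (simp add: attainable_means_def)
  have mX: "AE t in dt T. mean M X t = as t"
    using mean_fbsde[OF asL ls XYZ] eq_ls by eventually_elim simp
  have X: "X \<in> L2Fc M W T" and Y: "Y \<in> L2F M W T" and Z: "Z \<in> L2F M W T"
    using XYZ L2Fc_L2(2) by (auto simp: fbsde_solution_def)
  \<comment> \<open>The stationarity condition solved for the control. It witnesses existence and
    represents the unique class of optimal controls.\<close>
  define u\<^sub>0 where "u\<^sub>0 = (\<lambda>s \<omega>. - feedback Y Z s \<omega>)"
  have u\<^sub>0: "u\<^sub>0 \<in> L2F M W T" unfolding u\<^sub>0_def by (rule L2F_uminus[OF feedback_L2F[OF Y Z]])
  have stat_iff: "?stat u \<longleftrightarrow> (AE (s, \<omega>) in dtP M T. u s \<omega> = u\<^sub>0 s \<omega>)" for u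
  proof
    assume "?stat u"
    then show "AE (s, \<omega>) in dtP M T. u s \<omega> = u\<^sub>0 s \<omega>"
      using stationary_iff[of u Y Z] unfolding u\<^sub>0_def by eventually_elim blast
  next
    assume "AE (s, \<omega>) in dtP M T. u s \<omega> = u\<^sub>0 s \<omega>"
    then show "?stat u"
      using stationary_iff[of u Y Z] unfolding u\<^sub>0_def by eventually_elim blast
  qed
  have minimizer: "constrained_pair M W T S x \<alpha> (ustar \<alpha>) (Xstar \<alpha>)"
    "\<And>v X'. constrained_pair M W T S x \<alpha> v X' \<Longrightarrow> frozen_cost M T S \<alpha> (ustar \<alpha>) (Xstar \<alpha>) \<le> frozen_cost M T S \<alpha> v X'"
    "\<And>v X'. constrained_pair M W T S x \<alpha> v X' \<Longrightarrow>
        frozen_cost M T S \<alpha> v X' \<le> frozen_cost M T S \<alpha> (ustar \<alpha>) (Xstar \<alpha>) \<Longrightarrow>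
        AE (s, \<omega>) in dtP M T. v s \<omega> = ustar \<alpha> s \<omega>"
    if "\<alpha> \<in> attainable_means M W T S x" for \<alpha>
    using ustar[OF that] unfolding constrained_minimizer_def by (blast intro: antisym)+
  \<comment> \<open>A stationary control is feasible for \<open>as\<close> and costs no more than
    the constrained minimizer, so uniqueness of the latter identifies the two.\<close>
  have stat: "mf_state M W T S x u X" "mf_cost M T S u X = ?J" "AE (s, \<omega>) in dtP M T. u s \<omega> = ustar as s \<omega>"
    if u: "u \<in> L2F M W T" and st: "?stat u" for u
  proof -
    have pair: "constrained_pair M W T S x as u X"
      by (rule fbsde_constrained_pair[OF XYZ asL mX u st])
    then show "mf_state M W T S x u X" by (simp add: constrained_pair_def)
    have le: "frozen_cost M T S as u X \<le> ?J"
      by (rule fbsde_constrained_minimal[OF XYZ asL ls st pair minimizer(1)[OF as]])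
    then show "AE (s, \<omega>) in dtP M T. u s \<omega> = ustar as s \<omega>"
      by (rule minimizer(3)[OF as pair])
    have "frozen_cost M T S (mean M X) u X = frozen_cost M T S as u X"
      by (rule frozen_cost_cong[OF mean_L2[OF L2Fc_L2(2)[OF X]] asL mX u X])
    with le minimizer(2)[OF as pair] show "mf_cost M T S u X = ?J" by (simp add: mf_cost_def)
  qed
  have growth: "?J + \<delta> * ip (dtP M T) (\<lambda>z. case_prod (ustar \<alpha>) z - case_prod (ustar as) z)
        (\<lambda>z. case_prod (ustar \<alpha>) z - case_prod (ustar as) z) \<le> frozen_cost M T S \<alpha> (ustar \<alpha>) (Xstar \<alpha>)"
    and ustar_L2F: "ustar \<alpha> \<in> L2F M W T"
    if \<alpha>: "\<alpha> \<in> attainable_means M W T S x" for \<alpha>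
  proof -
    have reg: "ustar \<beta> \<in> L2F M W T" "Xstar \<beta> \<in> L2Fc M W T" if "\<beta> \<in> attainable_means M W T S x" for \<beta>
      using minimizer(1)[OF that] by (auto simp: constrained_pair_def mf_state_def frozen_state_def)
    show "ustar \<alpha> \<in> L2F M W T" by (rule reg[OF \<alpha>])
    show "?J + \<delta> * ip (dtP M T) (\<lambda>z. case_prod (ustar \<alpha>) z - case_prod (ustar as) z)
        (\<lambda>z. case_prod (ustar \<alpha>) z - case_prod (ustar as) z) \<le> frozen_cost M T S \<alpha> (ustar \<alpha>) (Xstar \<alpha>)"
      \<comment> \<open>All constrained minimizers share the parts depending on x, so these take the
        place of the \<open>p\<close> terms, which cancel in differences.\<close>
      by (rule constrained_value_growth[OF V(1,2) subsetD[OF V(3) as] subsetD[OF V(3) \<alpha>] K123 adj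
          reg[OF as] reg[OF \<alpha>], where p\<^sub>1 = "P\<^sub>1 x" and p\<^sub>2 = "P\<^sub>2 x" and p\<^sub>3 = "P\<^sub>3 x"])
        (use rep[OF as] rep[OF \<alpha>] dom eq_as in \<open>simp_all only: split_beta' prod.collapse\<close>)
  qed
  \<comment> \<open>Freezing a competitor's own mean changes neither its state equation nor its
    cost, so it becomes feasible for the constrained problem with that mean.\<close>
  have lower: "\<exists>\<alpha>\<in>attainable_means M W T S x. constrained_pair M W T S x \<alpha> v X' \<and> mf_cost M T S v X' = frozen_cost M T S \<alpha> v X'"
    if v: "v \<in> L2F M W T" and X': "mf_state M W T S x v X'" for v X'
  proof -
    have "mean M X' \<in> L2 (dt T)"
      using X' by (intro mean_L2 L2Fc_L2(2)) (simp add: mf_state_def frozen_state_def)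
    moreover have "constrained_pair M W T S x (mean M X') v X'"
      using v X' by (simp add: constrained_pair_def)
    ultimately show ?thesis
      by (intro bexI[of _ "mean M X'"]) (auto simp: mf_cost_def attainable_means_def)
  qed
  have J_le: "?J \<le> mf_cost M T S v X'" if v: "v \<in> L2F M W T" and X': "mf_state M W T S x v X'" for v X'
  proof -
    obtain \<alpha> where \<alpha>: "\<alpha> \<in> attainable_means M W T S x" and pair: "constrained_pair M W T S x \<alpha> v X'"
      and cost: "mf_cost M T S v X' = frozen_cost M T S \<alpha> v X'"
      using lower[OF v X'] by blast
    have "0 \<le> \<delta> * ip (dtP M T) (\<lambda>z. case_prod (ustar \<alpha>) z - case_prod (ustar as) z)
        (\<lambda>z. case_prod (ustar \<alpha>) z - case_prod (ustar as) z)"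
      using \<delta>(1) ip_self_nonneg by (intro mult_nonneg_nonneg) auto
    with growth[OF \<alpha>] minimizer(2)[OF \<alpha> pair] cost show ?thesis by linarith
  qed
  have opt: "optimal_control M W T S x u" if u: "u \<in> L2F M W T" and st: "?stat u" for u
    unfolding optimal_control_def using u stat(1,2)[OF u st] J_le by (intro conjI exI[of _ X]) auto
  have st\<^sub>0: "?stat u\<^sub>0" unfolding stat_iff by simp
  show ?thesis
  proof (intro conjI ballI iffI)
    show "\<exists>u. optimal_control M W T S x u" using opt[OF u\<^sub>0 st\<^sub>0] by blast
  next
    fix u assume u: "u \<in> L2F M W T" and "optimal_control M W T S x u"
    then obtain X' where X': "mf_state M W T S x u X'"
      and "\<forall>v\<in>L2F M W T. \<forall>X''. mf_state M W T S x v X'' \<longrightarrow> mf_cost M T S u X' \<le> mf_cost M T S v X''"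
      by (auto simp: optimal_control_def)
    then have le: "mf_cost M T S u X' \<le> ?J" using u\<^sub>0 stat(1,2)[OF u\<^sub>0 st\<^sub>0] by fastforce
    obtain \<alpha> where \<alpha>: "\<alpha> \<in> attainable_means M W T S x" and pair: "constrained_pair M W T S x \<alpha> u X'"
      and cost: "mf_cost M T S u X' = frozen_cost M T S \<alpha> u X'"
      using lower[OF u X'] by blast
    let ?d = "\<lambda>z. case_prod (ustar \<alpha>) z - case_prod (ustar as) z"
    \<comment> \<open>The cost of \<open>u\<close> is at most \<open>?J\<close>, yet it is at least
      the constrained minimum at \<alpha>, which exceeds \<open>?J\<close> by at least this
      term.\<close>
    have "\<delta> * ip (dtP M T) ?d ?d \<le> 0"
      using growth[OF \<alpha>] minimizer(2)[OF \<alpha> pair] cost le by linarith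
    then have "ip (dtP M T) ?d ?d \<le> 0" using \<delta>(1) by (simp only: mult_le_0_iff) auto
    then have "AE z in dtP M T. ?d z = 0"
      by (intro ip_zero_AE L2_diff L2F_L2 ustar_L2F \<alpha> as)
    \<comment> \<open>The other gap in the same chain: \<open>u\<close> does no worse than the
      minimizer for its own mean, hence equals it.\<close>
    moreover have "frozen_cost M T S \<alpha> u X' \<le> frozen_cost M T S \<alpha> (ustar \<alpha>) (Xstar \<alpha>)"
    proof -
      have "0 \<le> \<delta> * ip (dtP M T) ?d ?d"
        using \<delta>(1) ip_self_nonneg by (intro mult_nonneg_nonneg) auto
      with growth[OF \<alpha>] cost le show ?thesis by linarith
    qed
    then have "AE (s, \<omega>) in dtP M T. u s \<omega> = ustar \<alpha> s \<omega>"
      by (rule minimizer(3)[OF \<alpha> pair])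
    ultimately have "AE (s, \<omega>) in dtP M T. u s \<omega> = u\<^sub>0 s \<omega>"
      using stat(3)[OF u\<^sub>0 st\<^sub>0] by eventually_elim auto
    then show "?stat u" by (simp only: stat_iff)
  qed (rule opt)
qed

end
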